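(* For every modular ortholattice $L$ of dimension (height) $2$, both decision problems $\mathrm{SAT}_L$ and $\mathrm{sat}_L$ are $\mathcal{NP}$-complete.
   Context: An ortholattice is a lattice $L$ with least element $0$ and greatest element $1$ and an order-reversing involution $\neg$ satisfying $a\wedge\neg a=0$ and $a\vee\neg a=1$. It is modular (a modular ortholattice, MOL) if $a\ge c$ implies $a\wedge(b\vee c)=(a\wedge b)\vee c$. The dimension (height) of $L$ is the cardinality of a maximal chain minus one. An ortholattice term is a syntactically correct expression built from variables $x_1,x_2,\ldots$ with the operations $\wedge,\vee,\neg$ and the constants $0,1$; $t_L(\bar a)$ denotes the value of $t$ in $L$ under an assignment $\bar a\in L^n$. Terms are encoded as binary strings $\langle t\rangle$ in a standard way. Then $\mathrm{SAT}_L=\{\langle t(x_1,\ldots,x_n)\rangle : n\in\mathbb N,\ \exists \bar a\in L^n:\ t_L(\bar a)=1\}$ (strong satisfiability) and $\mathrm{sat}_L=\{\langle t(x_1,\ldots,x_n)\rangle : n\in\mathbb N,\ \exists \bar a\in L^n:\ t_L(\bar a)\ne 0\}$ (weak satisfiability). $\mathcal{NP}$-completeness is with respect to polynomial-time many-one reductions by Turing machines. *)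

theory Defs
  imports "HOL-Library.Complemented_Lattices" "HOL-Computational_Algebra.Polynomial"
begin

section \<open>Modular ortholattices\<close>

text \<open>
  The class \<^class>\<open>orthocomplemented_lattice\<close> is the class of ortholattices (least and greatest
  element \<open>bot\<close> and \<open>top\<close>, orthocomplement \<open>uminus\<close>). Its additional operation \<open>minus\<close> is
  determined by the others through the law \<open>x - y = inf x (- y)\<close>.
\<close>

class modular_ortholattice = orthocomplemented_lattice +
  assumes modular_law: "c \<le> a \<Longrightarrow> inf a (sup b c) = sup (inf a b) c"

text \<open>
  All maximal chains of a modular lattice with a finite maximal chain have the same cardinality,
  so it does not matter which maximal chain is used.
\<close>

definition has_dimension :: "'a::order itself \<Rightarrow> nat \<Rightarrow> bool" where
  "has_dimension L d \<longleftrightarrow>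
    (\<exists>C::'a set. pred_on.maxchain UNIV (<) C \<and> finite C \<and> card C = Suc d)"


section \<open>Ortholattice terms and satisfiability\<close>

text \<open>\<open>Var i\<close> stands for the variable \<open>x\<^bsub>i+1\<^esub>\<close>.\<close>

datatype ol_term =
    Var nat
  | Zero
  | One
  | Neg ol_term
  | Meet ol_term ol_term
  | Join ol_term ol_term

primrec ol_eval :: "(nat \<Rightarrow> 'a::orthocomplemented_lattice) \<Rightarrow> ol_term \<Rightarrow> 'a" where
  "ol_eval a (Var i) = a i"
| "ol_eval a Zero = bot"
| "ol_eval a One = top"
| "ol_eval a (Neg t) = - ol_eval a t"
| "ol_eval a (Meet s t) = inf (ol_eval a s) (ol_eval a t)"
| "ol_eval a (Join s t) = sup (ol_eval a s) (ol_eval a t)"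

text \<open>Binary representation, most significant bit first.\<close>

fun binary :: "nat \<Rightarrow> bool list" where
  "binary n = (if n \<le> 1 then [n = 1] else binary (n div 2) @ [odd n])"

declare binary.simps [simp del]

text \<open>
  Terms are written in prefix (Polish) notation over an alphabet of eight letters: the constants,
  the three operations, a letter \<open>x\<close>, and the two binary digits. A variable is the letter \<open>x\<close>
  followed by its index in binary. Every letter is replaced by a block of three bits.
\<close>

primrec encode :: "ol_term \<Rightarrow> bool list" where
  "encode Zero = [False, False, False]"
| "encode One = [False, False, True]"
| "encode (Neg t) = [False, True, False] @ encode t"
| "encode (Meet s t) = [False, True, True] @ encode s @ encode t"
| "encode (Join s t) = [True, False, False] @ encode s @ encode t"
| "encode (Var i) = [True, False, True] @ concat (map (\<lambda>b. [True, True, b]) (binary (Suc i)))"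

text \<open>
  Only the values of the finitely many variables of a term matter, so total assignments \<open>a\<close> may be
  used in place of tuples.
\<close>

definition strong_SAT :: "'a::orthocomplemented_lattice itself \<Rightarrow> bool list set" where
  "strong_SAT L = {encode t | t. \<exists>a::nat \<Rightarrow> 'a. ol_eval a t = top}"

definition weak_SAT :: "'a::orthocomplemented_lattice itself \<Rightarrow> bool list set" where
  "weak_SAT L = {encode t | t. \<exists>a::nat \<Rightarrow> 'a. ol_eval a t \<noteq> bot}"


subsection \<open>The encoding is injective\<close>

lemma binary_small: "n \<le> 1 \<Longrightarrow> binary n = [n = 1]"
  by (subst binary.simps) simp

lemma binary_large: "\<not> n \<le> 1 \<Longrightarrow> binary n = binary (n div 2) @ [odd n]"
  by (subst binary.simps) simp

lemma binary_nonempty: "binary n \<noteq> []"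
  by (cases "n \<le> 1") (simp_all add: binary_small binary_large)

lemma binary_inject: "binary m = binary n \<Longrightarrow> m = n"
proof (induction m arbitrary: n rule: less_induct)
  case (less m)
  show ?case
  proof (cases "m \<le> 1")
    case True
    then have "binary n = [m = 1]" using less.prems by (simp add: binary_small)
    then have "n \<le> 1"
      using binary_large[of n] binary_nonempty[of "n div 2"] by (metis append1_eq_conv append_Nil)
    with True less.prems have "(m = 1) = (n = 1)" by (simp add: binary_small)
    with True \<open>n \<le> 1\<close> show ?thesis by linarith
  next
    case False
    then have m: "binary m = binary (m div 2) @ [odd m]" by (rule binary_large)
    have "\<not> n \<le> 1"
    proof
      assume "n \<le> 1"
      then have "binary m = [] @ [n = 1]" using less.prems by (simp add: binary_small)
      with m binary_nonempty show False by (metis append1_eq_conv)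
    qed
    then have "binary n = binary (n div 2) @ [odd n]" by (rule binary_large)
    with m less.prems have "binary (m div 2) = binary (n div 2)" and parity: "odd m = odd n"
      by (metis append1_eq_conv)+
    moreover have "m div 2 < m" using False by simp
    ultimately have "m div 2 = n div 2" using less.IH by blast
    with parity show ?thesis by presburger
  qed
qed

lemma digits_inject:
  assumes "concat (map (\<lambda>b. [True, True, b]) bs) @ xs = concat (map (\<lambda>b. [True, True, b]) cs) @ ys"
    and "take 2 xs \<noteq> [True, True]" and "take 2 ys \<noteq> [True, True]"
  shows "bs = cs \<and> xs = ys"
  using assms
proof (induction bs arbitrary: cs)
  case Nil
  then show ?case by (cases cs) auto
next
  case (Cons b bs)
  show ?case
  proof (cases cs)
    case Nil
    with Cons.prems(1) have "ys = True # True # b # concat (map (\<lambda>b. [True, True, b]) bs) @ xs"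
      by simp
    with Cons.prems(3) show ?thesis by simp
  next
    case (Cons c ds)
    with Cons.prems(1) have "b = c"
      "concat (map (\<lambda>b. [True, True, b]) bs) @ xs = concat (map (\<lambda>b. [True, True, b]) ds) @ ys"
      by simp_all
    with Cons.IH[OF this(2) Cons.prems(2,3)] Cons show ?thesis by simp
  qed
qed

lemma encode_no_digit: "take 2 (encode t @ xs) \<noteq> [True, True]"
  by (cases t) auto

lemma encode_append_inject:
  assumes "encode s @ xs = encode t @ ys"
    and "take 2 xs \<noteq> [True, True]" and "take 2 ys \<noteq> [True, True]"
  shows "s = t \<and> xs = ys"
  using assms
proof (induction s arbitrary: t xs ys)
  case (Var i)
  from Var.prems(1) obtain j where t: "t = Var j" by (cases t) auto
  have "binary (Suc i) = binary (Suc j) \<and> xs = ys"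
    by (rule digits_inject) (use Var.prems t in simp_all)
  with t binary_inject[of "Suc i" "Suc j"] show ?case by simp
next
  case Zero
  then show ?case by (cases t) auto
next
  case One
  then show ?case by (cases t) auto
next
  case (Neg s)
  from Neg.prems(1) obtain t1 where t: "t = Neg t1" by (cases t) auto
  with Neg.prems(1) have "encode s @ xs = encode t1 @ ys" by simp
  from Neg.IH[OF this Neg.prems(2,3)] t show ?case by simp
next
  case (Meet s1 s2)
  from Meet.prems(1) obtain t1 t2 where t: "t = Meet t1 t2" by (cases t) auto
  with Meet.prems(1) have "encode s1 @ encode s2 @ xs = encode t1 @ encode t2 @ ys" by simp
  from Meet.IH(1)[OF this encode_no_digit encode_no_digit]
  have "s1 = t1" and "encode s2 @ xs = encode t2 @ ys" by simp_all
  with Meet.IH(2)[OF this(2) Meet.prems(2,3)] t show ?case by simp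
next
  case (Join s1 s2)
  from Join.prems(1) obtain t1 t2 where t: "t = Join t1 t2" by (cases t) auto
  with Join.prems(1) have "encode s1 @ encode s2 @ xs = encode t1 @ encode t2 @ ys" by simp
  from Join.IH(1)[OF this encode_no_digit encode_no_digit]
  have "s1 = t1" and "encode s2 @ xs = encode t2 @ ys" by simp_all
  with Join.IH(2)[OF this(2) Join.prems(2,3)] t show ?case by simp
qed

lemma inj_encode: "inj encode"
  using encode_append_inject[of _ "[]" _ "[]"] by (auto intro: injI)


section \<open>Turing machines\<close>

text \<open>
  Nondeterministic Turing machines with \<open>num_tapes\<close> many two-way infinite tapes. A transition
  \<open>(q, rs, q', as)\<close> applies in state \<open>q\<close> when the heads read the symbols \<open>rs\<close>; it enters \<open>q'\<close> and
  performs on each tape the corresponding action in \<open>as\<close>: write a symbol, then move the head.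
  States and symbols are natural numbers; since the set of transitions is required to be
  finite, only finitely many of them are relevant to a machine. State \<open>0\<close> is the initial state
  and \<open>1\<close> the accepting one; symbol \<open>0\<close> is the blank, and \<open>1\<close> and \<open>2\<close> represent the bits.
\<close>

datatype move = Left_move | Stay | Right_move

record machine =
  num_tapes :: nat
  transitions :: "(nat \<times> nat list \<times> nat \<times> (nat \<times> move) list) set"

definition turing_machine :: "machine \<Rightarrow> bool" where
  "turing_machine M \<longleftrightarrow> num_tapes M \<ge> 1 \<and> finite (transitions M) \<and>
    (\<forall>(q, rs, q', as) \<in> transitions M. length rs = num_tapes M \<and> length as = num_tapes M)"

definition deterministic :: "machine \<Rightarrow> bool" where
  "deterministic M \<longleftrightarrow> (\<forall>q rs q' as q'' as'.
    (q, rs, q', as) \<in> transitions M \<longrightarrow> (q, rs, q'', as') \<in> transitions M \<longrightarrow> q' = q'' \<and> as = as')"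

text \<open>A configuration consists of the state and, for each tape, its contents and head position.\<close>

type_synonym tape = "int \<Rightarrow> nat"
type_synonym config = "nat \<times> (tape \<times> int) list"

primrec offset :: "move \<Rightarrow> int" where
  "offset Left_move = - 1"
| "offset Stay = 0"
| "offset Right_move = 1"

definition act :: "nat \<times> move \<Rightarrow> tape \<times> int \<Rightarrow> tape \<times> int" where
  "act = (\<lambda>(b, d) (t, h). (t(h := b), h + offset d))"

inductive step :: "machine \<Rightarrow> config \<Rightarrow> config \<Rightarrow> bool" for M :: machine where
  "(q, map (\<lambda>(t, h). t h) ts, q', as) \<in> transitions M \<Longrightarrow> step M (q, ts) (q', map2 act as ts)"

definition halting :: "machine \<Rightarrow> config \<Rightarrow> bool" where
  "halting M c \<longleftrightarrow> (\<nexists>c'. step M c c')"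

definition tape_of :: "bool list \<Rightarrow> tape" where
  "tape_of w = (\<lambda>i. if 0 \<le> i \<and> i < int (length w) then (if w ! nat i then 2 else 1) else 0)"

text \<open>The input is on the first tape, with the head on its first symbol; the other tapes are blank.\<close>

definition initial :: "machine \<Rightarrow> bool list \<Rightarrow> config" where
  "initial M x = (0, (tape_of x, 0) # replicate (num_tapes M - 1) (tape_of [], 0))"

definition accepts :: "machine \<Rightarrow> bool list \<Rightarrow> bool" where
  "accepts M x \<longleftrightarrow> (\<exists>c. (step M)\<^sup>*\<^sup>* (initial M x) c \<and> halting M c \<and> fst c = 1)"

text \<open>The output of a halted computation is what remains on the last tape.\<close>

definition computes :: "machine \<Rightarrow> (bool list \<Rightarrow> bool list) \<Rightarrow> bool" where
  "computes M f \<longleftrightarrow>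
    (\<forall>x. \<exists>c. (step M)\<^sup>*\<^sup>* (initial M x) c \<and> halting M c \<and> fst (last (snd c)) = tape_of (f x))"

text \<open>Every computation, along every nondeterministic branch, halts within the time bound.\<close>

definition polynomial_time :: "machine \<Rightarrow> bool" where
  "polynomial_time M \<longleftrightarrow>
    (\<exists>p::nat poly. \<forall>x n c. (step M ^^ n) (initial M x) c \<longrightarrow> n \<le> poly p (length x))"


section \<open>NP-completeness\<close>

definition NP :: "bool list set set" where
  "NP = {A. \<exists>M. turing_machine M \<and> polynomial_time M \<and> (\<forall>x. x \<in> A \<longleftrightarrow> accepts M x)}"

definition polynomial_reducible :: "bool list set \<Rightarrow> bool list set \<Rightarrow> bool" where
  "polynomial_reducible A B \<longleftrightarrow>
    (\<exists>M f. turing_machine M \<and> deterministic M \<and> polynomial_time M \<and> computes M f \<and>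
      (\<forall>x. x \<in> A \<longleftrightarrow> f x \<in> B))"

definition NP_complete :: "bool list set \<Rightarrow> bool" where
  "NP_complete B \<longleftrightarrow> B \<in> NP \<and> (\<forall>A \<in> NP. polynomial_reducible A B)"

end

(*
  In a modular ortholattice of height two, two distinct elements other than bot and top have infimum bot
  and supremum top. So its structure is given by the blocks {bot, q, - q, top}, and a term is evaluated
  knowing only which variables lie in which block, and with which sign. This gives membership in NP: guess
  these data and evaluate the term from right to left with a stack of values.

  For hardness, a tableau of a nondeterministic computation is described by Boolean variables, and every
  local constraint on the tableau by a disjunction of full minterms. As soon as two variables of such
  a constraint have values in different blocks, all of its minterms vanish. Hence if a conjunction of
  constraints takes a nonzero value p, any valuation of the lattice which selects one element of
  each block, among them p, turns the values of the variables into a Boolean solution. Conversely, a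
  Boolean solution makes the conjunction equal to top, so one and the same reduction serves both problems.

  Both Turing machines are obtained by compiling programs which operate on a fixed number of stacks.
*)

theory Submission
  imports Defs "HOL-Library.Sublist" "HOL-Library.Nat_Bijection"
begin

section \<open>Stack programs and their translation to Turing machines\<close>

text \<open>Ordinary clauses would not do for hardness: if x and y lie in different nontrivial
  blocks, all four clauses in x and y evaluate to \<open>top\<close>, although together they have no
  Boolean solution. Full minterms cure this, but their number is exponential in the number of
  variables of a constraint. It stays constant here because a constraint involves at most four cells
  and the number of tiles depends on the machine only, so every constraint is a copy of one of
  finitely many fixed templates. For membership, the delicate quantity is the number of nontrivial
  blocks. If it is finite, guessing more labels would describe values which the lattice does not
  have; if it is infinite, one label per variable is enough. Two features of the machine model shape
  the programs. Every branch has to halt, so they must be total even on malformed words and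
  certificates. The guessed string has exactly the length of the input, so a certificate has to be
  shorter than the term it belongs to.\<close>

text \<open>
  Every tape is used as a stack, with the head on the top element. A condition or a pushed symbol may
  depend on the tops of all stacks, where the top of an empty stack reads as the blank \<open>0\<close>.
\<close>

type_synonym store = "nat \<Rightarrow> nat list"

definition hd0 :: "nat list \<Rightarrow> nat" where
  "hd0 xs = (case xs of [] \<Rightarrow> 0 | x # _ \<Rightarrow> x)"

lemma hd0_simps [simp]: "hd0 [] = 0" "hd0 (x # xs) = x"
  by (simp_all add: hd0_def)

definition tops :: "store \<Rightarrow> nat \<Rightarrow> nat" where
  "tops \<sigma> = (\<lambda>j. hd0 (\<sigma> j))"

datatype prog =
    Skip
  | Push nat "(nat \<Rightarrow> nat) \<Rightarrow> nat"
  | Pop nat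
  | Seq prog prog (infixr ";;" 60)
  | Cond "(nat \<Rightarrow> nat) \<Rightarrow> bool" prog prog
  | Loop "(nat \<Rightarrow> nat) \<Rightarrow> bool" prog

primrec iterate :: "((nat \<Rightarrow> nat) \<Rightarrow> bool) \<Rightarrow> (store \<Rightarrow> store option) \<Rightarrow> nat \<Rightarrow> store \<Rightarrow> store option" where
  "iterate b F 0 \<sigma> = (if b (tops \<sigma>) then None else Some \<sigma>)"
| "iterate b F (Suc n) \<sigma> = (if b (tops \<sigma>) then Option.bind (F \<sigma>) (iterate b F n) else Some \<sigma>)"

text \<open>
  Execution fails when the empty stack is popped or when some loop is executed more than \<open>S\<close> times
  in a row; bounding every single loop by \<open>S\<close> bounds the running time by a polynomial in \<open>S\<close>. The
  symbol pushed on a stack cannot depend on the top of that stack, as the machine has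
  already moved to the empty cell above when it chooses the symbol.
\<close>

primrec exec :: "nat \<Rightarrow> prog \<Rightarrow> store \<Rightarrow> store option" where
  "exec S Skip \<sigma> = Some \<sigma>"
| "exec S (Push j f) \<sigma> = Some (\<sigma>(j := f ((tops \<sigma>)(j := 0)) # \<sigma> j))"
| "exec S (Pop j) \<sigma> = (if \<sigma> j = [] then None else Some (\<sigma>(j := tl (\<sigma> j))))"
| "exec S (p ;; q) \<sigma> = Option.bind (exec S p \<sigma>) (exec S q)"
| "exec S (Cond b p q) \<sigma> = (if b (tops \<sigma>) then exec S p \<sigma> else exec S q \<sigma>)"
| "exec S (Loop b p) \<sigma> = iterate b (exec S p) S \<sigma>"

text \<open>A push takes two steps, one to move up and one to write; a round of a loop pays for its
  test and for the jump back. A conditional adds its branches instead of taking the maximum, which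
  keeps the bound a polynomial in \<open>S\<close>.\<close>

primrec time :: "nat \<Rightarrow> prog \<Rightarrow> nat" where
  "time S Skip = 0"
| "time S (Push j f) = 2"
| "time S (Pop j) = 1"
| "time S (p ;; q) = time S p + time S q"
| "time S (Cond b p q) = time S p + time S q + 2"
| "time S (Loop b p) = S * (time S p + 2) + 1"

lemma time_poly: "\<exists>r::nat poly. \<forall>S. time S p = poly r S"
proof (induction p)
  case Skip
  show ?case by (rule exI[of _ 0]) simp
next
  case (Push j f)
  show ?case by (rule exI[of _ "[:2:]"]) simp
next
  case (Pop j)
  show ?case by (rule exI[of _ "[:1:]"]) simp
next
  case (Seq p q)
  then obtain r s where "\<forall>S. time S p = poly r S" "\<forall>S. time S q = poly s S" by blast
  then show ?case by (intro exI[of _ "r + s"]) simp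
next
  case (Cond b p q)
  then obtain r s where "\<forall>S. time S p = poly r S" "\<forall>S. time S q = poly s S" by blast
  then show ?case by (intro exI[of _ "r + s + [:2:]"]) simp
next
  case (Loop b p)
  then obtain r where "\<forall>S. time S p = poly r S" by blast
  then show ?case by (intro exI[of _ "[:0, 1:] * (r + [:2:]) + [:1:]"]) simp
qed

primrec wf :: "nat \<Rightarrow> nat \<Rightarrow> prog \<Rightarrow> bool" where
  "wf k K Skip \<longleftrightarrow> True"
| "wf k K (Push j f) \<longleftrightarrow> j < k \<and> (\<forall>r. (\<forall>i. r i < K) \<longrightarrow> f r < K)"
| "wf k K (Pop j) \<longleftrightarrow> j < k"
| "wf k K (p ;; q) \<longleftrightarrow> wf k K p \<and> wf k K q"
| "wf k K (Cond b p q) \<longleftrightarrow> wf k K p \<and> wf k K q"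
| "wf k K (Loop b p) \<longleftrightarrow> wf k K p"

text \<open>Stacks from \<open>k\<close> on have no tape. Keeping them empty makes conditions that
  inspect them agree with \<open>reads\<close>, which returns 0 there.\<close>

definition ok :: "nat \<Rightarrow> nat \<Rightarrow> store \<Rightarrow> bool" where
  "ok k K \<sigma> \<longleftrightarrow> (\<forall>j. set (\<sigma> j) \<subseteq> {..<K}) \<and> (\<forall>j\<ge>k. \<sigma> j = [])"

lemma ok_tops: "ok k K \<sigma> \<Longrightarrow> 0 < K \<Longrightarrow> tops \<sigma> j < K"
  by (cases "\<sigma> j") (auto simp: ok_def tops_def dest: spec[of _ j])

lemma ok_upd: "ok k K \<sigma> \<Longrightarrow> j < k \<Longrightarrow> set xs \<subseteq> {..<K} \<Longrightarrow> ok k K (\<sigma>(j := xs))"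
  by (auto simp: ok_def)

lemma ok_tl: "ok k K \<sigma> \<Longrightarrow> j < k \<Longrightarrow> ok k K (\<sigma>(j := tl (\<sigma> j)))"
  using set_mono_suffix[OF suffix_tl, of "\<sigma> j"] by (intro ok_upd) (auto simp: ok_def)

lemma ok_push: "ok k K \<sigma> \<Longrightarrow> j < k \<Longrightarrow> x < K \<Longrightarrow> ok k K (\<sigma>(j := x # \<sigma> j))"
  by (rule ok_upd) (auto simp: ok_def)

section \<open>Compilation of programs into transitions\<close>

type_synonym instr = "nat list \<Rightarrow> nat \<times> (nat \<times> move) list"

definition reads :: "nat list \<Rightarrow> nat \<Rightarrow> nat" where
  "reads rs = (\<lambda>j. if j < length rs then rs ! j else 0)"

definition only :: "nat \<Rightarrow> nat \<Rightarrow> nat \<times> move \<Rightarrow> nat list \<Rightarrow> (nat \<times> move) list" where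
  "only k j a rs = map (\<lambda>i. if i = j then a else (rs ! i, Stay)) [0..<k]"

definition keep :: "nat \<Rightarrow> nat list \<Rightarrow> (nat \<times> move) list" where
  "keep k rs = map (\<lambda>i. (rs ! i, Stay)) [0..<k]"

primrec len :: "prog \<Rightarrow> nat" where
  "len Skip = 0"
| "len (Push j f) = 2"
| "len (Pop j) = 1"
| "len (p ;; q) = len p + len q"
| "len (Cond b p q) = len p + len q + 2"
| "len (Loop b p) = len p + 2"

text \<open>The instruction at position \<open>i\<close> of \<open>code k p n\<close> belongs to state \<open>n + i\<close>, and control leaves
  the code in state \<open>n + len p\<close>.\<close>

primrec code :: "nat \<Rightarrow> prog \<Rightarrow> nat \<Rightarrow> instr list" where
  "code k Skip n = []"
| "code k (Push j f) n =
    [\<lambda>rs. (n + 1, only k j (rs ! j, Right_move) rs), \<lambda>rs. (n + 2, only k j (f (reads rs), Stay) rs)]"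
| "code k (Pop j) n = [\<lambda>rs. (n + 1, only k j (0, Left_move) rs)]"
| "code k (p ;; q) n = code k p n @ code k q (n + len p)"
| "code k (Cond b p q) n =
    [\<lambda>rs. (if b (reads rs) then n + 1 else n + len p + 2, keep k rs)] @ code k p (n + 1) @
    [\<lambda>rs. (n + len p + len q + 2, keep k rs)] @ code k q (n + len p + 2)"
| "code k (Loop b p) n =
    [\<lambda>rs. (if b (reads rs) then n + 1 else n + len p + 2, keep k rs)] @ code k p (n + 1) @
    [\<lambda>rs. (n, keep k rs)]"

lemma length_code [simp]: "length (code k p n) = len p"
  by (induction p arbitrary: n) auto

text \<open>Code placed at 2 therefore never re-enters the guessing state 0.\<close>

lemma code_target: "ins \<in> set (code k p n) \<Longrightarrow> n \<le> fst (ins rs) \<and> length (snd (ins rs)) = k"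
  by (induction p arbitrary: n) (fastforce simp: only_def keep_def)+

definition words :: "nat \<Rightarrow> nat \<Rightarrow> nat list set" where
  "words k K = {rs. length rs = k \<and> set rs \<subseteq> {..<K}}"

lemma finite_words: "finite (words k K)"
  using finite_lists_length_eq[of "{..<K}" k] by (simp add: words_def conj_commute)

text \<open>Containment rather than equality, so that the property passes to subprograms and
  tolerates the transitions around the code.\<close>

definition placed :: "nat \<Rightarrow> nat \<Rightarrow> machine \<Rightarrow> instr list \<Rightarrow> nat \<Rightarrow> bool" where
  "placed k K M c n \<longleftrightarrow> (\<forall>i < length c. \<forall>rs \<in> words k K.
    (n + i, rs, fst ((c ! i) rs), snd ((c ! i) rs)) \<in> transitions M)"

lemma placed_append [simp]:
  "placed k K M (c @ d) n \<longleftrightarrow> placed k K M c n \<and> placed k K M d (n + length c)"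
proof -
  have "placed k K M d (n + length c)" if "placed k K M (c @ d) n"
    unfolding placed_def
  proof (intro allI impI ballI)
    fix i rs assume "i < length d" "rs \<in> words k K"
    then show "(n + length c + i, rs, fst ((d ! i) rs), snd ((d ! i) rs)) \<in> transitions M"
      using that[unfolded placed_def, rule_format, of "length c + i" rs] by (simp add: add.assoc)
  qed
  moreover have "placed k K M c n" if "placed k K M (c @ d) n"
    unfolding placed_def
  proof (intro allI impI ballI)
    fix i rs assume "i < length c" "rs \<in> words k K"
    then show "(n + i, rs, fst ((c ! i) rs), snd ((c ! i) rs)) \<in> transitions M"
      using that[unfolded placed_def, rule_format, of i rs] by (simp add: nth_append)
  qed
  moreover have "placed k K M (c @ d) n" if "placed k K M c n" "placed k K M d (n + length c)"
    unfolding placed_def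
  proof (intro allI impI ballI)
    fix i rs assume i: "i < length (c @ d)" "rs \<in> words k K"
    show "(n + i, rs, fst (((c @ d) ! i) rs), snd (((c @ d) ! i) rs)) \<in> transitions M"
    proof (cases "i < length c")
      case True
      then show ?thesis using that(1) i(2) by (simp add: placed_def nth_append)
    next
      case False
      then show ?thesis using that(2)[unfolded placed_def, rule_format, of "i - length c" rs] i
        by (simp add: nth_append)
    qed
  qed
  ultimately show ?thesis by blast
qed

lemma placed_Cons:
  "placed k K M (x # d) n \<longleftrightarrow>
    (\<forall>rs \<in> words k K. (n, rs, fst (x rs), snd (x rs)) \<in> transitions M) \<and> placed k K M d (n + 1)"
  using placed_append[of k K M "[x]" d n] by (simp add: placed_def)

text \<open>Cell \<open>b\<close> holds the bottom element. For the empty stack the head stands on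
  the blank cell \<open>b - 1\<close>, so that reading always yields \<open>hd0\<close>.\<close>

definition stack :: "int \<Rightarrow> nat list \<Rightarrow> tape \<times> int" where
  "stack b xs = (\<lambda>i. if b \<le> i \<and> i < b + int (length xs) then rev xs ! nat (i - b) else 0,
    b + int (length xs) - 1)"

definition config_of :: "nat \<Rightarrow> (nat \<Rightarrow> int) \<Rightarrow> store \<Rightarrow> (tape \<times> int) list" where
  "config_of k b \<sigma> = map (\<lambda>j. stack (b j) (\<sigma> j)) [0..<k]"

lemma stack_read: "(case stack b xs of (t, h) \<Rightarrow> t h) = hd0 xs"
  by (cases xs) (auto simp: stack_def nth_append)

lemma act_stay: "act (hd0 xs, Stay) (stack b xs) = stack b xs"
  using stack_read[of b xs] by (auto simp: act_def split: prod.splits)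

text \<open>The cell above the top is blank, so moving there amounts to pushing 0; the second
  instruction of a push overwrites it. Between the two the head reads 0 on this tape, whence
  \<open>(tops \<sigma>)(j := 0)\<close> in the semantics.\<close>

lemma act_push: "act (hd0 xs, Right_move) (stack b xs) = stack b (0 # xs)"
  by (cases xs) (auto simp: act_def stack_def fun_eq_iff nth_append)

lemma act_write: "act (a, Stay) (stack b (x # xs)) = stack b (a # xs)"
  by (auto simp: act_def stack_def fun_eq_iff nth_append)

lemma act_pop: "act (0, Left_move) (stack b (x # xs)) = stack b xs"
  by (auto simp: act_def stack_def fun_eq_iff nth_append)

lemma config_reads:
  "map (\<lambda>(t, h). t h) (config_of k b \<sigma>) = map (tops \<sigma>) [0..<k]"
  using stack_read by (simp add: config_of_def tops_def)

lemma reads_tops: "ok k K \<sigma> \<Longrightarrow> reads (map (tops \<sigma>) [0..<k]) = tops \<sigma>"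
  by (auto simp: reads_def ok_def tops_def fun_eq_iff)

lemma config_words: "ok k K \<sigma> \<Longrightarrow> 0 < K \<Longrightarrow> map (tops \<sigma>) [0..<k] \<in> words k K"
  by (auto simp: words_def ok_tops)

lemma act_only:
  assumes "j < k" "act a (stack (b j) (\<sigma> j)) = stack (b j) xs"
  shows "map2 act (only k j a (map (tops \<sigma>) [0..<k])) (config_of k b \<sigma>) = config_of k b (\<sigma>(j := xs))"
  using assms act_stay
  by (auto intro!: nth_equalityI simp: only_def config_of_def tops_def)

lemma act_keep: "map2 act (keep k (map (tops \<sigma>) [0..<k])) (config_of k b \<sigma>) = config_of k b \<sigma>"
  using act_stay by (auto intro!: nth_equalityI simp: keep_def config_of_def tops_def)

lemma step_instr:
  assumes "placed k K M (x # d) n" "ok k K \<sigma>" "0 < K"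
    and "x (map (tops \<sigma>) [0..<k]) = (q, as)"
  shows "step M (n, config_of k b \<sigma>) (q, map2 act as (config_of k b \<sigma>))"
  using step.intros[of n "config_of k b \<sigma>" q as M] assms config_words[OF assms(2,3)]
  by (force simp: placed_Cons config_reads)

lemma relpowp_step: "R x y \<Longrightarrow> (R ^^ m) y z \<Longrightarrow> (R ^^ (m + 1)) x z"
  using relpowp_Suc_I2[of R x y m z] by (simp only: Suc_eq_plus1)

lemma relpowp_step2: "R x y \<Longrightarrow> (R ^^ m) y z \<Longrightarrow> R z w \<Longrightarrow> (R ^^ (m + 2)) x w"
  using relpowp_step[OF _ relpowp_Suc_I[of m R y z w]] by (simp only: Suc_eq_plus1 add.assoc one_add_one)

lemma relpowp_plus: "(R ^^ m) x y \<Longrightarrow> (R ^^ n) y z \<Longrightarrow> (R ^^ (m + n)) x z"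
  by (auto simp: relpowp_add)

lemma exec_steps:
  fixes b :: "nat \<Rightarrow> int"
  assumes "0 < K" "wf k K p" "ok k K \<sigma>" "exec S p \<sigma> = Some \<tau>" "placed k K M (code k p n) n"
  shows "ok k K \<tau> \<and>
    (\<exists>m \<le> time S p. (step M ^^ m) (n, config_of k b \<sigma>) (n + len p, config_of k b \<tau>))"
  using assms(2-)
proof (induction p arbitrary: n \<sigma> \<tau>)
  case Skip
  then show ?case by (auto intro: exI[of _ 0])
next
  case (Push j f)
  let ?z = "\<sigma>(j := 0 # \<sigma> j)" and ?x = "f ((tops \<sigma>)(j := 0))"
  have j: "j < k" and tau: "\<tau> = \<sigma>(j := ?x # \<sigma> j)" using Push.prems by auto
  have z: "ok k K ?z" using ok_push[OF Push.prems(2) j] assms(1) by simp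
  have topz: "tops ?z = (tops \<sigma>)(j := 0)" by (auto simp: tops_def)
  have "?x < K" using Push.prems(1) ok_tops[OF Push.prems(2) assms(1)] assms(1) by simp
  then have ok: "ok k K \<tau>" using ok_push[OF Push.prems(2) j] tau by simp
  have x: "only k j (map (tops \<sigma>) [0..<k] ! j, Right_move) = only k j (hd0 (\<sigma> j), Right_move)"
    using j by (simp add: tops_def)
  have s1: "step M (n, config_of k b \<sigma>) (n + 1, config_of k b ?z)"
    using step_instr[OF Push.prems(4)[unfolded code.simps] Push.prems(2) assms(1) refl, of b] j
      act_only[where b = b, OF j act_push] x by simp
  have s2: "step M (n + 1, config_of k b ?z) (n + 2, config_of k b \<tau>)"
    using step_instr[of k K M "\<lambda>rs. (n + 2, only k j (f (reads rs), Stay) rs)" "[]" "n + 1" ?z _ _ b]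
      Push.prems(4) z assms(1) reads_tops[OF z]
      act_only[where b = b and \<sigma> = ?z and a = "(?x, Stay)" and xs = "?x # \<sigma> j", OF j] act_write topz tau
    by (simp add: placed_Cons)
  have "(step M ^^ 2) (n, config_of k b \<sigma>) (n + 2, config_of k b \<tau>)"
    using s1 s2 by (auto simp: numeral_2_eq_2)
  then show ?case using ok by (auto intro: exI[of _ 2])
next
  case (Pop j)
  then obtain x xs where xs: "\<sigma> j = x # xs" and tau: "\<tau> = \<sigma>(j := xs)" and j: "j < k"
    by (cases "\<sigma> j") auto
  have ok: "ok k K \<tau>" using ok_tl[OF Pop.prems(2) j] tau xs by simp
  have "step M (n, config_of k b \<sigma>) (n + 1, config_of k b \<tau>)"
    using step_instr[OF Pop.prems(4)[unfolded code.simps] Pop.prems(2) assms(1) refl, of b]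
      act_only[where b = b and \<sigma> = \<sigma> and a = "(0, Left_move)" and xs = xs, OF j] act_pop xs tau by simp
  then have "(step M ^^ 1) (n, config_of k b \<sigma>) (n + len (Pop j), config_of k b \<tau>)"
      by (simp only: relpowp_1 len.simps)
  then show ?case using ok by (metis time.simps(3) order_refl)
next
  case (Seq p q)
  obtain \<rho> where p: "exec S p \<sigma> = Some \<rho>" and q: "exec S q \<rho> = Some \<tau>"
    using Seq.prems(3) by (auto split: bind_splits)
  obtain m1 where 1: "ok k K \<rho>" "m1 \<le> time S p"
    "(step M ^^ m1) (n, config_of k b \<sigma>) (n + len p, config_of k b \<rho>)"
    using Seq.IH(1)[OF _ _ p, of n] Seq.prems by auto
  obtain m2 where 2: "ok k K \<tau>" "m2 \<le> time S q"
    "(step M ^^ m2) (n + len p, config_of k b \<rho>) (n + len p + len q, config_of k b \<tau>)"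
    using Seq.IH(2)[OF _ 1(1) q, of "n + len p"] Seq.prems by auto
  show ?case using relpowp_plus[OF 1(3) 2(3)] 1 2 by (auto intro!: exI[of _ "m1 + m2"] simp: add.assoc)
next
  case (Cond c p q)
  note pl = Cond.prems(4)[unfolded code.simps append_Cons append_Nil]
  note st = step_instr[OF pl Cond.prems(2) assms(1) refl, of b, unfolded fst_conv snd_conv
      reads_tops[OF Cond.prems(2)] act_keep]
  show ?case
  proof (cases "c (tops \<sigma>)")
    case True
    obtain m where m: "ok k K \<tau>" "m \<le> time S p"
      "(step M ^^ m) (n + 1, config_of k b \<sigma>) (n + 1 + len p, config_of k b \<tau>)"
      using Cond.IH(1)[of \<sigma> \<tau> "n + 1"] Cond.prems pl True by (auto simp: placed_Cons)
    have "step M (n + 1 + len p, config_of k b \<tau>) (n + len p + len q + 2, config_of k b \<tau>)"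
      using step_instr[of k K M "\<lambda>rs. (n + len p + len q + 2, keep k rs)" _ "n + 1 + len p" \<tau>] pl m(1)
        assms(1) act_keep by (fastforce simp: placed_Cons)
    with st m(3) True have "(step M ^^ (m + 2)) (n, config_of k b \<sigma>) (n + len (Cond c p q),
        config_of k b \<tau>)"
      by (intro relpowp_step2[where R = "step M"]) (simp_all add: add.assoc)
    then show ?thesis using m(1,2) by (intro conjI exI[of _ "m + 2"]) simp_all
  next
    case False
    obtain m where m: "ok k K \<tau>" "m \<le> time S q"
      "(step M ^^ m) (n + len p + 2, config_of k b \<sigma>) (n + len p + 2 + len q, config_of k b \<tau>)"
      using Cond.IH(2)[of \<sigma> \<tau> "n + len p + 2"] Cond.prems pl False by (auto simp: placed_Cons)
    with st False have "(step M ^^ (m + 1)) (n, config_of k b \<sigma>) (n + len (Cond c p q), config_of k b \<tau>)"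
      by (intro relpowp_step[where R = "step M"]) (simp_all add: algebra_simps)
    then show ?thesis using m(1,2) by (intro conjI exI[of _ "m + 1"]) simp_all
  qed
next
  case (Loop c p)
  note pl = Loop.prems(4)[unfolded code.simps append_Cons append_Nil]
  \<comment> \<open>The number \<open>N\<close> of rounds left is decoupled from the bound
    \<open>S\<close> for the loops inside the body; only the former decreases.\<close>
  have *: "ok k K \<tau> \<and> (\<exists>m \<le> N * (time S p + 2) + 1.
      (step M ^^ m) (n, config_of k b \<sigma>) (n + len p + 2, config_of k b \<tau>))"
    if "iterate c (exec S p) N \<sigma> = Some \<tau>" "ok k K \<sigma>" for N \<sigma>
    using that
  proof (induction N arbitrary: \<sigma>)
    case 0
    note st = step_instr[OF pl 0(2) assms(1) refl, of b, unfolded fst_conv snd_conv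
      reads_tops[OF 0(2)] act_keep]
    show ?case using 0 st by (auto split: if_splits intro!: exI[of _ 1])
  next
    case (Suc N)
    note st = step_instr[OF pl Suc.prems(2) assms(1) refl, of b, unfolded fst_conv snd_conv
      reads_tops[OF Suc.prems(2)] act_keep]
    show ?case
    proof (cases "c (tops \<sigma>)")
      case False
      then show ?thesis using Suc.prems st by (auto intro!: exI[of _ 1])
    next
      case True
      then obtain \<rho> where r: "exec S p \<sigma> = Some \<rho>" "iterate c (exec S p) N \<rho> = Some \<tau>"
        using Suc.prems(1) by (auto split: bind_splits)
      obtain m where m: "ok k K \<rho>" "m \<le> time S p"
        "(step M ^^ m) (n + 1, config_of k b \<sigma>) (n + 1 + len p, config_of k b \<rho>)"
        using Loop.IH[OF _ _ r(1), of "n + 1"] Loop.prems(1) Suc.prems pl by (auto simp: placed_Cons)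
      have "step M (n + 1 + len p, config_of k b \<rho>) (n, config_of k b \<rho>)"
        using step_instr[of k K M "\<lambda>rs. (n, keep k rs)" "[]" "n + 1 + len p" \<rho>] pl m(1)
          assms(1) act_keep by (fastforce simp: placed_Cons)
      with st m(3) True have 1: "(step M ^^ (m + 2)) (n, config_of k b \<sigma>) (n, config_of k b \<rho>)"
        by (intro relpowp_step2[where R = "step M"]) simp_all
      obtain m' where m': "ok k K \<tau>" "m' \<le> N * (time S p + 2) + 1"
        "(step M ^^ m') (n, config_of k b \<rho>) (n + len p + 2, config_of k b \<tau>)"
        using Suc.IH[OF r(2) m(1)] by blast
      show ?thesis using relpowp_plus[OF 1 m'(3)] m m' by (intro conjI exI[of _ "m + 2 + m'"]) auto
    qed
  qed
  show ?case using *[of S \<sigma>] Loop.prems by (auto simp: algebra_simps)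
qed

section \<open>Machines that guess and then run a program\<close>

definition bit :: "bool \<Rightarrow> nat" where
  "bit b = (if b then 2 else 1)"

definition loaded :: "nat list \<Rightarrow> nat list \<Rightarrow> nat list \<Rightarrow> store" where
  "loaded xs cs us = (\<lambda>_. [])(1 := xs, 2 := cs, 3 := us)"

definition start :: "bool list \<Rightarrow> nat list \<Rightarrow> store" where
  "start x cs = loaded (rev (map bit x)) (rev cs) (replicate (length x) 1)"

definition advance :: "nat \<Rightarrow> nat \<Rightarrow> nat list \<Rightarrow> (nat \<times> move) list" where
  "advance k g rs = (0, Right_move) # (rs ! 0, Right_move) # (g, Right_move) # (1, Right_move) #
    replicate (k - 4) (0, Stay)"

definition launch :: "nat \<Rightarrow> (nat \<times> move) list" where
  "launch k = (0, Stay) # replicate (k - 1) (0, Left_move)"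

text \<open>
  The machine moves its input from tape \<open>0\<close> to tape \<open>1\<close>, writing alongside a string of the same
  length with letters guessed from \<open>{1..G}\<close> on tape \<open>2\<close> and the length in unary on tape \<open>3\<close>.
  It then runs the program, and finally accepts depending on the tops of the stacks.
\<close>

definition guess_run :: "nat \<Rightarrow> nat \<Rightarrow> nat \<Rightarrow> prog \<Rightarrow> ((nat \<Rightarrow> nat) \<Rightarrow> bool) \<Rightarrow> machine" where
  "guess_run k K G p acc = \<lparr>num_tapes = k, transitions =
    {(0, rs, 0, advance k g rs) | rs g. rs \<in> words k K \<and> rs ! 0 \<noteq> 0 \<and> g \<in> {1..G}} \<union>
    {(0, rs, 2, launch k) | rs. rs \<in> words k K \<and> rs ! 0 = 0} \<union>
    {(2 + i, rs, fst ((code k p 2 ! i) rs), snd ((code k p 2 ! i) rs)) | i rs.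
      i < len p \<and> rs \<in> words k K} \<union>
    {(2 + len p, rs, 1, keep k rs) | rs. rs \<in> words k K \<and> acc (reads rs)}\<rparr>"

text \<open>During the guessing phase the heads wait on the blank cell above the top, so that one
  step can write and move on. \<open>launch\<close> lowers them onto the tops.\<close>

definition upper :: "nat list \<Rightarrow> tape \<times> int" where
  "upper xs = (fst (stack 0 xs), int (length xs))"

definition rest :: "int \<Rightarrow> nat list \<Rightarrow> tape \<times> int" where
  "rest i ys = (\<lambda>z. if i \<le> z \<and> z < i + int (length ys) then ys ! nat (z - i) else 0, i)"

definition prelude :: "nat \<Rightarrow> int \<Rightarrow> nat list \<Rightarrow> nat list \<Rightarrow> nat list \<Rightarrow> nat list \<Rightarrow> (tape \<times> int) list" where
  "prelude k i ys xs cs us =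
    rest i ys # upper xs # upper cs # upper us # replicate (k - 4) (upper [])"

text \<open>The head of tape 0 walks across the input and erases it. What it leaves is an empty
  stack, but one based behind the input.\<close>

definition base :: "int \<Rightarrow> nat \<Rightarrow> int" where
  "base z = (\<lambda>j. if j = 0 then z else 0)"

lemma replicate_shift: "replicate n x @ x # xs = x # replicate n x @ xs"
  by (induction n) auto

lemma upper_read: "(case upper xs of (t, h) \<Rightarrow> t h) = 0"
  by (simp add: upper_def stack_def)

lemma act_upper_push: "act (a, Right_move) (upper xs) = upper (a # xs)"
  by (auto simp: act_def upper_def stack_def fun_eq_iff nth_append)

lemma act_upper_stay: "act (0, Stay) (upper xs) = upper xs"
  by (auto simp: act_def upper_def stack_def fun_eq_iff)

lemma act_upper_down: "act (0, Left_move) (upper xs) = stack 0 xs"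
  by (auto simp: act_def upper_def stack_def fun_eq_iff)

lemma rest_read: "(case rest i ys of (t, h) \<Rightarrow> t h) = hd0 ys"
  by (cases ys) (auto simp: rest_def)

lemma act_rest_advance: "act (0, Right_move) (rest i (y # ys)) = rest (i + 1) ys"
proof -
  have "nat (z - i) = Suc (nat (z - (i + 1)))" if "i < z" for z
    using that by simp
  then show ?thesis by (simp add: act_def rest_def fun_eq_iff)
qed

lemma act_rest_end: "act (0, Stay) (rest i []) = stack (i + 1) []"
  by (auto simp: act_def rest_def stack_def fun_eq_iff)

lemma prelude_reads:
  "map (\<lambda>(t, h). t h) (prelude k i ys xs cs us) = hd0 ys # 0 # 0 # 0 # replicate (k - 4) 0"
  using upper_read rest_read by (simp add: prelude_def)

lemma prelude_advance:
  assumes "rs ! 0 = y"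
  shows "map2 act (advance k g rs) (prelude k i (y # ys) xs cs us) =
    prelude k (i + 1) ys (y # xs) (g # cs) (1 # us)"
  using assms
  by (simp add: prelude_def advance_def act_upper_push act_rest_advance act_upper_stay
      zip_replicate[where i = "k - 4" and j = "k - 4"])

lemma prelude_launch:
  assumes "4 \<le> k"
  shows "map2 act (launch k) (prelude k i [] xs cs us) =
    config_of k (base (i + 1)) (loaded xs cs us)"
proof -
  obtain k' where k: "k = Suc (Suc (Suc (Suc k')))"
    using assms by (intro that[of "k - 4"]) simp
  show ?thesis
    unfolding k config_of_def prelude_def launch_def
    by (rule nth_equalityI)
      (auto simp: base_def loaded_def act_upper_down act_rest_end nth_Cons' simp del: upt_Suc)
qed

lemma initial_prelude:
  assumes "4 \<le> num_tapes M"
  shows "initial M x = (0, prelude (num_tapes M) 0 (map bit x) [] [] [])"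
proof -
  have "(tape_of x, 0) = rest 0 (map bit x)"
    by (auto simp: tape_of_def rest_def bit_def fun_eq_iff)
  moreover have "(tape_of [], 0) = upper []"
    by (auto simp: tape_of_def upper_def stack_def fun_eq_iff)
  moreover have "num_tapes M - 1 = Suc (Suc (Suc (num_tapes M - 4)))"
    using assms by simp
  ultimately show ?thesis by (simp add: initial_def prelude_def)
qed

text \<open>Determinism is assumed on \<open>P\<close> only, because guessing steps have several
  successors. A path ending in a halting element then prolongs every other path from the same
  start.\<close>

lemma deterministic_path:
  assumes det: "\<And>x y z. P x \<Longrightarrow> R x y \<Longrightarrow> R x z \<Longrightarrow> y = z" and inv: "\<And>x y. P x \<Longrightarrow> R x y \<Longrightarrow> P y"
    and "(R ^^ m) x y" "P x" "\<nexists>z. R y z" "(R ^^ j) x z"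
  shows "j \<le> m \<and> (R ^^ (m - j)) z y"
  using assms(3-)
proof (induction m arbitrary: x j)
  case 0
  then show ?case by (cases j) (auto simp del: relpowp.simps(2) elim: relpowp_Suc_E2)
next
  case (Suc m)
  show ?case
  proof (cases j)
    case 0
    with Suc.prems show ?thesis by (auto simp del: relpowp.simps(2))
  next
    case (Suc j')
    obtain x1 where 1: "R x x1" "(R ^^ m) x1 y" using relpowp_Suc_D2[OF Suc.prems(1)] by blast
    obtain x2 where 2: "R x x2" "(R ^^ j') x2 z"
      using relpowp_Suc_D2[OF Suc.prems(4)[unfolded Suc]] by blast
    have "x2 = x1" using det Suc.prems(2) 1 2 by blast
    with Suc.IH[OF 1(2) _ Suc.prems(3), of j'] inv 1 2 Suc.prems(2) Suc show ?thesis by auto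
  qed
qed

text \<open>Used twice: \<open>G = 1\<close> leaves no choice and gives a deterministic machine
  computing a function, a larger \<open>G\<close> gives a verifier. Termination is demanded for
  every certificate because the time bound concerns all branches.\<close>

locale guess_and_run =
  fixes k K G :: nat and p :: prog and acc :: "(nat \<Rightarrow> nat) \<Rightarrow> bool" and S :: "nat poly"
  assumes k: "4 \<le> k" and K: "3 \<le> K" "G < K" and G: "1 \<le> G" and wf: "wf k K p"
    and terminates: "length cs = length x \<Longrightarrow> set cs \<subseteq> {1..G} \<Longrightarrow>
      \<exists>\<tau>. exec (poly S (length x)) p (start x cs) = Some \<tau>"
begin

definition M :: machine where
  "M = guess_run k K G p acc"

definition result :: "bool list \<Rightarrow> nat list \<Rightarrow> store" where
  "result x cs = the (exec (poly S (length x)) p (start x cs))"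

lemma num_tapes [simp]: "num_tapes M = k"
  by (simp add: M_def guess_run_def)

lemma transitions_0: "(0, rs, q, as) \<in> transitions M \<longleftrightarrow> rs \<in> words k K \<and>
    (if rs ! 0 = 0 then q = 2 \<and> as = launch k else q = 0 \<and> (\<exists>g \<in> {1..G}. as = advance k g rs))"
  by (auto simp: M_def guess_run_def)

lemma transitions_pos:
  assumes "(q, rs, q', as) \<in> transitions M" "q \<noteq> 0"
  shows "q \<noteq> 1" "q' \<noteq> 0"
    and "(q', as) = (if q = 2 + len p then (1, keep k rs) else (code k p 2 ! (q - 2)) rs)"
    and "q = 2 + len p \<Longrightarrow> acc (reads rs)"
proof -
  have pos: "fst ((code k p 2 ! i) rs) \<noteq> 0" if "i < len p" for i
    using code_target[OF nth_mem, of i k p 2 rs] that by simp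
  show "q \<noteq> 1" "q = 2 + len p \<Longrightarrow> acc (reads rs)" and
    *: "(q', as) = (if q = 2 + len p then (1, keep k rs) else (code k p 2 ! (q - 2)) rs)"
    using assms by (auto simp: M_def guess_run_def)
  have "q = 2 + len p \<or> q - 2 < len p"
    using assms by (auto simp: M_def guess_run_def)
  then have "fst (q', as) \<noteq> 0"
    unfolding * using pos by auto
  then show "q' \<noteq> 0" by simp
qed

lemma finite_transitions: "finite (transitions M)"
proof -
  have "finite ((\<lambda>(rs, g). (0::nat, rs, 0::nat, advance k g rs)) ` (words k K \<times> {1..G}))"
    "finite ((\<lambda>rs. (0::nat, rs, 2::nat, launch k)) ` words k K)"
    "finite ((\<lambda>(i, rs). (2 + i, rs, fst ((code k p 2 ! i) rs), snd ((code k p 2 ! i) rs))) `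
      ({..<len p} \<times> words k K))"
    "finite ((\<lambda>rs. (2 + len p, rs, 1::nat, keep k rs)) ` words k K)"
    by (auto intro!: finite_imageI finite_cartesian_product finite_words)
  then have "finite ((\<lambda>(rs, g). (0::nat, rs, 0::nat, advance k g rs)) ` (words k K \<times> {1..G}) \<union>
    (\<lambda>rs. (0, rs, 2, launch k)) ` words k K \<union>
    (\<lambda>(i, rs). (2 + i, rs, fst ((code k p 2 ! i) rs), snd ((code k p 2 ! i) rs))) `
      ({..<len p} \<times> words k K) \<union>
    (\<lambda>rs. (2 + len p, rs, 1, keep k rs)) ` words k K)" by blast
  then show ?thesis by (rule rev_finite_subset) (auto simp: M_def guess_run_def image_iff)
qed

lemma turing_machine: "turing_machine M"
proof -
  have "length as = k" if "(q, rs, q', as) \<in> transitions M" for q rs q' as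
  proof (cases "q = 0")
    case True
    with that show ?thesis using k
      by (auto simp: transitions_0 advance_def launch_def split: if_splits)
  next
    case False
    show ?thesis
    proof (cases "q = 2 + len p")
      case True
      then show ?thesis using transitions_pos(3)[OF that False] by (simp add: keep_def)
    next
      case False
      from that \<open>q \<noteq> 0\<close> False have "q - 2 < len p" by (auto simp: M_def guess_run_def)
      then show ?thesis using transitions_pos(3)[OF that \<open>q \<noteq> 0\<close>] False
          code_target[OF nth_mem, of "q - 2" k p 2 rs] by (metis length_code snd_conv)
    qed
  qed
  moreover have "length rs = k" if "(q, rs, q', as) \<in> transitions M" for q rs q' as
    using that by (auto simp: M_def guess_run_def words_def)
  ultimately show ?thesis using k finite_transitions by (auto simp: turing_machine_def)
qed

lemma deterministic: "G = 1 \<Longrightarrow> deterministic M"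
  unfolding deterministic_def
proof (intro allI impI)
  fix q rs q' as q'' as'
  assume "G = 1" and t: "(q, rs, q', as) \<in> transitions M" "(q, rs, q'', as') \<in> transitions M"
  show "q' = q'' \<and> as = as'"
  proof (cases "q = 0")
    case True
    have g: "\<And>g. g \<in> {1..G} \<Longrightarrow> g = 1" using \<open>G = 1\<close> by simp
    show ?thesis
    proof (cases "rs ! 0 = 0")
      case True
      with t[unfolded \<open>q = 0\<close> transitions_0] show ?thesis by simp
    next
      case False
      with t[unfolded \<open>q = 0\<close> transitions_0] g show ?thesis by (simp only: if_False) blast
    qed
  next
    case False
    then show ?thesis using transitions_pos(3)[OF t(1)] transitions_pos(3)[OF t(2)]
      by (metis Pair_inject)
  qed
qed

lemma step_iff: "step M (q, ts) c \<longleftrightarrow>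
    (\<exists>q' as. (q, map (\<lambda>(t, h). t h) ts, q', as) \<in> transitions M \<and> c = (q', map2 act as ts))"
  by (auto simp: step.simps)

lemma step_pos:
  assumes "fst c \<noteq> 0" "step M c c1"
  shows "fst c1 \<noteq> 0" "step M c c2 \<Longrightarrow> c1 = c2"
proof -
  obtain q ts where c: "c = (q, ts)" by (cases c)
  let ?rs = "map (\<lambda>(t, h). t h) ts"
  obtain q1 as1 where 1: "(q, ?rs, q1, as1) \<in> transitions M" "c1 = (q1, map2 act as1 ts)"
    using assms(2) unfolding c by (auto elim: step.cases)
  have q: "q \<noteq> 0" using assms(1) c by simp
  show "fst c1 \<noteq> 0" using transitions_pos(2)[OF 1(1) q] 1(2) by simp
  assume "step M c c2"
  then obtain q2 as2 where 2: "(q, ?rs, q2, as2) \<in> transitions M" "c2 = (q2, map2 act as2 ts)"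
    unfolding c by (auto elim: step.cases)
  have "(q1, as1) = (q2, as2)"
    using transitions_pos(3)[OF 1(1) q] transitions_pos(3)[OF 2(1) q] by (rule trans[OF _ sym])
  then show "c1 = c2" using 1(2) 2(2) by simp
qed

lemma halting_accept: "halting M (1, ts)"
  using transitions_pos(1)[of 1] by (auto simp: halting_def elim!: step.cases)

lemma step_advance:
  assumes "y \<in> {1, 2}"
  shows "step M (0, prelude k i (y # ys) xs cs us) c \<longleftrightarrow>
    (\<exists>g \<in> {1..G}. c = (0, prelude k (i + 1) ys (y # xs) (g # cs) (1 # us)))"
proof -
  let ?rs = "y # 0 # 0 # 0 # replicate (k - 4) 0" and ?ts = "prelude k i (y # ys) xs cs us"
  have words: "?rs \<in> words k K"
    using assms K k by (auto simp: words_def)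
  have y: "y \<noteq> 0" using assms by auto
  have adv: "map2 act (advance k g ?rs) ?ts = prelude k (i + 1) ys (y # xs) (g # cs) (1 # us)" for g
    by (rule prelude_advance) simp
  have tr: "(0, ?rs, q, as) \<in> transitions M \<longleftrightarrow> q = 0 \<and> (\<exists>g \<in> {1..G}. as = advance k g ?rs)" for q as
    using words y unfolding transitions_0 nth_Cons_0 by (simp only: if_False simp_thms)
  show ?thesis
    unfolding step_iff prelude_reads hd0_simps tr
    using adv by metis
qed

lemma step_launch:
  "step M (0, prelude k i [] xs cs us) c \<longleftrightarrow>
    c = (2, config_of k (base (i + 1)) (loaded xs cs us))"
proof -
  have "0 # 0 # 0 # 0 # replicate (k - 4) 0 \<in> words k K"
    using K k by (auto simp: words_def)
  then show ?thesis
    using prelude_launch[OF k] by (simp add: step_iff transitions_0 prelude_reads)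
qed

lemma prelude_paths:
  assumes "(step M ^^ m) (0, prelude k i ys xs cs us) c" "set ys \<subseteq> {1, 2}"
  shows "m \<le> length ys \<and> fst c = 0 \<or> (\<exists>gs m'. length gs = length ys \<and> set gs \<subseteq> {1..G} \<and>
    m = length ys + 1 + m' \<and>
    (step M ^^ m') (2, config_of k (base (i + int (length ys) + 1)) (loaded (rev ys @ xs) (rev gs @
        cs) (replicate (length ys) 1 @ us))) c)"
  using assms
proof (induction ys arbitrary: i m xs cs us)
  case Nil
  show ?case
  proof (cases m)
    case 0
    then show ?thesis using Nil by auto
  next
    case (Suc m')
    with relpowp_Suc_D2[OF Nil.prems(1)[unfolded Suc]] show ?thesis
      by (auto simp: step_launch simp del: relpowp.simps)
  qed
next
  case (Cons y ys)
  show ?case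
  proof (cases m)
    case 0
    then show ?thesis using Cons by auto
  next
    case (Suc m')
    obtain g where g: "g \<in> {1..G}"
      "(step M ^^ m') (0, prelude k (i + 1) ys (y # xs) (g # cs) (1 # us)) c"
      using relpowp_Suc_D2[OF Cons.prems(1)[unfolded Suc]] Cons.prems(2) step_advance by fastforce
    from Cons.IH[OF g(2)] Cons.prems(2) consider "m' \<le> length ys \<and> fst c = 0"
      | gs l where "length gs = length ys" "set gs \<subseteq> {1..G}" "m' = length ys + 1 + l"
        "(step M ^^ l) (2, config_of k (base (i + 1 + int (length ys) + 1))
          (loaded (rev ys @ y # xs) (rev gs @ g # cs) (replicate (length ys) 1 @ 1 # us))) c"
      by auto
    then show ?thesis
    proof cases
      case 1
      then show ?thesis using Suc by simp
    next
      case 2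
      then show ?thesis using 2 g(1) Suc
        by (intro disjI2 exI[of _ "g # gs"] exI[of _ l]) (simp add: add_ac replicate_shift)
    qed
  qed
qed

lemma prelude_path:
  assumes "length gs = length ys" "set gs \<subseteq> {1..G}" "set ys \<subseteq> {1, 2}"
  shows "(step M)\<^sup>*\<^sup>* (0, prelude k i ys xs cs us)
    (2, config_of k (base (i + int (length ys) + 1)) (loaded (rev ys @ xs) (rev gs @
        cs) (replicate (length ys) 1 @ us)))"
  using assms
proof (induction gs ys arbitrary: i xs cs us rule: list_induct2)
  case Nil
  show ?case by (rule r_into_rtranclp) (simp add: step_launch)
next
  case (Cons g gs y ys)
  have "step M (0, prelude k i (y # ys) xs cs us)
      (0, prelude k (i + 1) ys (y # xs) (g # cs) (1 # us))"
    using Cons.prems step_advance[of y] by auto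
  moreover have "(step M)\<^sup>*\<^sup>* (0, prelude k (i + 1) ys (y # xs) (g # cs) (1 # us))
    (2, config_of k (base (i + int (length (y # ys)) + 1)) (loaded (rev (y # ys) @
        xs) (rev (g # gs) @ cs) (replicate (length (y # ys)) 1 @ us)))"
    using Cons.IH[of "i + 1" "y # xs" "g # cs" "1 # us"] Cons.prems by (simp add: add_ac replicate_shift)
  ultimately show ?case by (rule converse_rtranclp_into_rtranclp)
qed

lemma initial_eq: "initial M x = (0, prelude k 0 (map bit x) [] [] [])"
  using initial_prelude[of M x] k by simp

lemma bits: "set (map bit x) \<subseteq> {1, 2}"
  by (auto simp: bit_def)

lemma initial_paths:
  assumes "(step M ^^ m) (initial M x) c"
  shows "m \<le> length x \<and> fst c = 0 \<or> (\<exists>cs m'. length cs = length x \<and> set cs \<subseteq> {1..G} \<and>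
    m = length x + 1 + m' \<and> (step M ^^ m') (2, config_of k (base (int (length x) + 1)) (start x cs)) c)"
  using prelude_paths[OF assms[unfolded initial_eq] bits] by (simp add: start_def)

lemma initial_path:
  assumes "length cs = length x" "set cs \<subseteq> {1..G}"
  shows "(step M)\<^sup>*\<^sup>* (initial M x) (2, config_of k (base (int (length x) + 1)) (start x cs))"
  using prelude_path[OF _ assms(2) bits, of x 0 "[]" "[]" "[]"] assms
  by (simp add: initial_eq start_def)

lemma result:
  assumes "length cs = length x" "set cs \<subseteq> {1..G}"
  shows "exec (poly S (length x)) p (start x cs) = Some (result x cs)"
  using terminates[OF assms] by (auto simp: result_def)

lemma run:
  assumes "length cs = length x" "set cs \<subseteq> {1..G}"
  shows "\<exists>m c. m \<le> time (poly S (length x)) p + 1 \<and>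
    (step M ^^ m) (2, config_of k (base (int (length x) + 1)) (start x cs)) c \<and> halting M c \<and>
    (fst c = 1 \<longleftrightarrow> acc (tops (result x cs))) \<and> snd c =
        config_of k (base (int (length x) + 1)) (result x cs)"
proof -
  let ?b = "base (int (length x) + 1)" and ?r = "result x cs"
  have ok: "ok k K (start x cs)"
    using assms(2) K k by (fastforce simp: ok_def start_def loaded_def bit_def)
  have placed: "placed k K M (code k p 2) 2"
    by (auto simp: placed_def M_def guess_run_def)
  obtain m where m: "ok k K ?r" "m \<le> time (poly S (length x)) p"
    "(step M ^^ m) (2, config_of k ?b (start x cs)) (2 + len p, config_of k ?b ?r)"
    using exec_steps[OF _ wf ok result[OF assms] placed, of ?b] K by auto
  show ?thesis
  proof (cases "acc (tops ?r)")
    case True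
    have "step M (2 + len p, config_of k ?b ?r) (1,
        map2 act (keep k (map (tops ?r) [0..<k])) (config_of k ?b ?r))"
      unfolding step_iff config_reads
      using True config_words[OF m(1)] reads_tops[OF m(1)] K
      by (fastforce simp: M_def guess_run_def)
    then have "step M (2 + len p, config_of k ?b ?r) (1, config_of k ?b ?r)"
      by (simp only: act_keep)
    from relpowp_Suc_I[OF m(3) this] m(2) True halting_accept show ?thesis
      by (intro exI[of _ "Suc m"] exI[of _ "(1, config_of k ?b ?r)"]) (simp del: relpowp.simps)
  next
    case False
    have "halting M (2 + len p, config_of k ?b ?r)"
      unfolding halting_def
    proof
      assume "\<exists>c'. step M (2 + len p, config_of k ?b ?r) c'"
      then obtain q as where "(2 + len p, map (tops ?r) [0..<k], q, as) \<in> transitions M"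
        by (auto simp: step_iff config_reads)
      from transitions_pos(4)[OF this] False reads_tops[OF m(1)] show False by simp
    qed
    with m(2,3) False show ?thesis by (intro exI[of _ m] exI[of _ "(2 + len p, config_of k ?b ?r)"]) simp
  qed
qed

text \<open>By \<open>run\<close> there is one halting path once the guesses are made. All steps
  after them are deterministic, so every path is a prefix of that one, and a path that halts
  coincides with it.\<close>

lemma run_prefix:
  assumes "length cs = length x" "set cs \<subseteq> {1..G}"
    and "(step M ^^ j) (2, config_of k (base (int (length x) + 1)) (start x cs)) c"
  shows "j \<le> time (poly S (length x)) p + 1"
    and "halting M c \<Longrightarrow> fst c = 1 \<Longrightarrow> acc (tops (result x cs))"
proof -
  obtain m d where d: "m \<le> time (poly S (length x)) p + 1"
    "(step M ^^ m) (2, config_of k (base (int (length x) + 1)) (start x cs)) d" "halting M d"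
    "fst d = 1 \<longleftrightarrow> acc (tops (result x cs))"
    using run[OF assms(1,2)] by blast
  have *: "j \<le> m \<and> (step M ^^ (m - j)) c d"
    using deterministic_path[of "\<lambda>c. fst c \<noteq> 0" "step M", OF step_pos(2) step_pos(1) d(2) _ _ assms(3)]
      d(3) by (auto simp: halting_def)
  then show "j \<le> time (poly S (length x)) p + 1" using d(1) by simp
  assume c: "halting M c" "fst c = 1"
  have "m - j = 0"
    using * c(1) by (cases "m - j") (auto simp: halting_def simp del: relpowp.simps elim: relpowp_Suc_E2)
  with * c(2) d(4) show "acc (tops (result x cs))" by auto
qed

lemma polynomial_time: "polynomial_time M"
proof -
  obtain r where r: "\<And>N. time N p = poly r N" using time_poly by blast
  have "m \<le> poly ([:3, 1:] + pcompose r S) (length x)" if "(step M ^^ m) (initial M x) c" for m x c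
    using initial_paths[OF that]
  proof (elim disjE exE conjE)
    fix cs l
    assume cs: "length cs = length x" "set cs \<subseteq> {1..G}" and m: "m = length x + 1 + l"
      and l: "(step M ^^ l) (2, config_of k (base (int (length x) + 1)) (start x cs)) c"
    show ?thesis using run_prefix(1)[OF cs l] m by (simp add: poly_pcompose r)
  qed simp
  then show ?thesis unfolding polynomial_time_def by blast
qed

lemma accepts_iff:
  "accepts M x \<longleftrightarrow> (\<exists>cs. length cs = length x \<and> set cs \<subseteq> {1..G} \<and> acc (tops (result x cs)))"
proof
  assume "accepts M x"
  then obtain c m where "(step M ^^ m) (initial M x) c" "halting M c" "fst c = 1"
    unfolding accepts_def by (auto dest: rtranclp_imp_relpowp)
  from initial_paths[OF this(1)]
  show "\<exists>cs. length cs = length x \<and> set cs \<subseteq> {1..G} \<and> acc (tops (result x cs))"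
  proof (elim disjE exE conjE)
    fix cs l
    assume cs: "length cs = length x" "set cs \<subseteq> {1..G}"
      and l: "(step M ^^ l) (2, config_of k (base (int (length x) + 1)) (start x cs)) c"
    show ?thesis using run_prefix(2)[OF cs l \<open>halting M c\<close> \<open>fst c = 1\<close>] cs by blast
  qed (use \<open>fst c = 1\<close> in simp)
next
  assume "\<exists>cs. length cs = length x \<and> set cs \<subseteq> {1..G} \<and> acc (tops (result x cs))"
  then obtain cs where cs: "length cs = length x" "set cs \<subseteq> {1..G}" "acc (tops (result x cs))"
    by blast
  with run[OF cs(1,2)] initial_path[OF cs(1,2)] show "accepts M x"
    unfolding accepts_def by (meson relpowp_imp_rtranclp rtranclp_trans)
qed

text \<open>Tape \<open>k - 1\<close> is not tape 0, so its stack is based at cell 0 and its bottom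
  element is the first symbol of the output; hence the reversal.\<close>

lemma computes:
  assumes "\<And>x. result x (replicate (length x) 1) (k - 1) = rev (map bit (f x))"
  shows "computes M f"
  unfolding computes_def
proof
  fix x :: "bool list"
  let ?cs = "replicate (length x) (1::nat)"
  have cs: "length ?cs = length x" "set ?cs \<subseteq> {1..G}" using G by auto
  obtain m c where c: "(step M ^^ m) (2, config_of k (base (int (length x) + 1)) (start x ?cs)) c"
    "halting M c" "snd c = config_of k (base (int (length x) + 1)) (result x ?cs)"
    using run[OF cs] by blast
  have "last (snd c) = stack 0 (rev (map bit (f x)))"
    using c(3) k assms by (simp add: config_of_def last_map base_def)
  then have "fst (last (snd c)) = tape_of (f x)"
    by (auto simp: stack_def tape_of_def bit_def fun_eq_iff)
  with c(1,2) initial_path[OF cs]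
  show "\<exists>c. (step M)\<^sup>*\<^sup>* (initial M x) c \<and> halting M c \<and> fst (last (snd c)) = tape_of (f x)"
    by (meson relpowp_imp_rtranclp rtranclp_trans)
qed

end

section \<open>Modular ortholattices of height two\<close>

lemma compl_eq_swap: "- x = y \<longleftrightarrow> x = - (y::'a::orthocomplemented_lattice)"
  by (metis ortho_involution)

locale height_two =
  fixes L :: "'a::modular_ortholattice itself"
  assumes nontrivial: "\<exists>a::'a. a \<noteq> bot \<and> a \<noteq> top"
    and collapse: "(x::'a) < y \<Longrightarrow> x = bot \<or> y = top"
begin

lemma bot_neq_top: "(bot::'a) \<noteq> top"
  using nontrivial by (metis bot.extremum_uniqueI top_greatest)

lemma inf_eq: "inf (x::'a) y = (if x = top then y else if y = top then x else if x = y then x else bot)"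
proof -
  have "inf x y = bot" if "x \<noteq> top" "y \<noteq> top" "x \<noteq> y"
  proof (rule ccontr)
    assume nb: "inf x y \<noteq> bot"
    then have "inf x y = x" using collapse[of "inf x y" x] that inf_le1[of x y] by (auto simp: less_le)
    moreover have "inf x y = y" using collapse[of "inf x y" y] nb that inf_le2[of x y]
        by (auto simp: less_le)
    ultimately show False using that by simp
  qed
  then show ?thesis by auto
qed

lemma compl_neq: "- (x::'a) \<noteq> x"
proof
  assume *: "- x = x"
  then have "inf x x = bot" using inf_compl_bot[of x] by (simp only:)
  then show False using * bot_neq_top by simp
qed

lemma le_iff_eq: "(x::'a) \<le> y \<longleftrightarrow> x = bot \<or> y = top \<or> x = y"
  using collapse[of x y] by (auto simp: less_le)

text \<open>From each pair \<open>{x, - x}\<close> one element is declared true, with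
  \<open>p\<close> and \<open>top\<close> prescribed; this is consistent since \<open>p\<close> is
  not \<open>bot\<close>. The choice \<open>m\<close> is made from the pair as a set, so
  \<open>x\<close> and \<open>- x\<close> share it.\<close>

lemma valuation:
  assumes "(p::'a) \<noteq> bot"
  obtains v where "v p" "v top" "\<And>x. v (- x) \<longleftrightarrow> \<not> v x"
proof -
  define m where "m x = (SOME y. y \<in> {x, - x})" for x :: 'a
  define v where "v x \<longleftrightarrow> x = p \<or> x = top \<or> (x \<noteq> - p \<and> x \<noteq> bot \<and> x = m x)" for x
  have true: "v x" if "x = p \<or> x = top" for x
    using that by (auto simp: v_def)
  have "- p \<noteq> top" using assms compl_eq_swap[of p top] by simp
  then have false: "\<not> v x" if "x = - p \<or> x = bot" for x
    using that assms compl_neq[of p] bot_neq_top by (auto simp: v_def)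
  have "v (- x) \<longleftrightarrow> \<not> v x" for x
  proof -
    consider "x = p \<or> x = top" | "x = - p \<or> x = bot"
      | "x \<noteq> p" "x \<noteq> top" "x \<noteq> - p" "x \<noteq> bot" by blast
    then show ?thesis
    proof cases
      case 1
      then have "- x = - p \<or> - x = bot" by auto
      with 1 show ?thesis using true false by blast
    next
      case 2
      then have "- x = p \<or> - x = top" by auto
      with 2 show ?thesis using true false by blast
    next
      case 3
      have mem: "m x \<in> {x, - x}" unfolding m_def by (rule someI[of "\<lambda>y. y \<in> {x, - x}" x]) simp
      have "{- x, - (- x)} = {x, - x}" by auto
      then have m: "m (- x) = m x" unfolding m_def by (simp only:)
      have n: "- x \<noteq> p" "- x \<noteq> top" "- x \<noteq> - p" "- x \<noteq> bot"
        using 3 unfolding compl_eq_swap[of x p] compl_eq_swap[of x top] compl_eq_swap[of x bot]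
            by simp_all
      have v: "v x \<longleftrightarrow> x = m x" "v (- x) \<longleftrightarrow> - x = m x"
        using 3 n unfolding v_def m by blast+
      from mem consider "m x = x" | "m x = - x" by blast
      then show ?thesis using compl_neq[of x] unfolding v
          by cases (simp_all only: not_True_eq_False not_False_eq_True refl eq_commute)
    qed
  qed
  moreover have "v p" "v top" by (simp_all add: v_def)
  ultimately show ?thesis using that by blast
qed

end

text \<open>In the maximal chain \<open>{bot, a, top}\<close> the element \<open>a\<close> is both
  an atom and a coatom. A pair \<open>x < y\<close> with \<open>x\<close> different from
  \<open>bot\<close> and \<open>y\<close> from \<open>top\<close> would form a pentagon with
  \<open>a\<close>: then \<open>inf y a = bot\<close> and \<open>sup a x = top\<close>, and the
  modular law gives \<open>y = x\<close>.\<close>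

lemma height_two_if_dimension:
  assumes "has_dimension TYPE('a::modular_ortholattice) 2"
  shows "height_two TYPE('a)"
proof -
  obtain C :: "'a set" where C: "pred_on.maxchain UNIV (<) C" "finite C" "card C = 3"
    using assms by (auto simp: has_dimension_def)
  have chain: "x \<le> y \<or> y \<le> x" if "x \<in> C" "y \<in> C" for x y
    using C(1) that unfolding pred_on.maxchain_def pred_on.chain_def by (auto simp: less_le)
  have max: "z \<in> C" if "\<And>x. x \<in> C \<Longrightarrow> x \<le> z \<or> z \<le> x" for z
  proof (rule ccontr)
    assume "z \<notin> C"
    then have "C \<subset> insert z C" by blast
    moreover have "pred_on.chain UNIV (<) (insert z C)"
      unfolding pred_on.chain_def using that chain by (auto simp: less_le)
    ultimately show False using C(1) unfolding pred_on.maxchain_def by blast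
  qed
  have bt: "bot \<in> C" "top \<in> C" by (auto intro: max)
  have "card {bot::'a, top} \<le> 2" by (simp add: card_insert_if)
  then have "\<not> C \<subseteq> {bot, top}" using C(3) card_mono[of "{bot::'a, top}" C] by auto
  then obtain a where a: "a \<in> C" "a \<noteq> bot" "a \<noteq> top" by blast
  have "(bot::'a) \<noteq> top" using a by (metis bot.extremum_uniqueI top_greatest)
  then have "card {bot, a, top} = 3" using a by simp
  then have C_eq: "C = {bot, a, top}"
    using card_subset_eq[OF C(2), of "{bot, a, top}"] a bt C(3) by auto
  have comparable: "z = bot \<or> z = a \<or> z = top" if "z \<le> a \<or> a \<le> z" for z
  proof -
    have "x \<le> z \<or> z \<le> x" if "x \<in> C" for x
      using that \<open>z \<le> a \<or> a \<le> z\<close> by (auto simp: C_eq)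
    then have "z \<in> C" by (rule max)
    then show ?thesis by (simp add: C_eq)
  qed
  have below: "z \<le> a \<Longrightarrow> z = bot \<or> z = a" for z
    using comparable[of z] a by (auto dest: top.extremum_uniqueI)
  have above: "a \<le> z \<Longrightarrow> z = a \<or> z = top" for z
    using comparable[of z] a by (auto dest: bot.extremum_uniqueI)
  show ?thesis
  proof
    show "\<exists>a::'a. a \<noteq> bot \<and> a \<noteq> top" using a by blast
    fix x y :: 'a
    assume xy: "x < y"
    show "x = bot \<or> y = top"
    proof (rule ccontr)
      assume n: "\<not> (x = bot \<or> y = top)"
      have "\<not> a \<le> y"
      proof
        assume "a \<le> y"
        then have "y = a" using above n by blast
        then show False using below[of x] xy n by (auto simp: less_le)
      qed
      then have ya: "inf y a = bot" using below[of "inf y a"] by (metis inf_le1 inf_le2)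
      have "\<not> x \<le> a"
      proof
        assume "x \<le> a"
        then have "x = a" using below n by blast
        then show False using above[of y] xy n by (auto simp: less_le)
      qed
      then have "sup a x = top" using above[of "sup a x"] by (metis sup_ge1 sup_ge2)
      then have "y = x" using modular_law[OF less_imp_le[OF xy], of a] ya by simp
      with xy show False by simp
    qed
  qed
qed


section \<open>Terms expressing Boolean constraints\<close>

definition conj_term :: "ol_term list \<Rightarrow> ol_term" where
  "conj_term ts = foldr Meet ts One"

definition literal :: "nat \<Rightarrow> bool \<Rightarrow> ol_term" where
  "literal v b = (if b then Var v else Neg (Var v))"

definition minterm :: "nat list \<Rightarrow> bool list \<Rightarrow> ol_term" where
  "minterm vs bs = conj_term (map2 literal vs bs)"

definition dnf :: "nat list \<Rightarrow> (bool list \<Rightarrow> bool) \<Rightarrow> ol_term" where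
  "dnf vs P = foldr Join (map (minterm vs) (filter P (List.n_lists (length vs) [False, True]))) Zero"

lemma eval_conj_le: "t \<in> set ts \<Longrightarrow> ol_eval a (conj_term ts) \<le> ol_eval a t"
  by (induction ts) (auto simp: conj_term_def intro: le_infI2)

lemma eval_conj_top: "(\<And>t. t \<in> set ts \<Longrightarrow> ol_eval a t = top) \<Longrightarrow> ol_eval a (conj_term ts) = top"
  by (induction ts) (auto simp: conj_term_def)

lemma eval_disj_le: "(\<And>t. t \<in> set ts \<Longrightarrow> ol_eval a t \<le> q) \<Longrightarrow> ol_eval a (foldr Join ts Zero) \<le> q"
  by (induction ts) auto

lemma eval_disj_ge: "t \<in> set ts \<Longrightarrow> ol_eval a t \<le> ol_eval a (foldr Join ts Zero)"
  by (induction ts) (auto intro: le_supI2)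

lemma eval_dnf_top:
  assumes "P (map \<beta> vs)" and "\<And>v. a v = (if \<beta> v then top else bot)"
  shows "ol_eval a (dnf vs P) = top"
proof -
  let ?m = "minterm vs (map \<beta> vs)"
  have "ol_eval a ?m = top"
    unfolding minterm_def by (rule eval_conj_top) (auto simp: literal_def assms(2) set_zip)
  moreover have "?m \<in> set (map (minterm vs) (filter P (List.n_lists (length vs) [False, True])))"
    using assms(1) by (auto simp: set_n_lists)
  ultimately show ?thesis using eval_disj_ge[of ?m] by (metis dnf_def top.extremum_uniqueI)
qed

text \<open>
  Every variable of \<open>vs\<close> occurs in every minterm. So if two minterms are nonzero, all variables have
  their values in a common block \<open>{0, q, - q, 1}\<close>, on which \<open>v\<close> is a homomorphism.
\<close>

lemma (in height_two) eval_dnf_sound: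
  fixes a :: "nat \<Rightarrow> 'a"
  assumes "p \<noteq> bot" "p \<le> ol_eval a (dnf vs P)"
    and v: "v p" "v top" "\<And>x. v (- x) \<longleftrightarrow> \<not> v x"
  shows "P (map (v \<circ> a) vs)"
proof (rule ccontr)
  let ?b = "map (v \<circ> a) vs" and ?m = "\<lambda>bs. ol_eval a (minterm vs bs)"
  let ?B = "{bs. length bs = length vs \<and> P bs}"
  assume neg: "\<not> P ?b"
  have vbot: "\<not> v bot" using v(2) v(3)[of top] by simp
  have lit: "?m bs \<le> ol_eval a (literal (vs ! i) (bs ! i))"
    if "i < length vs" "length bs = length vs" for bs i
    unfolding minterm_def by (rule eval_conj_le) (use that in \<open>auto simp: set_zip intro!: exI[of _ i]\<close>)
  have eval_lit: "ol_eval a (literal x b) = (if b then a x else - a x)" for x b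
    by (simp add: literal_def)
  have false: "\<exists>i < length vs. \<not> v (ol_eval a (literal (vs ! i) (bs ! i)))" if "bs \<in> ?B" for bs
  proof -
    have "bs \<noteq> ?b" using that neg by auto
    moreover have "length bs = length ?b" using that by simp
    ultimately obtain i where i: "i < length vs" "bs ! i \<noteq> ?b ! i"
      using nth_equalityI[of bs ?b] by fastforce
    then have "bs ! i \<noteq> v (a (vs ! i))" by simp
    with i(1) show ?thesis using v(3) by (intro exI[of _ i]) (simp add: eval_lit)
  qed
  have "\<exists>q. \<not> v q \<and> (\<forall>bs \<in> ?B. ?m bs \<le> q)"
  proof (cases "\<forall>bs \<in> ?B. ?m bs = bot")
    case True
    then show ?thesis using vbot by auto
  next
    case False
    then obtain bs where bs: "bs \<in> ?B" "?m bs \<noteq> bot" by blast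
    obtain i where i: "i < length vs" "\<not> v (ol_eval a (literal (vs ! i) (bs ! i)))"
      using false[OF bs(1)] by blast
    let ?q = "ol_eval a (literal (vs ! i) (bs ! i))"
    have "?q \<noteq> bot" using lit[OF i(1), of bs] bs by (auto dest: bot.extremum_uniqueI)
    have "?m cs \<le> ?q" if cs: "cs \<in> ?B" for cs
    proof (cases "?m cs = bot")
      case False
      obtain j where j: "j < length vs" "\<not> v (ol_eval a (literal (vs ! j) (cs ! j)))"
        using false[OF cs] by blast
      then have vm: "\<not> v (?m cs)"
        using lit[OF j(1), of cs] cs v(2) vbot by (auto simp: le_iff_eq)
      have "?m cs \<le> ol_eval a (literal (vs ! i) (cs ! i))"
        using lit[OF i(1)] cs by simp
      moreover have "ol_eval a (literal (vs ! i) (cs ! i)) = ?q \<or>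
          ol_eval a (literal (vs ! i) (cs ! i)) = - ?q"
        by (auto simp: eval_lit)
      moreover have "\<not> ?m cs \<le> - ?q"
      proof
        assume "?m cs \<le> - ?q"
        then consider "- ?q = top" | "?m cs = - ?q" using False le_iff_eq by blast
        then show False
        proof cases
          case 1
          then have "?q = bot" using compl_eq_swap[of ?q top] by simp
          with \<open>?q \<noteq> bot\<close> show False by contradiction
        next
          case 2
          then show False using vm i(2) v(3)[of ?q] by (simp only:) simp
        qed
      qed
      ultimately show ?thesis by auto
    qed simp
    with i(2) show ?thesis by blast
  qed
  then obtain q where q: "\<not> v q" "\<And>bs. bs \<in> ?B \<Longrightarrow> ?m bs \<le> q" by blast
  have "ol_eval a (dnf vs P) \<le> q"
    unfolding dnf_def by (rule eval_disj_le) (use q(2) in \<open>auto simp: set_n_lists\<close>)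
  with assms(1,2) have "p = q \<or> q = top" by (meson le_iff_eq order_trans)
  with q(1) v(1,2) show False by blast
qed

text \<open>Constraints of one kind differ only in their cells. The reduction program stores one
  fixed term per kind, and renaming moves it to a cell.\<close>

primrec rename :: "(nat \<Rightarrow> nat) \<Rightarrow> ol_term \<Rightarrow> ol_term" where
  "rename f (Var i) = Var (f i)"
| "rename f Zero = Zero"
| "rename f One = One"
| "rename f (Neg t) = Neg (rename f t)"
| "rename f (Meet s t) = Meet (rename f s) (rename f t)"
| "rename f (Join s t) = Join (rename f s) (rename f t)"

lemma rename_minterm: "length bs = length vs \<Longrightarrow> rename f (minterm vs bs) = minterm (map f vs) bs"
  by (induction bs vs rule: list_induct2) (auto simp: minterm_def conj_term_def literal_def)

lemma rename_dnf: "rename f (dnf vs P) = dnf (map f vs) P"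
proof -
  have 1: "rename f (foldr Join ts Zero) = foldr Join (map (rename f) ts) Zero" for ts
    by (induction ts) auto
  have 2: "map (rename f \<circ> minterm vs) (filter P (List.n_lists (length vs) [False, True])) =
      map (minterm (map f vs)) (filter P (List.n_lists (length vs) [False, True]))"
    by (rule map_cong) (auto simp: rename_minterm set_n_lists)
  show ?thesis by (simp only: dnf_def 1 2 map_map length_map)
qed


subsection \<open>Variables indexed by cells and tiles\<close>

text \<open>The initial 1 acts as the leading digit, so every bit list is the tail of some binary
  numeral.\<close>

definition number :: "bool list \<Rightarrow> nat" where
  "number bs = foldl (\<lambda>n b. 2 * n + of_bool b) 1 bs"

lemma number_neq_0: "binary (number bs) = True # cs \<Longrightarrow> number bs \<noteq> 0"
proof
  assume b: "binary (number bs) = True # cs" and "number bs = 0"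
  then have "binary 0 = True # cs" by simp
  then show False by (simp add: binary_small)
qed

lemma binary_number: "binary (number bs) = True # bs"
proof (induction bs rule: rev_induct)
  case Nil
  show ?case by (simp add: number_def binary_small)
next
  case (snoc b bs)
  have "number bs \<noteq> 0"
    using snoc by (rule number_neq_0)
  then have "\<not> number (bs @ [b]) \<le> 1" by (auto simp: number_def)
  moreover have "number (bs @ [b]) div 2 = number bs" "odd (number (bs @ [b])) = b"
    by (auto simp: number_def)
  ultimately show ?case using snoc by (simp add: binary_large)
qed

text \<open>Unary coordinates let a program with unary counters print a variable digit by digit, at
  polynomial length; the zeros make the code injective.\<close>

definition cell_bits :: "nat \<Rightarrow> nat \<Rightarrow> nat \<Rightarrow> bool list" where
  "cell_bits s i e = replicate s True @ False # replicate i True @ False # replicate e True"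

definition cell_var :: "nat \<Rightarrow> nat \<Rightarrow> nat \<Rightarrow> nat" where
  "cell_var s i e = number (cell_bits s i e) - 1"

lemma binary_cell_var: "binary (Suc (cell_var s i e)) = True # cell_bits s i e"
proof -
  have "number (cell_bits s i e) \<noteq> 0"
    using binary_number by (rule number_neq_0)
  then show ?thesis using binary_number by (simp add: cell_var_def)
qed

lemma replicate_True_inject:
  "replicate m True @ False # xs = replicate n True @ False # ys \<Longrightarrow> m = n \<and> xs = ys"
proof (induction m arbitrary: n)
  case 0
  then show ?case by (cases n) auto
next
  case (Suc m)
  then show ?case by (cases n) auto
qed

lemma cell_var_inject: "cell_var s i e = cell_var s' i' e' \<longleftrightarrow> s = s' \<and> i = i' \<and> e = e'"
proof
  assume "cell_var s i e = cell_var s' i' e'"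
  then have "cell_bits s i e = cell_bits s' i' e'"
    using binary_cell_var by (metis list.inject)
  then show "s = s' \<and> i = i' \<and> e = e'"
    unfolding cell_bits_def using replicate_True_inject by (metis length_replicate)
qed simp

definition one_hot :: "nat \<Rightarrow> nat \<Rightarrow> bool list" where
  "one_hot E e = map (\<lambda>e'. e' = e) [0..<E]"

text \<open>The variable \<open>prod_encode (a, prod_encode (b, e))\<close> of a template says that the cell at offset
  \<open>(a, b)\<close> carries the tile with number \<open>e\<close>.\<close>

definition template :: "nat \<Rightarrow> (nat \<times> nat) list \<Rightarrow> (nat list \<Rightarrow> bool) \<Rightarrow> ol_term" where
  "template E ds W =
    dnf (concat (map (\<lambda>(a, b). map (\<lambda>e. prod_encode (a, prod_encode (b, e))) [0..<E]) ds))
      (\<lambda>bs. \<exists>es. length es = length ds \<and> set es \<subseteq> {..<E} \<and> W es \<and> bs = concat (map (one_hot E) es))"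

definition place :: "nat \<Rightarrow> nat \<Rightarrow> nat \<Rightarrow> nat" where
  "place s i v = (case prod_decode v of (a, w) \<Rightarrow> case prod_decode w of (b, e) \<Rightarrow>
    cell_var (s + a) (i + b) e)"

lemma rename_template: "rename (place s i) (template E ds W) =
    dnf (concat (map (\<lambda>(a, b). map (cell_var (s + a) (i + b)) [0..<E]) ds))
      (\<lambda>bs. \<exists>es. length es = length ds \<and> set es \<subseteq> {..<E} \<and> W es \<and> bs = concat (map (one_hot E) es))"
  unfolding template_def rename_dnf
  by (simp add: map_concat place_def comp_def case_prod_unfold length_concat)

lemma one_hot_inject: "e < E \<Longrightarrow> one_hot E e = one_hot E e' \<Longrightarrow> e = e'"
  unfolding one_hot_def by (auto dest: bspec[of _ _ e])

lemma concat_blocks: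
  assumes "concat (map f xs) = concat (map g ys)" "length xs = length ys"
    and "\<And>x. length (f x) = E" "\<And>y. length (g y) = E"
  shows "map f xs = map g ys"
  using assms(1,2) by (intro concat_injective) (auto simp: set_zip assms(3,4))

text \<open>One valuation, true at the value of the entire conjunction, decodes all cells. Hence
  constraints that share a cell agree about its tile.\<close>

lemma (in height_two) template_sound:
  fixes a :: "nat \<Rightarrow> 'a" and C :: "((nat \<times> nat) \<times> (nat \<times> nat) list \<times> (nat list \<Rightarrow> bool)) list"
  assumes "ol_eval a (conj_term (map (\<lambda>((s, i), ds, W). rename (place s i) (template E ds W)) C)) \<noteq> bot"
  shows "\<exists>g. \<forall>((s, i), ds, W) \<in> set C. W (map (\<lambda>(a, b). g (s + a) (i + b)) ds) \<and>
    (\<forall>(a, b) \<in> set ds. g (s + a) (i + b) < E)"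
proof -
  let ?T = "\<lambda>((s, i), ds, W). rename (place s i) (template E ds W)"
  let ?p = "ol_eval a (conj_term (map ?T C))"
  obtain v where v: "v ?p" "v top" "\<And>x. v (- x) \<longleftrightarrow> \<not> v x" using valuation[OF assms] by blast
  define g where "g s i = (SOME e. e < E \<and> map (v \<circ> a \<circ> cell_var s i) [0..<E] = one_hot E e)" for s i
  have g: "g s i = e" if "e < E" "map (v \<circ> a \<circ> cell_var s i) [0..<E] = one_hot E e" for s i e
    unfolding g_def by (rule some_equality) (use that one_hot_inject in auto)
  have "W (map (\<lambda>(a, b). g (s + a) (i + b)) ds) \<and> (\<forall>(a, b) \<in> set ds. g (s + a) (i + b) < E)"
    if "((s, i), ds, W) \<in> set C" for s i ds W
  proof -
    have "rename (place s i) (template E ds W) \<in> set (map ?T C)" using that by force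
    then have "?p \<le> ol_eval a (rename (place s i) (template E ds W))" by (rule eval_conj_le)
    from eval_dnf_sound[OF assms this[unfolded rename_template[of s i E ds W]] v]
    obtain es where es: "length es = length ds" "set es \<subseteq> {..<E}" "W es"
      "concat (map (\<lambda>(d, b). map (v \<circ> a \<circ> cell_var (s + d) (i + b)) [0..<E]) ds) =
          concat (map (one_hot E) es)"
      by (auto simp: map_concat comp_def case_prod_unfold)
    have blocks: "map (\<lambda>(d, b). map (v \<circ> a \<circ> cell_var (s + d) (i + b)) [0..<E]) ds = map (one_hot E) es"
      by (rule concat_blocks[OF es(4)]) (auto simp: es(1) one_hot_def)
    have nth: "(case ds ! j of (d, b) \<Rightarrow> g (s + d) (i + b)) = es ! j" if j: "j < length ds" for j
    proof (cases "ds ! j")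
      case (Pair d b)
      have "map (v \<circ> a \<circ> cell_var (s + d) (i + b)) [0..<E] = one_hot E (es ! j)"
        using arg_cong[OF blocks, of "\<lambda>l. l ! j"] j Pair es(1) by simp
      moreover have "es ! j < E" using nth_mem[of j es] es(1,2) j by (simp add: subset_iff)
      ultimately show ?thesis using g Pair by simp
    qed
    then have "map (\<lambda>(d, b). g (s + d) (i + b)) ds = es"
      by (intro nth_equalityI) (auto simp: es(1))
    moreover have "case x of (d, b) \<Rightarrow> g (s + d) (i + b) < E" if "x \<in> set ds" for x
      using that nth es(1,2)
          by (auto simp: in_set_conv_nth) (metis case_prod_conv lessThan_iff nth_mem subsetD)
    ultimately show ?thesis using es(3) by blast
  qed
  then have "\<And>s i ds W. ((s, i), ds, W) \<in> set C \<Longrightarrow> W (map (\<lambda>(a, b). g (s + a) (i + b)) ds)"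
    and "\<And>s i ds W a b. ((s, i), ds, W) \<in> set C \<Longrightarrow> (a, b) \<in> set ds \<Longrightarrow> g (s + a) (i + b) < E"
    by blast+
  then show ?thesis by (intro exI[of _ g]) auto
qed

lemma template_complete:
  fixes C :: "((nat \<times> nat) \<times> (nat \<times> nat) list \<times> (nat list \<Rightarrow> bool)) list"
  assumes "\<And>s i ds W. ((s, i), ds, W) \<in> set C \<Longrightarrow> W (map (\<lambda>(a, b). g (s + a) (i + b)) ds) \<and>
    (\<forall>(a, b) \<in> set ds. g (s + a) (i + b) < E)"
  shows "\<exists>a::nat \<Rightarrow> 'a::orthocomplemented_lattice.
    ol_eval a (conj_term (map (\<lambda>((s, i), ds, W). rename (place s i) (template E ds W)) C)) = top"
proof -
  define \<beta> where "\<beta> v \<longleftrightarrow> (\<exists>s i. v = cell_var s i (g s i))" for v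
  have beta: "\<beta> (cell_var s i e) \<longleftrightarrow> e = g s i" for s i e
    by (auto simp: \<beta>_def cell_var_inject)
  define a :: "nat \<Rightarrow> 'a" where "a v = (if \<beta> v then top else bot)" for v
  have "ol_eval a (rename (place s i) (template E ds W)) = top" if C: "((s, i), ds, W) \<in> set C"
      for s i ds W
    unfolding rename_template
  proof (rule eval_dnf_top[where \<beta> = \<beta>])
    let ?es = "map (\<lambda>(a, b). g (s + a) (i + b)) ds"
    have "map \<beta> (concat (map (\<lambda>(a, b). map (cell_var (s + a) (i + b)) [0..<E]) ds)) =
        concat (map (one_hot E) ?es)"
      by (simp add: map_concat comp_def case_prod_unfold beta one_hot_def)
    then show "\<exists>es. length es = length ds \<and> set es \<subseteq> {..<E} \<and> W es \<and>
        map \<beta> (concat (map (\<lambda>(a, b). map (cell_var (s + a) (i + b)) [0..<E]) ds)) =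
        concat (map (one_hot E) es)"
      using assms[OF C] by (intro exI[of _ ?es]) auto
  qed (simp add: a_def)
  then show ?thesis by (intro exI[of _ a] eval_conj_top) auto
qed

section \<open>Tableaux of nondeterministic computations\<close>

text \<open>
  Row \<open>s\<close> of a tableau describes the configuration at time \<open>s\<close> relative to the heads: cell \<open>N + d\<close>
  contains the symbols which the \<open>k\<close> tapes carry at distance \<open>d\<close> from their heads. Moving a head thus
  means to shift the corresponding track. Each tile further tells whether it is left of cell \<open>N\<close>, at
  cell \<open>N\<close> or right of it (\<open>0\<close>, \<open>1\<close>, \<open>2\<close>), and the transition applied at time \<open>s\<close>.
\<close>

type_synonym tile = "nat \<times> (nat \<times> nat list \<times> nat \<times> (nat \<times> move) list) \<times> nat list"

abbreviation pos :: "tile \<Rightarrow> nat" where "pos t \<equiv> fst t"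
abbreviation trans :: "tile \<Rightarrow> nat \<times> nat list \<times> nat \<times> (nat \<times> move) list" where "trans t \<equiv> fst (snd t)"
abbreviation syms :: "tile \<Rightarrow> nat list" where "syms t \<equiv> snd (snd t)"

text \<open>All windows are copies of one template, which cannot depend on the column, so the head
  column must be recognisable from the tiles. Once a 1 occurs, these pairs permit only rows of the
  form 0...0 1 2...2.\<close>

definition adjacent :: "nat \<Rightarrow> nat \<Rightarrow> bool" where
  "adjacent p q \<longleftrightarrow> (p, q) \<in> {(0, 0), (0, 1), (1, 2), (2, 2)}"

definition source :: "move \<Rightarrow> 'b \<Rightarrow> 'b \<Rightarrow> 'b \<Rightarrow> 'b" where
  "source m a b c = (case m of Left_move \<Rightarrow> a | Stay \<Rightarrow> b | Right_move \<Rightarrow> c)"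

text \<open>The transition is repeated across the row because each cell must know how its tracks
  shift. After a left move, the symbol at a given distance from the head comes from the cell to the
  left; if that cell was the head cell, it is the symbol just written.\<close>

definition window :: "machine \<Rightarrow> tile \<Rightarrow> tile \<Rightarrow> tile \<Rightarrow> tile \<Rightarrow> bool" where
  "window M a b c d \<longleftrightarrow> trans b \<in> transitions M \<and> trans a = trans b \<and> trans b = trans c \<and>
    adjacent (pos a) (pos b) \<and> adjacent (pos b) (pos c) \<and> pos d = pos b \<and>
    (case trans b of (q, rs, q', as) \<Rightarrow> (pos b = 1 \<longrightarrow> syms b = rs) \<and> fst (trans d) = q' \<and>
      (\<forall>j < num_tapes M. syms d ! j =
        (let x = source (snd (as ! j)) a b c in if pos x = 1 then fst (as ! j) else syms x ! j)))"

definition blank_tile :: "machine \<Rightarrow> tile \<Rightarrow> bool" where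
  "blank_tile M t \<longleftrightarrow> syms t = replicate (num_tapes M) 0"

definition input_tile :: "machine \<Rightarrow> bool \<Rightarrow> tile \<Rightarrow> bool" where
  "input_tile M b t \<longleftrightarrow> syms t = bit b # replicate (num_tapes M - 1) 0"

definition origin_tile :: "tile \<Rightarrow> bool" where
  "origin_tile t \<longleftrightarrow> pos t = 1 \<and> fst (trans t) = 0"

text \<open>The border cells of later rows are left free. Wrong symbols there spread inwards by one
  column per row and do not reach the head column \<open>N\<close> before row
  \<open>N\<close>.\<close>

definition tableau :: "machine \<Rightarrow> (nat \<Rightarrow> nat \<Rightarrow> tile) \<Rightarrow> bool list \<Rightarrow> nat \<Rightarrow> bool" where
  "tableau M t x N \<longleftrightarrow>
    (\<forall>i < N. blank_tile M (t 0 i)) \<and>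
    origin_tile (t 0 N) \<and>
    (\<forall>i < length x. input_tile M (x ! i) (t 0 (N + i))) \<and>
    (\<forall>i < N. blank_tile M (t 0 (N + length x + i))) \<and>
    (\<forall>s < N. \<forall>i < 2 * N. window M (t s i) (t s (i + 1)) (t s (i + 2)) (t (s + 1) (i + 1)))"

definition relative :: "nat \<Rightarrow> config \<Rightarrow> nat \<Rightarrow> nat \<Rightarrow> nat" where
  "relative N c j i = fst (snd c ! j) (snd (snd c ! j) + int i - int N)"

lemma relative_act:
  assumes "j < length (snd c)" "length as = length (snd c)"
    and "int i' = int i + offset (snd (as ! j))"
  shows "relative N (q, map2 act as (snd c)) j i =
    (if i' = N then fst (as ! j) else relative N c j i')"
proof -
  obtain w m where a: "as ! j = (w, m)" by (cases "as ! j")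
  obtain tp h where c: "snd c ! j = (tp, h)" by (cases "snd c ! j")
  have *: "h + offset m + int i - int N = h + int i' - int N" using assms(3) a by simp
  have "relative N (q, map2 act as (snd c)) j i = (tp(h := w)) (h + int i' - int N)"
    using assms(1,2) a c by (simp add: relative_def act_def *)
  then show ?thesis using a c by (auto simp: relative_def)
qed

lemma relative_read:
  "relative N c j N = (case snd c ! j of (t, h) \<Rightarrow> t h)"
  by (simp add: relative_def split_beta)

lemma relative_initial:
  assumes "j < num_tapes M"
  shows "relative N (initial M x) j i =
    (if j = 0 \<and> N \<le> i \<and> i < N + length x then bit (x ! (i - N)) else 0)"
proof (cases "j = 0")
  case True
  have "nat (int i - int N) = i - N" by simp
  with True show ?thesis by (auto simp: relative_def initial_def tape_of_def bit_def)
next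
  case False
  with assms show ?thesis by (auto simp: relative_def initial_def tape_of_def nth_Cons')
qed

lemma adjacent_only_head:
  assumes "\<And>i. i \<le> 2 * N \<Longrightarrow> adjacent (p i) (p (Suc i))" "p N = 1" "i \<le> Suc (2 * N)"
  shows "p i = 1 \<longleftrightarrow> i = N"
proof -
  have right: "p (N + 1 + d) = 2" if "N + 1 + d \<le> Suc (2 * N)" for d
    using that
  proof (induction d)
    case 0
    then show ?case using assms(1)[of N] assms(2) by (auto simp: adjacent_def)
  next
    case (Suc d)
    then show ?case using assms(1)[of "N + 1 + d"] by (auto simp: adjacent_def)
  qed
  have left: "p (N - Suc d) = 0" if "d < N" for d
    using that
  proof (induction d)
    case 0
    then show ?case using assms(1)[of "N - 1"] assms(2) by (auto simp: adjacent_def)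
  next
    case (Suc d)
    then have "p (N - Suc d) = 0" "Suc (N - Suc (Suc d)) = N - Suc d" by simp_all
    then show ?case using assms(1)[of "N - Suc (Suc d)"] by (auto simp: adjacent_def)
  qed
  consider "i < N" | "i = N" | "i > N" by linarith
  then show ?thesis
  proof cases
    case 1
    then show ?thesis using left[of "N - Suc i"] by simp
  next
    case 2
    then show ?thesis using assms(2) by simp
  next
    case 3
    then show ?thesis using right[of "i - N - 1"] assms(3) by simp
  qed
qed

locale tableau_machine =
  fixes M :: machine and \<Gamma> :: "nat set"
  assumes turing: "turing_machine M" and symbols: "finite \<Gamma>" "{0, 1, 2} \<subseteq> \<Gamma>"
    and writes: "(q, rs, q', as) \<in> transitions M \<Longrightarrow> (b, m) \<in> set as \<Longrightarrow> b \<in> \<Gamma>"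
begin

lemma transition_lengths:
  "(q, rs, q', as) \<in> transitions M \<Longrightarrow> length rs = num_tapes M \<and> length as = num_tapes M"
  using turing unfolding turing_machine_def by blast

definition tiles :: "tile set" where
  "tiles = {0, 1, 2} \<times> transitions M \<times> {ws. set ws \<subseteq> \<Gamma> \<and> length ws = num_tapes M}"

lemma finite_tiles: "finite tiles"
  using turing symbols(1) unfolding tiles_def turing_machine_def
  by (intro finite_cartesian_product finite_lists_length_eq) auto

definition valid :: "config \<Rightarrow> bool" where
  "valid c \<longleftrightarrow> length (snd c) = num_tapes M \<and> (\<forall>j < num_tapes M. range (fst (snd c ! j)) \<subseteq> \<Gamma>)"

lemma valid_initial: "valid (initial M x)"
  using turing symbols(2)
  by (auto simp: valid_def initial_def tape_of_def turing_machine_def nth_Cons')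

lemma valid_step:
  assumes "step M c d" "valid c"
  shows "valid d"
proof -
  obtain q ts q' as where c: "c = (q, ts)" "d = (q', map2 act as ts)"
    and t: "(q, map (\<lambda>(t, h). t h) ts, q', as) \<in> transitions M"
    using assms(1) by (cases rule: step.cases) auto
  have len: "length as = num_tapes M" "length ts = num_tapes M"
    using transition_lengths[OF t] by auto
  have "range (fst (act (as ! j) (ts ! j))) \<subseteq> \<Gamma>" if j: "j < num_tapes M" for j
  proof -
    have "(fst (as ! j), snd (as ! j)) \<in> set as" using j len by simp
    then have "fst (as ! j) \<in> \<Gamma>" by (rule writes[OF t])
    moreover have "range (fst (ts ! j)) \<subseteq> \<Gamma>" using assms(2) c j by (simp add: valid_def)
    ultimately show ?thesis by (auto simp: act_def case_prod_beta)
  qed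
  then show ?thesis using len c by (simp add: valid_def)
qed

lemma tableau_run:
  assumes "tableau M t x N"
  shows "\<exists>c. (step M ^^ N) (initial M x) c"
proof -
  let ?k = "num_tapes M" and ?\<tau> = "\<lambda>s. trans (t s N)"
  have win: "window M (t s i) (t s (i + 1)) (t s (i + 2)) (t (s + 1) (i + 1))"
    if "s < N" "i < 2 * N" for s i
    using assms that by (simp add: tableau_def)
  define c where "c = rec_nat (initial M x)
    (\<lambda>s c. (fst (snd (snd (?\<tau> s))), map2 act (snd (snd (snd (?\<tau> s)))) (snd c)))"
  have c0: "c 0 = initial M x" by (simp add: c_def)
  have cS: "c (Suc s) = (fst (snd (snd (?\<tau> s))), map2 act (snd (snd (snd (?\<tau> s)))) (snd (c s)))" for s
    by (simp add: c_def)
  have trans: "trans (t s i) = ?\<tau> s" if "s < N" "i \<le> 2 * N" for s i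
  proof -
    have "i \<le> 2 * N \<Longrightarrow> trans (t s i) = trans (t s 0)" for i
    proof (induction i)
      case (Suc i)
      then show ?case using win[OF \<open>s < N\<close>, of i] by (simp add: window_def)
    qed simp
    from this[OF that(2)] this[of N] show ?thesis by simp
  qed
  have adj: "adjacent (pos (t s i)) (pos (t s (Suc i)))" if "s < N" "i \<le> 2 * N" for s i
  proof (cases "i < 2 * N")
    case True
    then show ?thesis using win[OF that(1), of i] by (simp add: window_def)
  next
    case False
    then have "i - 1 < 2 * N" "i - 1 + 1 = i" "i - 1 + 2 = Suc i" using that by auto
    then show ?thesis using win[OF that(1), of "i - 1"] by (simp add: window_def)
  qed
  have posN: "pos (t s N) = 1" if "s < N" for s
    using that
  proof (induction s)
    case 0
    then show ?case using assms by (simp add: tableau_def origin_tile_def)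
  next
    case (Suc s)
    then show ?case using win[of s "N - 1"] by (simp add: window_def)
  qed
  have pos: "pos (t s i) = 1 \<longleftrightarrow> i = N" if "s < N" "i \<le> Suc (2 * N)" for s i
    using adjacent_only_head[OF adj[OF that(1)] posN[OF that(1)] that(2)] by blast
  have winN: "window M (t s (N - 1)) (t s N) (t s (N + 1)) (t (s + 1) N)" if "s < N" for s
    using win[OF that, of "N - 1"] that by simp
  have \<tau>: "?\<tau> s \<in> transitions M" if "s < N" for s
    using winN[OF that] unfolding window_def by (rule conjunct1)
  have lens: "length (fst (snd (?\<tau> s))) = ?k \<and> length (snd (snd (snd (?\<tau> s)))) = ?k" if "s < N" for s
    using \<tau>[OF that] transition_lengths[of "fst (?\<tau> s)" "fst (snd (?\<tau> s))" "fst (snd (snd (?\<tau> s)))"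
        "snd (snd (snd (?\<tau> s)))"] by simp
  have len: "length (snd (c s)) = ?k" if "s \<le> N" for s
    using that
  proof (induction s)
    case 0
    have "1 \<le> ?k" using turing by (simp add: turing_machine_def)
    then show ?case by (simp add: c0 initial_def)
  next
    case (Suc s)
    then show ?case using lens[of s] by (simp add: cS)
  qed
  \<comment> \<open>The interval of reliable columns loses one column at each end per row; for
    \<open>s < N\<close> it still contains \<open>N\<close>.\<close>
  have main: "s < N \<Longrightarrow> fst (c s) = fst (?\<tau> s) \<and>
      (\<forall>i j. s + 1 \<le> i \<longrightarrow> i + s + 1 \<le> 2 * N \<longrightarrow> j < ?k \<longrightarrow> syms (t s i) ! j = relative N (c s) j i)" for s
  proof (induction s)
    case 0
    have "syms (t 0 i) ! j = relative N (c 0) j i" if i: "i < 2 * N" and j: "j < ?k" for i j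
    proof -
      consider "i < N" | "N \<le> i" "i < N + length x" | "N + length x \<le> i" by linarith
      then show ?thesis
      proof cases
        case 1
        then have "blank_tile M (t 0 i)" using assms by (simp add: tableau_def)
        with 1 j show ?thesis by (simp add: c0 relative_initial blank_tile_def)
      next
        case 2
        then have "input_tile M (x ! (i - N)) (t 0 (N + (i - N)))"
          using assms unfolding tableau_def by (metis less_diff_conv2 add.commute)
        with 2 j show ?thesis by (auto simp: c0 relative_initial input_tile_def nth_Cons')
      next
        case 3
        then have "i - (N + length x) < N" using i by linarith
        then have "blank_tile M (t 0 (N + length x + (i - (N + length x))))"
          using assms unfolding tableau_def by blast
        with 3 j show ?thesis by (simp add: c0 relative_initial blank_tile_def)
      qed
    qed
    moreover have "fst (c 0) = fst (?\<tau> 0)"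
      using assms by (simp add: c0 initial_def tableau_def origin_tile_def)
    ultimately show ?case by auto
  next
    case (Suc s)
    then have s: "s < N" by simp
    obtain q rs q' as where T: "?\<tau> s = (q, rs, q', as)" by (metis prod.exhaust)
    have "fst (?\<tau> (Suc s)) = q'"
      using winN[OF s] unfolding window_def T by simp
    then have "fst (c (Suc s)) = fst (?\<tau> (Suc s))"
      by (simp add: cS T)
    moreover have "syms (t (Suc s) i) ! j = relative N (c (Suc s)) j i"
      if i: "Suc s + 1 \<le> i" "i + Suc s + 1 \<le> 2 * N" and j: "j < ?k" for i j
    proof -
      define i' where "i' = source (snd (as ! j)) (i - 1) i (i + 1)"
      have i': "int i' = int i + offset (snd (as ! j))"
        using i by (cases "snd (as ! j)") (simp_all add: i'_def source_def)
      have range: "s + 1 \<le> i'" "i' + s + 1 \<le> 2 * N"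
        using i by (cases "snd (as ! j)"; simp add: i'_def source_def)+
      have src: "source (snd (as ! j)) (t s (i - 1)) (t s i) (t s (i + 1)) = t s i'"
        by (cases "snd (as ! j)") (simp_all add: i'_def source_def)
      have "window M (t s (i - 1)) (t s i) (t s (i + 1)) (t (Suc s) i)"
        using win[OF s, of "i - 1"] i by simp
      moreover have "trans (t s i) = (q, rs, q', as)" using trans[OF s, of i] T i by simp
      ultimately have "syms (t (Suc s) i) ! j =
          (if pos (t s i') = 1 then fst (as ! j) else syms (t s i') ! j)"
        using j src by (simp add: window_def)
      also have "\<dots> = (if i' = N then fst (as ! j) else relative N (c s) j i')"
        using pos[OF s, of i'] Suc.IH[OF s] range j by simp
      also have "\<dots> = relative N (c (Suc s)) j i"
        using relative_act[of j "c s" as i' i N q'] j len[of s] lens[OF s] s i' T by (simp add: cS)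
      finally show ?thesis .
    qed
    ultimately show ?case by blast
  qed
  have "step M (c s) (c (Suc s))" if s: "s < N" for s
  proof -
    obtain q rs q' as where T: "?\<tau> s = (q, rs, q', as)" by (metis prod.exhaust)
    have "syms (t s N) = rs"
      using winN[OF s] posN[OF s] unfolding window_def T by simp
    then have "rs ! j = relative N (c s) j N" if "j < ?k" for j
      using main[OF s] that s by auto
    then have "rs = map (\<lambda>(t, h). t h) (snd (c s))"
      using lens[OF s] T len[of s] s by (intro nth_equalityI) (auto simp: relative_read)
    then have "(q, map (\<lambda>(t, h). t h) (snd (c s)), q', as) \<in> transitions M" using \<tau>[OF s] T by simp
    from step.intros[OF this] main[OF s] T show ?thesis
      by (metis cS fst_conv snd_conv prod.collapse)
  qed
  then have "(step M ^^ N) (c 0) (c N)" by (auto simp: relpowp_fun_conv)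
  then show ?thesis unfolding c0 by blast
qed

text \<open>Row \<open>N\<close> must also carry a transition that applies to its configuration,
  since every tile contains one. Therefore the run is one step longer than the tableau is high. Rows
  beyond \<open>N\<close> repeat row \<open>N\<close>, with the sole purpose of making
  \<open>t\<close> total.\<close>

lemma run_tableau:
  assumes "(step M ^^ Suc N) (initial M x) d"
  shows "\<exists>t. tableau M t x N \<and> (\<forall>s i. t s i \<in> tiles)"
proof -
  let ?k = "num_tapes M"
  obtain c where c: "c 0 = initial M x" "\<And>s. s < Suc N \<Longrightarrow> step M (c s) (c (Suc s))"
    using assms unfolding relpowp_fun_conv by blast
  have valid: "s \<le> N \<Longrightarrow> valid (c s)" for s
  proof (induction s)
    case 0
    show ?case using c(1) valid_initial by simp
  next
    case (Suc s)
    then show ?case using valid_step c(2)[of s] by simp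
  qed
  have "\<exists>\<tau>. \<tau> \<in> transitions M \<and> fst \<tau> = fst (c s) \<and> fst (snd \<tau>) = map (\<lambda>(t, h). t h) (snd (c s)) \<and>
      c (Suc s) = (fst (snd (snd \<tau>)), map2 act (snd (snd (snd \<tau>))) (snd (c s)))" if "s \<le> N" for s
    using c(2)[of s] that by (cases rule: step.cases) auto
  then obtain \<tau> where \<tau>: "\<And>s. s \<le> N \<Longrightarrow> \<tau> s \<in> transitions M \<and> fst (\<tau> s) = fst (c s) \<and>
      fst (snd (\<tau> s)) = map (\<lambda>(t, h). t h) (snd (c s)) \<and>
      c (Suc s) = (fst (snd (snd (\<tau> s))), map2 act (snd (snd (snd (\<tau> s)))) (snd (c s)))"
    by metis
  define t :: "nat \<Rightarrow> nat \<Rightarrow> tile" where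
    "t s i = (if i < N then 0 else if i = N then 1 else 2, \<tau> (min s N),
      map (\<lambda>j. relative N (c (min s N)) j i) [0..<?k])" for s i
  have k: "1 \<le> ?k" using turing by (simp add: turing_machine_def)
  have "t s i \<in> tiles" for s i
  proof -
    have "relative N (c (min s N)) j i \<in> \<Gamma>" if "j < ?k" for j
      using valid[of "min s N"] that by (auto simp: valid_def relative_def)
    then show ?thesis using \<tau>[of "min s N"] by (auto simp: tiles_def t_def)
  qed
  moreover have "blank_tile M (t 0 i)" if "i < N \<or> N + length x \<le> i" for i
    unfolding blank_tile_def t_def
    using that by (auto intro!: nth_equalityI simp: c(1) relative_initial)
  moreover have "input_tile M (x ! i) (t 0 (N + i))" if "i < length x" for i
    unfolding input_tile_def t_def
    using that k by (auto intro!: nth_equalityI simp: c(1) relative_initial nth_Cons')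
  moreover have "origin_tile (t 0 N)"
    using \<tau>[of 0] c(1) by (simp add: origin_tile_def t_def initial_def)
  moreover have "window M (t s i) (t s (i + 1)) (t s (i + 2)) (t (s + 1) (i + 1))"
    if s: "s < N" and i: "i < 2 * N" for s i
  proof -
    obtain q rs q' as where T: "\<tau> s = (q, rs, q', as)" by (metis prod.exhaust)
    have len: "length (snd (c s)) = ?k" using valid[of s] s by (simp add: valid_def)
    have mem: "(q, rs, q', as) \<in> transitions M" using \<tau>[of s] T s by (metis less_imp_le)
    have lens: "length as = ?k" using transition_lengths[OF mem] by simp
    have cS: "c (Suc s) = (q', map2 act as (snd (c s)))" using \<tau>[of s] T s by simp
    have rs: "rs = map (\<lambda>j. relative N (c s) j N) [0..<?k]"
      using \<tau>[of s] T s len by (intro nth_equalityI) (auto simp: relative_read)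
    have head: "pos (t s i) = 1 \<longleftrightarrow> i = N" for i by (simp add: t_def)
    have sy: "syms (t s i) ! j = relative N (c s) j i" if "j < ?k" for i j
      using that s by (simp add: t_def)
    have "syms (t (s + 1) (i + 1)) ! j =
        (let x = source (snd (as ! j)) (t s i) (t s (i + 1)) (t s (i + 2))
         in if pos x = 1 then fst (as ! j) else syms x ! j)" if j: "j < ?k" for j
    proof -
      define i' where "i' = source (snd (as ! j)) i (i + 1) (i + 2)"
      have i': "int i' = int (i + 1) + offset (snd (as ! j))"
        by (cases "snd (as ! j)") (simp_all add: i'_def source_def)
      have src: "source (snd (as ! j)) (t s i) (t s (i + 1)) (t s (i + 2)) = t s i'"
        by (cases "snd (as ! j)") (simp_all add: i'_def source_def)
      have "syms (t (s + 1) (i + 1)) ! j = relative N (c (Suc s)) j (i + 1)"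
        using j s by (simp add: t_def min_def)
      also have "\<dots> = (if i' = N then fst (as ! j) else relative N (c s) j i')"
        unfolding cS by (rule relative_act) (use j len lens i' in auto)
      also have "\<dots> = (if pos (t s i') = 1 then fst (as ! j) else syms (t s i') ! j)"
        unfolding head using sy[OF j, of i'] by simp
      finally show ?thesis unfolding src Let_def .
    qed
    moreover have "fst (trans (t (s + 1) (i + 1))) = q'"
      using \<tau>[of "Suc s"] cS s by (simp add: t_def min_def)
    moreover have tr: "trans (t s i) = (q, rs, q', as)" for i
      using T s by (simp add: t_def)
    moreover note mem
    moreover have "pos (t s (i + 1)) = 1 \<longrightarrow> syms (t s (i + 1)) = rs"
      unfolding head rs using s by (simp add: t_def)
    moreover have "adjacent (pos (t s i)) (pos (t s (i + 1)))" "adjacent (pos (t s (i + 1))) (pos (t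
        s (i + 2)))"
      by (auto simp: t_def adjacent_def)
    moreover have "pos (t (s + 1) (i + 1)) = pos (t s (i + 1))" by (simp add: t_def)
    ultimately show ?thesis unfolding window_def tr by simp
  qed
  ultimately show ?thesis unfolding tableau_def by (intro exI[of _ t]) simp
qed

end


subsection \<open>Idling in accepting configurations\<close>

definition tape_symbols :: "machine \<Rightarrow> nat set" where
  "tape_symbols M = {0, 1, 2} \<union> (\<Union>(q, rs, q', as) \<in> transitions M. fst ` set as)"

text \<open>Loops in place of halting in state 1 turn acceptance into the existence of a long run,
  which is what a tableau of fixed height can express. The words are limited to
  \<open>tape_symbols\<close> to keep the set of transitions finite.\<close>

definition idle :: "machine \<Rightarrow> (nat \<times> nat list \<times> nat \<times> (nat \<times> move) list) set" where
  "idle M = {(1, rs, 1, map (\<lambda>b. (b, Stay)) rs) | rs.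
    set rs \<subseteq> tape_symbols M \<and> length rs = num_tapes M \<and> (\<forall>q as. (1, rs, q, as) \<notin> transitions M)}"

definition idling :: "machine \<Rightarrow> machine" where
  "idling M = M\<lparr>transitions := transitions M \<union> idle M\<rparr>"

lemma finite_tape_symbols: "turing_machine M \<Longrightarrow> finite (tape_symbols M)"
  by (auto simp: tape_symbols_def turing_machine_def)

lemma tableau_machine_idling:
  assumes "turing_machine M"
  shows "tableau_machine (idling M) (tape_symbols M)"
proof
  have "finite ((\<lambda>rs. (1::nat, rs, 1::nat, map (\<lambda>b. (b, Stay)) rs)) `
      {rs. set rs \<subseteq> tape_symbols M \<and> length rs = num_tapes M})"
    using finite_lists_length_eq[OF finite_tape_symbols[OF assms]] by blast
  then have "finite (idle M)" by (rule rev_finite_subset) (auto simp: idle_def)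
  then show "turing_machine (idling M)"
    using assms by (auto simp: turing_machine_def idling_def idle_def)
  show "finite (tape_symbols M)" using assms by (rule finite_tape_symbols)
  show "{0, 1, 2} \<subseteq> tape_symbols M" by (auto simp: tape_symbols_def)
  fix q rs q' as b m
  assume t: "(q, rs, q', as) \<in> transitions (idling M)" and b: "(b, m) \<in> set as"
  show "b \<in> tape_symbols M"
  proof (cases "(q, rs, q', as) \<in> transitions M")
    case True
    moreover have "b \<in> fst ` set as" using b by force
    ultimately have "b \<in> (\<Union>(q, rs, q', as) \<in> transitions M. fst ` set as)" by blast
    then show ?thesis unfolding tape_symbols_def by (rule UnI2)
  next
    case False
    then show ?thesis using t b by (auto simp: idling_def idle_def)
  qed
qed

lemma initial_idling [simp]: "initial (idling M) x = initial M x"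
  by (simp add: initial_def idling_def)

lemma num_tapes_idling [simp]: "num_tapes (idling M) = num_tapes M"
  by (simp add: idling_def)

lemma step_idling: "step M c d \<Longrightarrow> step (idling M) c d"
  by (auto simp: step.simps idling_def)

text \<open>The idle loop exists only for words over \<open>tape_symbols\<close>, so the tapes
  reached must stay within this alphabet; this is what \<open>valid\<close> records.\<close>

lemma accepting_run:
  assumes M: "turing_machine M" and p: "\<And>n c. (step M ^^ n) (initial M x) c \<Longrightarrow> n \<le> m"
    and "accepts M x" "m \<le> N"
  shows "\<exists>c. (step (idling M) ^^ N) (initial M x) c"
proof -
  interpret tableau_machine "idling M" "tape_symbols M"
    by (rule tableau_machine_idling[OF M])
  obtain n c where c: "(step M ^^ n) (initial M x) c" "halting M c" "fst c = 1"
    using assms(3) unfolding accepts_def by (auto dest: rtranclp_imp_relpowp)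
  have run: "(step (idling M) ^^ n) (initial M x) c"
    using c(1) by (induction n arbitrary: c) (auto intro: step_idling)
  have "valid c'" if "(step (idling M) ^^ n) (initial M x) c'" for n c'
    using that
  proof (induction n arbitrary: c')
    case 0
    then show ?case using valid_initial[of x] by simp
  next
    case (Suc n)
    from Suc.prems obtain c1 where "(step (idling M) ^^ n) (initial M x) c1" "step (idling M) c1 c'"
      by (rule relpowp_Suc_E)
    then show ?case using valid_step Suc.IH by blast
  qed
  from this[OF run] have v: "length (snd c) = num_tapes M"
    "\<And>j. j < num_tapes M \<Longrightarrow> range (fst (snd c ! j)) \<subseteq> tape_symbols M"
    using num_tapes_idling[of M] by (auto simp: valid_def)
  obtain ts where ts: "c = (1, ts)" using c(3) by (cases c) auto
  let ?rs = "map (\<lambda>(t, h). t h) ts"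
  have "set ?rs \<subseteq> tape_symbols M"
    using v ts by (fastforce simp: in_set_conv_nth)
  moreover have "(1, ?rs, q, as) \<notin> transitions M" for q as
    using c(2) ts by (auto simp: halting_def step.simps)
  ultimately have "(1, ?rs, 1, map (\<lambda>b. (b, Stay)) ?rs) \<in> transitions (idling M)"
    using v(1) ts by (auto simp: idling_def idle_def)
  from step.intros[OF this] have "step (idling M) c (1, map2 act (map (\<lambda>b. (b, Stay)) ?rs) ts)"
    by (simp add: ts)
  moreover have "map2 act (map (\<lambda>b. (b, Stay)) ?rs) ts = ts"
    by (rule nth_equalityI) (auto simp: act_def split: prod.splits)
  ultimately have loop: "step (idling M) c c" by (simp add: ts)
  have "(step (idling M) ^^ l) c c" for l
    by (induction l) (auto intro: loop)
  moreover have "n + (N - n) = N" using p[OF c(1)] assms(4) by simp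
  ultimately show ?thesis using relpowp_plus[OF run, of "N - n" c] by metis
qed

text \<open>A run of more than \<open>m\<close> steps cannot consist of steps of \<open>M\<close>
  alone. Its first foreign step starts in a halting configuration of \<open>M\<close> with state 1,
  reached by steps of \<open>M\<close>.\<close>

lemma run_accepting:
  assumes M: "turing_machine M" and p: "\<And>n c. (step M ^^ n) (initial M x) c \<Longrightarrow> n \<le> m"
    and "(step (idling M) ^^ N) (initial M x) c" "m < N"
  shows "accepts M x"
proof -
  have "(step M ^^ n) (initial M x) c' \<or> accepts M x" if "(step (idling M) ^^ n) (initial M x) c'"
      for n c'
    using that
  proof (induction n arbitrary: c')
    case 0
    then show ?case by simp
  next
    case (Suc n)
    obtain c1 where c1: "(step (idling M) ^^ n) (initial M x) c1" "step (idling M) c1 c'"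
      using Suc.prems by (auto elim: relpowp_Suc_E)
    show ?case
    proof (cases "accepts M x")
      case False
      then have run: "(step M ^^ n) (initial M x) c1" using Suc.IH[OF c1(1)] by blast
      have "step M c1 c'"
      proof (rule ccontr)
        assume no: "\<not> step M c1 c'"
        obtain q ts q' as where t: "c1 = (q, ts)" "c' = (q', map2 act as ts)"
          "(q, map (\<lambda>(t, h). t h) ts, q', as) \<in> transitions (idling M)"
          using c1(2) by (cases rule: step.cases) auto
        have "(q, map (\<lambda>(t, h). t h) ts, q', as) \<in> idle M"
          using t no step.intros[of q ts q' as M] by (auto simp: idling_def)
        then have "q = 1" "\<And>q as. (1, map (\<lambda>(t, h). t h) ts, q, as) \<notin> transitions M"
          by (auto simp: idle_def)
        then have "halting M c1" "fst c1 = 1" using t(1) by (auto simp: halting_def step.simps)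
        with run False show False unfolding accepts_def by (meson relpowp_imp_rtranclp)
      qed
      then show ?thesis using run by (auto intro: relpowp_Suc_I)
    qed simp
  qed
  from this[OF assms(3)] show ?thesis using p[of N c] assms(4) by auto
qed

section \<open>The reduction\<close>

lemma replicate_minus: "q < m \<Longrightarrow> replicate (m - q) x = x # replicate (m - Suc q) x"
  by (metis Suc_diff_Suc replicate_Suc)

text \<open>Instead of an invariant, the store after \<open>q\<close> rounds is supplied in closed
  form as \<open>st q\<close>.\<close>

lemma iterate_stages:
  assumes "\<And>q. q < m \<Longrightarrow> b (tops (st q)) \<and> F (st q) = Some (st (Suc q))"
    and "\<not> b (tops (st m))" "m \<le> S"
  shows "iterate b F S (st 0) = Some (st m)"
  using assms
proof (induction m arbitrary: st S)
  case 0
  then show ?case by (cases S) auto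
next
  case (Suc m)
  obtain S' where S: "S = Suc S'" "m \<le> S'" using Suc.prems(3) by (cases S) auto
  have "iterate b F S' (st (Suc 0)) = Some (st (Suc m))"
    by (rule Suc.IH[of "\<lambda>q. st (Suc q)"]) (use Suc.prems S in auto)
  then show ?case using Suc.prems(1)[of 0] S by simp
qed

definition move :: "nat \<Rightarrow> nat \<Rightarrow> prog" where
  "move i j = Loop (\<lambda>r. r i \<noteq> 0) (Push j (\<lambda>r. r i) ;; Pop i)"

lemma exec_move:
  assumes "i \<noteq> j" "0 \<notin> set (\<sigma> i)" "length (\<sigma> i) \<le> S"
  shows "exec S (move i j) \<sigma> = Some (\<sigma>(i := [], j := rev (\<sigma> i) @ \<sigma> j))"
proof -
  let ?st = "\<lambda>q. \<sigma>(i := drop q (\<sigma> i), j := rev (take q (\<sigma> i)) @ \<sigma> j)"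
  have "iterate (\<lambda>r. r i \<noteq> 0) (exec S (Push j (\<lambda>r. r i) ;; Pop i)) S (?st 0) = Some (?st (length (\<sigma> i)))"
  proof (rule iterate_stages[where st = ?st])
    fix q
    assume q: "q < length (\<sigma> i)"
    then have d: "drop q (\<sigma> i) = \<sigma> i ! q # drop (Suc q) (\<sigma> i)" by (simp add: Cons_nth_drop_Suc)
    have "\<sigma> i ! q \<noteq> 0" using q assms(2) by (metis nth_mem)
    then show "tops (?st q) i \<noteq> 0 \<and> exec S (Push j (\<lambda>r. r i) ;; Pop i) (?st q) = Some (?st (Suc q))"
      using assms(1) q d by (auto simp: tops_def fun_eq_iff take_Suc_conv_app_nth)
  qed (use assms in \<open>auto simp: tops_def\<close>)
  then show ?thesis by (simp add: move_def)
qed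

definition clear :: "nat \<Rightarrow> prog" where
  "clear i = Loop (\<lambda>r. r i \<noteq> 0) (Pop i)"

lemma exec_clear:
  assumes "0 \<notin> set (\<sigma> i)" "length (\<sigma> i) \<le> S"
  shows "exec S (clear i) \<sigma> = Some (\<sigma>(i := []))"
proof -
  let ?st = "\<lambda>q. \<sigma>(i := drop q (\<sigma> i))"
  have "iterate (\<lambda>r. r i \<noteq> 0) (exec S (Pop i)) S (?st 0) = Some (?st (length (\<sigma> i)))"
  proof (rule iterate_stages[where st = ?st])
    fix q
    assume q: "q < length (\<sigma> i)"
    then have d: "drop q (\<sigma> i) = \<sigma> i ! q # drop (Suc q) (\<sigma> i)" by (simp add: Cons_nth_drop_Suc)
    have "\<sigma> i ! q \<noteq> 0" using q assms(1) by (metis nth_mem)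
    then show "tops (?st q) i \<noteq> 0 \<and> exec S (Pop i) (?st q) = Some (?st (Suc q))"
      using q d by (auto simp: tops_def fun_eq_iff)
  qed (use assms in \<open>auto simp: tops_def\<close>)
  then show ?thesis by (simp add: clear_def)
qed


subsection \<open>Emitting terms\<close>

text \<open>
  The output is written on stack \<open>11\<close>. Stacks \<open>8\<close> and \<open>9\<close> hold the coordinates \<open>s\<close> and \<open>i\<close> of the
  current cell in unary, and stack \<open>10\<close> is used for copying.
\<close>

definition append_output :: "bool list \<Rightarrow> store \<Rightarrow> store" where
  "append_output w \<sigma> = \<sigma>(11 := rev (map bit w) @ \<sigma> 11)"

lemma append_append_output [simp]: "append_output v (append_output w \<sigma>) = append_output (w @ v) \<sigma>"
  by (simp add: append_output_def)

lemma append_output_other [simp]: "j \<noteq> 11 \<Longrightarrow> append_output w \<sigma> j = \<sigma> j"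
  by (simp add: append_output_def)

lemma append_output_upd: "j \<noteq> 11 \<Longrightarrow> append_output w (\<sigma>(j := xs)) = (append_output w \<sigma>)(j := xs)"
  by (auto simp: append_output_def)

primrec emit :: "bool list \<Rightarrow> prog" where
  "emit [] = Skip"
| "emit (b # bs) = Push 11 (\<lambda>_. bit b) ;; emit bs"

lemma exec_emit [simp]: "exec S (emit bs) \<sigma> = Some (append_output bs \<sigma>)"
  by (induction bs arbitrary: \<sigma>) (auto simp: append_output_def)

declare emit.simps [simp del]

definition digits :: "bool list \<Rightarrow> bool list" where
  "digits bs = concat (map (\<lambda>b. [True, True, b]) bs)"

lemma digits_append: "digits (bs @ cs) = digits bs @ digits cs"
  by (simp add: digits_def)

definition emit_unary :: "nat \<Rightarrow> prog" where
  "emit_unary i = Loop (\<lambda>r. r i \<noteq> 0) (Push 10 (\<lambda>_. 1) ;; Pop i ;; emit [True, True, True]) ;; move 10 i"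

lemma exec_emit_unary:
  assumes "\<sigma> i = replicate m 1" "\<sigma> 10 = []" "m \<le> S" "i < 10"
  shows "exec S (emit_unary i) \<sigma> = Some (append_output (digits (replicate m True)) \<sigma>)"
proof -
  let ?st = "\<lambda>q. (append_output (digits (replicate q True)) \<sigma>)(i := replicate (m - q) 1, 10 :=
      replicate q 1)"
  let ?F = "exec S (Push 10 (\<lambda>_. 1) ;; Pop i ;; emit [True, True, True])"
  have "iterate (\<lambda>r. r i \<noteq> 0) ?F S (?st 0) = Some (?st m)"
  proof (rule iterate_stages[where st = ?st])
    fix q
    assume q: "q < m"
    then have d: "replicate (m - q) (1::nat) = 1 # replicate (m - Suc q) 1"
      by (rule replicate_minus)
    have e: "digits (replicate (Suc q) True) = digits (replicate q True) @ [True, True, True]"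
      unfolding replicate_append_same[symmetric] replicate_Suc digits_append by (simp add: digits_def)
    show "tops (?st q) i \<noteq> 0 \<and> ?F (?st q) = Some (?st (Suc q))"
      using assms(4) d e by (auto simp: tops_def fun_eq_iff append_output_def)
  qed (use assms in \<open>auto simp: tops_def\<close>)
  moreover have "?st 0 = \<sigma>" using assms by (auto simp: fun_eq_iff append_output_def digits_def)
  ultimately have "exec S (emit_unary i) \<sigma> = exec S (move 10 i) (?st m)"
    by (simp add: emit_unary_def)
  also have "\<dots> = Some (append_output (digits (replicate m True)) \<sigma>)"
    using assms by (subst exec_move) (auto simp: fun_eq_iff append_output_def)
  finally show ?thesis .
qed

text \<open>Prints the digits of \<open>cell_bits\<close> from left to right. The offsets
  \<open>a\<close> and \<open>b\<close> are constants of the template and merely lengthen the unary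
  blocks.\<close>

definition emit_var :: "nat \<Rightarrow> prog" where
  "emit_var v = (case prod_decode v of (a, w) \<Rightarrow> case prod_decode w of (b, e) \<Rightarrow>
    emit ([True, False, True] @ digits [True]) ;; emit_unary 8 ;;
    emit (digits (replicate a True @ [False])) ;; emit_unary 9 ;;
    emit (digits (replicate b True @ False # replicate e True)))"

lemma exec_emit_var:
  assumes "\<sigma> 8 = replicate s 1" "\<sigma> 9 = replicate i 1" "\<sigma> 10 = []" "s \<le> S" "i \<le> S"
  shows "exec S (emit_var v) \<sigma> = Some (append_output (encode (Var (place s i v))) \<sigma>)"
proof -
  obtain a w where v: "prod_decode v = (a, w)" by (metis prod.exhaust)
  obtain b e where w: "prod_decode w = (b, e)" by (metis prod.exhaust)
  have "encode (Var (place s i v)) = [True, False, True] @ digits (binary (Suc (place s i v)))"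
    by (simp add: digits_def)
  also have "binary (Suc (place s i v)) = [True] @ replicate s True @ (replicate a True @ [False]) @
      replicate i True @ (replicate b True @ False # replicate e True)"
    by (simp add: place_def v w binary_cell_var cell_bits_def replicate_add)
  finally have *: "encode (Var (place s i v)) = [True, False, True] @ digits [True] @
      digits (replicate s True) @ digits (replicate a True @ [False]) @ digits (replicate i True) @
      digits (replicate b True @ False # replicate e True)"
    by (simp only: digits_append append_assoc)
  show ?thesis
    using assms unfolding * by (simp add: emit_var_def v w exec_emit_unary)
qed

primrec emit_term :: "ol_term \<Rightarrow> prog" where
  "emit_term (Var v) = emit_var v"
| "emit_term Zero = emit [False, False, False]"
| "emit_term One = emit [False, False, True]"
| "emit_term (Neg t) = emit [False, True, False] ;; emit_term t"
| "emit_term (Meet t u) = emit [False, True, True] ;; emit_term t ;; emit_term u"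
| "emit_term (Join t u) = emit [True, False, False] ;; emit_term t ;; emit_term u"

lemma exec_emit_term:
  assumes "\<sigma> 8 = replicate s 1" "\<sigma> 9 = replicate i 1" "\<sigma> 10 = []" "s \<le> S" "i \<le> S"
  shows "exec S (emit_term t) \<sigma> = Some (append_output (encode (rename (place s i) t)) \<sigma>)"
  using assms(1-3)
  by (induction t arbitrary: \<sigma>) (simp_all add: exec_emit_var assms(4,5) del: encode.simps(6))

text \<open>In prefix notation a right-nested conjunction is a plain sequence of such pieces, closed
  by the code of \<open>One\<close>. Conjuncts can thus be written without knowing how many
  follow.\<close>

definition conjunct :: "ol_term \<Rightarrow> bool list" where
  "conjunct t = [False, True, True] @ encode t"

lemma encode_conj_term: "encode (conj_term ts) = concat (map conjunct ts) @ encode One"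
  by (induction ts) (auto simp: conj_term_def conjunct_def)

definition emit_conjunct :: "ol_term \<Rightarrow> prog" where
  "emit_conjunct t = emit [False, True, True] ;; emit_term t"

lemma exec_emit_conjunct:
  assumes "\<sigma> 8 = replicate s 1" "\<sigma> 9 = replicate i 1" "\<sigma> 10 = []" "s \<le> S" "i \<le> S"
  shows "exec S (emit_conjunct t) \<sigma> = Some (append_output (conjunct (rename (place s i) t)) \<sigma>)"
  using assms by (simp add: emit_conjunct_def exec_emit_term conjunct_def)

text \<open>The counter is moved from \<open>i\<close> to \<open>j\<close> rather than consumed, so
  that a later sweep can run back. Stack \<open>9\<close> keeps counting columns across
  sweeps.\<close>

definition sweep :: "ol_term \<Rightarrow> nat \<Rightarrow> nat \<Rightarrow> prog" where
  "sweep t i j = Loop (\<lambda>r. r i \<noteq> 0) (emit_conjunct t ;; Push 9 (\<lambda>_. 1) ;; Pop i ;; Push j (\<lambda>_. 1))"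

lemma exec_sweep:
  assumes "\<sigma> i = replicate m 1" "\<sigma> j = []" "\<sigma> 8 = replicate s 1" "\<sigma> 9 = replicate p 1" "\<sigma> 10 = []"
    and "s \<le> S" "p + m \<le> S" "i \<noteq> j" "i < 8" "j < 8"
  shows "exec S (sweep t i j) \<sigma> =
    Some ((append_output (concat (map (\<lambda>q. conjunct (rename (place s (p + q)) t)) [0..<m])) \<sigma>)
      (i := [], j := replicate m 1, 9 := replicate (p + m) 1))"
proof -
  let ?w = "\<lambda>m. concat (map (\<lambda>q. conjunct (rename (place s (p + q)) t)) [0..<m])"
  let ?st = "\<lambda>q. (append_output (?w q) \<sigma>)(i := replicate (m - q) 1, j := replicate q 1, 9 :=
      replicate (p + q) 1)"
  let ?F = "exec S (emit_conjunct t ;; Push 9 (\<lambda>_. 1) ;; Pop i ;; Push j (\<lambda>_. 1))"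
  have "iterate (\<lambda>r. r i \<noteq> 0) ?F S (?st 0) = Some (?st m)"
  proof (rule iterate_stages[where st = ?st])
    fix q
    assume q: "q < m"
    then have d: "replicate (m - q) (1::nat) = 1 # replicate (m - Suc q) 1"
      by (rule replicate_minus)
    have "exec S (emit_conjunct t) (?st q) =
        Some (append_output (conjunct (rename (place s (p + q)) t)) (?st q))"
      by (rule exec_emit_conjunct) (use assms q in auto)
    moreover define \<rho> where "\<rho> = append_output (conjunct (rename (place s (p + q)) t)) (?st q)"
    ultimately have "exec S (emit_conjunct t) (?st q) = Some \<rho>" by simp
    moreover have \<rho>: "\<rho> i = 1 # replicate (m - Suc q) 1" "\<rho> 9 = replicate (p + q) 1"
      "\<rho> j = replicate q 1"
      unfolding \<rho>_def using assms(8-) d by simp_all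
    moreover have "i \<noteq> 9" "j \<noteq> 9" using assms by simp_all
    ultimately have "?F (?st q) =
        Some (\<rho>(9 := 1 # replicate (p + q) 1, i := replicate (m - Suc q) 1, j := 1 # replicate q 1))"
      using assms(8) by (simp only: exec.simps bind.bind_lunit) simp
    also have "\<rho>(9 := 1 # replicate (p + q) 1, i := replicate (m - Suc q) 1, j :=
        1 # replicate q 1) = ?st (Suc q)"
      unfolding \<rho>_def by (rule ext) (use assms(8-) in \<open>simp add: append_output_def\<close>)
    finally have "?F (?st q) = Some (?st (Suc q))" .
    moreover have "tops (?st q) i \<noteq> 0" using assms(8-) d by (simp add: tops_def)
    ultimately show "tops (?st q) i \<noteq> 0 \<and> ?F (?st q) = Some (?st (Suc q))" by blast
  next
    show "\<not> tops (?st m) i \<noteq> 0" using assms(8-10) by (simp add: tops_def)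
    show "m \<le> S" using assms(7) by simp
  qed
  moreover have "?st 0 = \<sigma>" using assms by (auto simp: fun_eq_iff append_output_def)
  ultimately show ?thesis by (simp add: sweep_def)
qed


subsection \<open>Unary arithmetic\<close>

primrec push_ones :: "nat \<Rightarrow> nat \<Rightarrow> prog" where
  "push_ones j 0 = Skip"
| "push_ones j (Suc n) = Push j (\<lambda>_. 1) ;; push_ones j n"

lemma exec_push_ones: "exec S (push_ones j n) \<sigma> = Some (\<sigma>(j := replicate n 1 @ \<sigma> j))"
  by (induction n arbitrary: \<sigma>) (auto simp: replicate_app_Cons_same)

definition copy :: "nat \<Rightarrow> nat \<Rightarrow> prog" where
  "copy i j = Loop (\<lambda>r. r i \<noteq> 0) (Push 10 (\<lambda>_. 1) ;; Pop i ;; Push j (\<lambda>_. 1)) ;; move 10 i"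

lemma exec_copy:
  assumes "\<sigma> i = replicate m 1" "\<sigma> 10 = []" "m \<le> S" "i < 10" "j < 10" "i \<noteq> j"
  shows "exec S (copy i j) \<sigma> = Some (\<sigma>(j := replicate m 1 @ \<sigma> j))"
proof -
  let ?st = "\<lambda>q. \<sigma>(i := replicate (m - q) 1, 10 := replicate q 1, j := replicate q 1 @ \<sigma> j)"
  let ?F = "exec S (Push 10 (\<lambda>_. 1) ;; Pop i ;; Push j (\<lambda>_. 1))"
  have "iterate (\<lambda>r. r i \<noteq> 0) ?F S (?st 0) = Some (?st m)"
  proof (rule iterate_stages[where st = ?st])
    fix q
    assume q: "q < m"
    then have d: "replicate (m - q) (1::nat) = 1 # replicate (m - Suc q) 1"
      by (rule replicate_minus)
    show "tops (?st q) i \<noteq> 0 \<and> ?F (?st q) = Some (?st (Suc q))"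
      using assms(4-) d by (auto simp: tops_def fun_eq_iff)
  qed (use assms in \<open>auto simp: tops_def\<close>)
  moreover have "?st 0 = \<sigma>" using assms by (auto simp: fun_eq_iff)
  ultimately have "exec S (copy i j) \<sigma> = exec S (move 10 i) (?st m)"
    by (simp add: copy_def)
  also have "\<dots> = Some (\<sigma>(j := replicate m 1 @ \<sigma> j))"
    using assms by (subst exec_move) (auto simp: fun_eq_iff)
  finally show ?thesis .
qed

definition multiply :: prog where
  "multiply = Loop (\<lambda>r. r 5 \<noteq> 0) (Pop 5 ;; copy 2 6) ;; move 6 5"

lemma exec_multiply:
  assumes "\<sigma> 5 = replicate a 1" "\<sigma> 2 = replicate m 1" "\<sigma> 6 = []" "\<sigma> 10 = []" "a \<le> S" "m \<le> S" "a * m \<le> S"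
  shows "exec S multiply \<sigma> = Some (\<sigma>(5 := replicate (a * m) 1))"
proof -
  let ?st = "\<lambda>q. \<sigma>(5 := replicate (a - q) 1, 6 := replicate (q * m) 1)"
  let ?F = "exec S (Pop 5 ;; copy 2 6)"
  have "iterate (\<lambda>r. r 5 \<noteq> 0) ?F S (?st 0) = Some (?st a)"
  proof (rule iterate_stages[where st = ?st])
    fix q
    assume q: "q < a"
    then have d: "replicate (a - q) (1::nat) = 1 # replicate (a - Suc q) 1"
      by (rule replicate_minus)
    have "exec S (copy 2 6) ((?st q)(5 := replicate (a - Suc q) 1)) =
        Some (((?st q)(5 := replicate (a - Suc q) 1))(6 := replicate m 1 @ replicate (q * m) 1))"
      by (subst exec_copy[where m = m]) (use assms in auto)
    moreover have "replicate m 1 @ replicate (q * m) (1::nat) = replicate (Suc q * m) 1"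
      by (simp add: replicate_add)
    ultimately show "tops (?st q) 5 \<noteq> 0 \<and> ?F (?st q) = Some (?st (Suc q))"
      using d by (simp add: tops_def fun_upd_twist)
  qed (use assms in \<open>auto simp: tops_def\<close>)
  moreover have "?st 0 = \<sigma>" using assms by (auto simp: fun_eq_iff)
  ultimately have "exec S multiply \<sigma> = exec S (move 6 5) (?st a)"
    by (simp add: multiply_def)
  also have "\<dots> = Some (\<sigma>(5 := replicate (a * m) 1))"
    using assms by (subst exec_move) (auto simp: fun_eq_iff)
  finally show ?thesis .
qed

primrec power_prog :: "nat \<Rightarrow> prog" where
  "power_prog 0 = Skip"
| "power_prog (Suc d) = multiply ;; power_prog d"

lemma exec_power:
  assumes "\<sigma> 5 = replicate a 1" "\<sigma> 2 = replicate m 1" "\<sigma> 6 = []" "\<sigma> 10 =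
      []" "1 \<le> m" "m \<le> S" "a * m ^ d \<le> S"
  shows "exec S (power_prog d) \<sigma> = Some (\<sigma>(5 := replicate (a * m ^ d) 1))"
  using assms(1-4,7)
proof (induction d arbitrary: a \<sigma>)
  case 0
  then show ?case by (auto simp: fun_eq_iff)
next
  case (Suc d)
  \<comment> \<open>As the base is positive, no intermediate product exceeds the final one, and a
    single bound \<open>S\<close> covers all loops.\<close>
  have "1 \<le> m ^ d" using assms(5) by simp
  then have "a * m * 1 \<le> a * m * m ^ d" by (intro mult_le_mono2)
  then have le: "a * m \<le> a * m * m ^ d" by simp
  have am': "a * m * m ^ d \<le> S" using Suc.prems(5) by (simp add: ac_simps)
  have am: "a * m \<le> S" "a * m * m ^ d \<le> S" using le am' by (rule le_trans) (rule am')
  have "a * 1 \<le> a * m" using assms(5) by (intro mult_le_mono2)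
  then have "a \<le> S" using am(1) by (simp only: mult_1_right)
  then have "exec S multiply \<sigma> = Some (\<sigma>(5 := replicate (a * m) 1))"
    using Suc.prems am(1) assms(6) by (intro exec_multiply) auto
  moreover have "exec S (power_prog d) (\<sigma>(5 := replicate (a * m) 1)) =
      Some ((\<sigma>(5 := replicate (a * m) 1))(5 := replicate (a * m * m ^ d) 1))"
    by (rule Suc.IH) (use Suc.prems am in auto)
  ultimately show ?case by (simp add: ac_simps fun_eq_iff)
qed


subsection \<open>The reduction program\<close>

text \<open>With a single letter to guess, the certificate on stack \<open>2\<close> is the input
  length in unary, and it serves as the number to start from. The power is left on \<open>5\<close>
  as column counter and on \<open>7\<close> as row counter.\<close>

definition sizes :: "nat \<Rightarrow> nat \<Rightarrow> prog" where
  "sizes c d = push_ones 2 c ;; Push 5 (\<lambda>_. 1) ;; power_prog d ;; copy 5 7"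

lemma exec_sizes:
  assumes "\<sigma> 2 = replicate n 1" "\<And>j. 4 \<le> j \<Longrightarrow> \<sigma> j = []"
    and "1 \<le> c" "n + c \<le> S" "(n + c) ^ d \<le> S"
  shows "exec S (sizes c d) \<sigma> = Some (\<sigma>(2 := replicate (n + c) 1,
    5 := replicate ((n + c) ^ d) 1, 7 := replicate ((n + c) ^ d) 1))"
proof -
  let ?N = "(n + c) ^ d"
  define \<rho> where "\<rho> = \<sigma>(2 := replicate (n + c) 1, 5 := replicate 1 1)"
  have "exec S (sizes c d) \<sigma> = Option.bind (exec S (power_prog d) \<rho>) (exec S (copy 5 7))"
    using assms(1,2) by (simp add: sizes_def exec_push_ones \<rho>_def replicate_add add.commute)
  also have "exec S (power_prog d) \<rho> = Some (\<rho>(5 := replicate (1 * ?N) 1))"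
    by (rule exec_power) (use assms in \<open>auto simp: \<rho>_def\<close>)
  also have "Option.bind \<dots> (exec S (copy 5 7)) = Some (\<rho>(5 := replicate ?N 1, 7 := replicate ?N 1))"
    by (subst bind.bind_lunit, subst exec_copy) (use assms in \<open>auto simp: \<rho>_def\<close>)
  finally show ?thesis by (simp add: \<rho>_def)
qed

definition input_row :: "(bool \<Rightarrow> ol_term) \<Rightarrow> prog" where
  "input_row tin = Loop (\<lambda>r. r 4 \<noteq> 0) (Cond (\<lambda>r. r 4 =
      2) (emit_conjunct (tin True)) (emit_conjunct (tin False)) ;;
    Pop 4 ;; Push 9 (\<lambda>_. 1))"

lemma exec_input_row:
  assumes "\<sigma> 4 = map bit x" "\<sigma> 8 = []" "\<sigma> 9 = replicate p 1" "\<sigma> 10 = []" "p + length x \<le> S"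
  shows "exec S (input_row tin) \<sigma> =
    Some ((append_output (concat (map (\<lambda>q. conjunct (rename (place 0 (p + q)) (tin (x ! q))))
        [0..<length x])) \<sigma>)
      (4 := [], 9 := replicate (p + length x) 1))"
proof -
  let ?w = "\<lambda>m. concat (map (\<lambda>q. conjunct (rename (place 0 (p + q)) (tin (x ! q)))) [0..<m])"
  let ?st = "\<lambda>q. (append_output (?w q) \<sigma>)(4 := map bit (drop q x), 9 := replicate (p + q) 1)"
  let ?F = "exec S (Cond (\<lambda>r. r 4 = 2) (emit_conjunct (tin True)) (emit_conjunct (tin False)) ;;
    Pop 4 ;; Push 9 (\<lambda>_. 1))"
  have "iterate (\<lambda>r. r 4 \<noteq> 0) ?F S (?st 0) = Some (?st (length x))"
  proof (rule iterate_stages[where st = ?st])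
    fix q
    assume q: "q < length x"
    then have d: "drop q x = x ! q # drop (Suc q) x" by (simp add: Cons_nth_drop_Suc)
    have e: "exec S (emit_conjunct t) (?st q) =
        Some (append_output (conjunct (rename (place 0 (p + q)) t)) (?st q))" for t
      by (rule exec_emit_conjunct) (use assms q in auto)
    have top: "tops (?st q) 4 = bit (x ! q)" using d by (simp add: tops_def)
    have "exec S (Cond (\<lambda>r. r 4 = 2) (emit_conjunct (tin True)) (emit_conjunct (tin False))) (?st q) =
        Some (append_output (conjunct (rename (place 0 (p + q)) (tin (x ! q)))) (?st q))"
      unfolding exec.simps top e by (cases "x ! q") (simp_all add: bit_def)
    moreover have "append_output (conjunct (rename (place 0 (p + q)) (tin (x ! q)))) (?st q) =
        (append_output (?w (Suc q)) \<sigma>)(4 := bit (x ! q) # map bit (drop (Suc q) x), 9 :=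
            replicate (p + q) 1)"
      using d by (simp add: append_output_upd)
    ultimately have "?F (?st q) = Option.bind (Some ((append_output (?w (Suc q)) \<sigma>)
        (4 := bit (x ! q) # map bit (drop (Suc q) x), 9 := replicate (p + q) 1)))
        (exec S (Pop 4 ;; Push 9 (\<lambda>_. 1)))"
      by (simp only: exec.simps(4))
    also have "\<dots> = Some (?st (Suc q))"
      by (simp add: fun_upd_twist)
    finally show "tops (?st q) 4 \<noteq> 0 \<and> ?F (?st q) = Some (?st (Suc q))"
      unfolding top by (simp add: bit_def)
  qed (use assms in \<open>simp_all add: tops_def\<close>)
  moreover have "?st 0 = \<sigma>" using assms by (auto simp: fun_eq_iff append_output_def)
  ultimately show ?thesis by (simp add: input_row_def)
qed

text \<open>Cell \<open>N\<close> receives the origin constraint in addition to the constraint on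
  its symbol, so \<open>emit_conjunct t0\<close> does not advance the column.\<close>

definition first_row :: "ol_term \<Rightarrow> ol_term \<Rightarrow> (bool \<Rightarrow> ol_term) \<Rightarrow> prog" where
  "first_row tb t0 tin = sweep tb 5 6 ;; emit_conjunct t0 ;; input_row tin ;; sweep tb 6 5 ;; clear 9"

definition first_terms :: "ol_term \<Rightarrow> ol_term \<Rightarrow> (bool \<Rightarrow> ol_term) \<Rightarrow> nat \<Rightarrow> bool list \<Rightarrow> ol_term list" where
  "first_terms tb t0 tin N x =
    map (\<lambda>i. rename (place 0 i) tb) [0..<N] @ [rename (place 0 N) t0] @
    map (\<lambda>i. rename (place 0 (N + i)) (tin (x ! i))) [0..<length x] @
    map (\<lambda>i. rename (place 0 (N + length x + i)) tb) [0..<N]"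

lemma exec_first_row:
  assumes "\<sigma> 4 = map bit x" "\<sigma> 5 = replicate N 1" "\<sigma> 6 = []" "\<sigma> 8 = []" "\<sigma> 9 = []" "\<sigma> 10 = []"
    and "2 * N + length x \<le> S"
  shows "exec S (first_row tb t0 tin) \<sigma> =
    Some ((append_output (concat (map conjunct (first_terms tb t0 tin N x))) \<sigma>)(4 := []))"
proof -
  let ?w1 = "concat (map (\<lambda>q. conjunct (rename (place 0 (0 + q)) tb)) [0..<N])"
  let ?w2 = "conjunct (rename (place 0 N) t0)"
  let ?w3 = "concat (map (\<lambda>q. conjunct (rename (place 0 (N + q)) (tin (x ! q)))) [0..<length x])"
  let ?w4 = "concat (map (\<lambda>q. conjunct (rename (place 0 (N + length x + q)) tb)) [0..<N])"
  define \<sigma>1 where "\<sigma>1 = (append_output ?w1 \<sigma>)(5 := [], 6 := replicate N 1, 9 := replicate (0 + N) 1)"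
  have 1: "exec S (sweep tb 5 6) \<sigma> = Some \<sigma>1"
    unfolding \<sigma>1_def by (rule exec_sweep) (use assms in auto)
  define \<sigma>2 where "\<sigma>2 = append_output ?w2 \<sigma>1"
  have 2: "exec S (emit_conjunct t0) \<sigma>1 = Some \<sigma>2"
    unfolding \<sigma>2_def by (rule exec_emit_conjunct) (use assms in \<open>auto simp: \<sigma>1_def\<close>)
  define \<sigma>3 where "\<sigma>3 = (append_output ?w3 \<sigma>2)(4 := [], 9 := replicate (N + length x) 1)"
  have 3: "exec S (input_row tin) \<sigma>2 = Some \<sigma>3"
    unfolding \<sigma>3_def by (rule exec_input_row) (use assms in \<open>auto simp: \<sigma>1_def \<sigma>2_def\<close>)
  define \<sigma>4 where "\<sigma>4 = (append_output ?w4 \<sigma>3)(6 := [], 5 := replicate N 1, 9 :=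
      replicate (N + length x + N) 1)"
  have 4: "exec S (sweep tb 6 5) \<sigma>3 = Some \<sigma>4"
    unfolding \<sigma>4_def by (rule exec_sweep) (use assms in \<open>auto simp: \<sigma>1_def \<sigma>2_def \<sigma>3_def\<close>)
  have 5: "exec S (clear 9) \<sigma>4 = Some (\<sigma>4(9 := []))"
    by (rule exec_clear) (use assms in \<open>auto simp: \<sigma>4_def\<close>)
  have "concat (map conjunct (first_terms tb t0 tin N x)) = ?w1 @ ?w2 @ ?w3 @ ?w4"
    by (simp add: first_terms_def comp_def)
  moreover have "\<sigma>4(9 := []) = (append_output (?w1 @ ?w2 @ ?w3 @ ?w4) \<sigma>)(4 := [])"
    using assms(2-5) by (auto simp: \<sigma>1_def \<sigma>2_def \<sigma>3_def \<sigma>4_def append_output_def fun_eq_iff)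
  ultimately show ?thesis by (simp add: first_row_def 1 2 3 4 5)
qed

definition rows :: "ol_term \<Rightarrow> prog" where
  "rows tw = Loop (\<lambda>r. r 7 \<noteq> 0) (sweep tw 5 6 ;; sweep tw 6 5 ;; clear 9 ;; Pop 7 ;; Push 8 (\<lambda>_. 1))"

definition row_terms :: "ol_term \<Rightarrow> nat \<Rightarrow> nat \<Rightarrow> ol_term list" where
  "row_terms tw N s = map (\<lambda>i. rename (place s i) tw) [0..<2 * N]"

lemma exec_rows:
  assumes "\<sigma> 5 = replicate N 1" "\<sigma> 6 = []" "\<sigma> 7 = replicate N 1" "\<sigma> 8 = []" "\<sigma> 9 = []" "\<sigma> 10 = []"
    and "2 * N \<le> S"
  shows "exec S (rows tw) \<sigma> = Some ((append_output (concat (map (\<lambda>s. concat (map conjunct (row_terms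
      tw N s))) [0..<N])) \<sigma>)
    (7 := [], 8 := replicate N 1))"
proof -
  let ?r = "\<lambda>s. concat (map conjunct (row_terms tw N s))"
  let ?w = "\<lambda>m. concat (map ?r [0..<m])"
  let ?st = "\<lambda>s. (append_output (?w s) \<sigma>)(7 := replicate (N - s) 1, 8 := replicate s 1)"
  let ?F = "exec S (sweep tw 5 6 ;; sweep tw 6 5 ;; clear 9 ;; Pop 7 ;; Push 8 (\<lambda>_. 1))"
  have "iterate (\<lambda>r. r 7 \<noteq> 0) ?F S (?st 0) = Some (?st N)"
  proof (rule iterate_stages[where st = ?st])
    fix s
    assume s: "s < N"
    then have d: "replicate (N - s) (1::nat) = 1 # replicate (N - Suc s) 1"
      by (rule replicate_minus)
    let ?w1 = "concat (map (\<lambda>q. conjunct (rename (place s (0 + q)) tw)) [0..<N])"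
    let ?w2 = "concat (map (\<lambda>q. conjunct (rename (place s (N + q)) tw)) [0..<N])"
    define \<sigma>1 where "\<sigma>1 = (append_output ?w1 (?st s))(5 := [], 6 := replicate N 1, 9 :=
        replicate (0 + N) 1)"
    have 1: "exec S (sweep tw 5 6) (?st s) = Some \<sigma>1"
      unfolding \<sigma>1_def by (rule exec_sweep) (use assms s in auto)
    define \<sigma>2 where "\<sigma>2 = (append_output ?w2 \<sigma>1)(6 := [], 5 := replicate N 1, 9 := replicate (N + N) 1)"
    have 2: "exec S (sweep tw 6 5) \<sigma>1 = Some \<sigma>2"
      unfolding \<sigma>2_def by (rule exec_sweep) (use assms s in \<open>auto simp: \<sigma>1_def\<close>)
    have 3: "exec S (clear 9) \<sigma>2 = Some (\<sigma>2(9 := []))"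
      by (rule exec_clear) (use assms in \<open>auto simp: \<sigma>2_def\<close>)
    have "map (\<lambda>q. N + q) [0..<N] = [N..<2 * N]"
      using map_add_upt[of N N] by (simp add: mult_2 add.commute)
    then have "?w2 = concat (map (\<lambda>i. conjunct (rename (place s i) tw)) [N..<2 * N])"
      by (metis (mono_tags, lifting) comp_apply map_eq_conv map_map)
    moreover have "[0..<2 * N] = [0..<N] @ [N..<2 * N]"
      using upt_add_eq_append[of 0 N N] by (simp add: mult_2)
    ultimately have "?r s = ?w1 @ ?w2" by (simp add: row_terms_def comp_def)
    then have "?w (Suc s) = ?w s @ ?w1 @ ?w2" by simp
    then have 4: "\<sigma>2(9 := []) = (append_output (?w (Suc s)) \<sigma>)(7 := 1 # replicate (N - Suc s) 1,
        8 := replicate s 1)"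
      using assms(1-5) d by (simp only:) (auto simp: \<sigma>1_def \<sigma>2_def append_output_def fun_eq_iff)
    have "?F (?st s) = exec S (Pop 7 ;; Push 8 (\<lambda>_. 1)) (\<sigma>2(9 := []))"
      unfolding exec.simps(4) 1 2 3 bind.bind_lunit ..
    also have "\<dots> = Some (?st (Suc s))"
      unfolding 4 by (simp add: fun_upd_twist)
    finally have "?F (?st s) = Some (?st (Suc s))" .
    moreover have "tops (?st s) 7 \<noteq> 0" using d by (simp add: tops_def)
    ultimately show "tops (?st s) 7 \<noteq> 0 \<and> ?F (?st s) = Some (?st (Suc s))" by blast
  qed (use assms in \<open>simp_all add: tops_def\<close>)
  moreover have "?st 0 = \<sigma>" using assms by (auto simp: fun_eq_iff append_output_def)
  ultimately show ?thesis by (simp add: rows_def)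
qed

definition tableau_prog ::
    "nat \<Rightarrow> nat \<Rightarrow> ol_term \<Rightarrow> ol_term \<Rightarrow> (bool \<Rightarrow> ol_term) \<Rightarrow> ol_term \<Rightarrow> prog" where
  "tableau_prog c d tb t0 tin tw =
    sizes c d ;; move 1 4 ;; first_row tb t0 tin ;; rows tw ;; emit (encode One)"

definition tableau_term ::
    "ol_term \<Rightarrow> ol_term \<Rightarrow> (bool \<Rightarrow> ol_term) \<Rightarrow> ol_term \<Rightarrow> nat \<Rightarrow> bool list \<Rightarrow> ol_term" where
  "tableau_term tb t0 tin tw N x =
    conj_term (first_terms tb t0 tin N x @ concat (map (row_terms tw N) [0..<N]))"

lemma exec_tableau_prog:
  assumes "1 \<le> c" "2 * (length x + c) ^ d + 2 * length x + c \<le> S"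
  shows "\<exists>\<tau>. exec S (tableau_prog c d tb t0 tin tw) (start x (replicate (length x) 1)) = Some \<tau> \<and>
    \<tau> 11 = rev (map bit (encode (tableau_term tb t0 tin tw ((length x + c) ^ d) x)))"
proof -
  let ?n = "length x" and ?N = "(length x + c) ^ d"
  define \<sigma> where "\<sigma> = start x (replicate ?n 1)"
  define \<sigma>1 where "\<sigma>1 = \<sigma>(2 := replicate (?n + c) 1, 5 := replicate ?N 1, 7 := replicate ?N 1)"
  have 1: "exec S (sizes c d) \<sigma> = Some \<sigma>1"
    unfolding \<sigma>1_def by (rule exec_sizes) (use assms in \<open>auto simp: \<sigma>_def start_def loaded_def\<close>)
  define \<sigma>2 where "\<sigma>2 = \<sigma>1(1 := [], 4 := rev (\<sigma>1 1) @ \<sigma>1 4)"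
  have 2: "exec S (move 1 4) \<sigma>1 = Some \<sigma>2"
    unfolding \<sigma>2_def by (rule exec_move)
      (use assms in \<open>auto simp: \<sigma>1_def \<sigma>_def start_def loaded_def bit_def\<close>)
  let ?w1 = "concat (map conjunct (first_terms tb t0 tin ?N x))"
  define \<sigma>3 where "\<sigma>3 = (append_output ?w1 \<sigma>2)(4 := [])"
  have 3: "exec S (first_row tb t0 tin) \<sigma>2 = Some \<sigma>3"
    unfolding \<sigma>3_def by (rule exec_first_row)
      (use assms in \<open>auto simp: \<sigma>2_def \<sigma>1_def \<sigma>_def start_def loaded_def\<close>)
  let ?w2 = "concat (map (\<lambda>s. concat (map conjunct (row_terms tw ?N s))) [0..<?N])"
  define \<sigma>4 where "\<sigma>4 = (append_output ?w2 \<sigma>3)(7 := [], 8 := replicate ?N 1)"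
  have 4: "exec S (rows tw) \<sigma>3 = Some \<sigma>4"
    unfolding \<sigma>4_def by (rule exec_rows)
      (use assms in \<open>auto simp: \<sigma>3_def \<sigma>2_def \<sigma>1_def \<sigma>_def start_def loaded_def\<close>)
  have "exec S (tableau_prog c d tb t0 tin tw) \<sigma> = Some (append_output (encode One) \<sigma>4)"
    unfolding tableau_prog_def exec.simps(4) 1 2 3 4 bind.bind_lunit exec_emit ..
  moreover have "append_output (encode One) \<sigma>4 11 = rev (map bit (?w1 @ ?w2 @ encode One))"
    by (simp add: append_output_def \<sigma>4_def \<sigma>3_def \<sigma>2_def \<sigma>1_def \<sigma>_def start_def loaded_def)
  moreover have "concat (map conjunct (concat tss)) =
      concat (map (\<lambda>ts. concat (map conjunct ts)) tss)" for tss
    by (induction tss) auto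
  then have "encode (tableau_term tb t0 tin tw ?N x) = ?w1 @ ?w2 @ encode One"
    by (simp add: tableau_term_def encode_conj_term comp_def)
  ultimately show ?thesis unfolding \<sigma>_def by auto
qed

lemma wf_move: "i < k \<Longrightarrow> j < k \<Longrightarrow> wf k K (move i j)"
  by (simp add: move_def)

lemma wf_clear: "i < k \<Longrightarrow> wf k K (clear i)"
  by (simp add: clear_def)

lemma wf_emit: "11 < k \<Longrightarrow> 3 \<le> K \<Longrightarrow> wf k K (emit bs)"
  by (induction bs) (auto simp: bit_def emit.simps)

lemma wf_emit_unary: "11 < k \<Longrightarrow> 3 \<le> K \<Longrightarrow> i < k \<Longrightarrow> wf k K (emit_unary i)"
  by (simp add: emit_unary_def wf_emit wf_move)

lemma wf_emit_term: "11 < k \<Longrightarrow> 3 \<le> K \<Longrightarrow> wf k K (emit_term t)"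
  by (induction t) (auto simp: emit_var_def wf_emit wf_emit_unary split: prod.split)

lemma wf_emit_conjunct: "11 < k \<Longrightarrow> 3 \<le> K \<Longrightarrow> wf k K (emit_conjunct t)"
  by (simp add: emit_conjunct_def wf_emit wf_emit_term)

lemma wf_sweep: "11 < k \<Longrightarrow> 3 \<le> K \<Longrightarrow> i < k \<Longrightarrow> j < k \<Longrightarrow> wf k K (sweep t i j)"
  by (simp add: sweep_def wf_emit_conjunct)

lemma wf_sizes: "11 < k \<Longrightarrow> 3 \<le> K \<Longrightarrow> wf k K (sizes c d)"
proof -
  assume k: "11 < k" "3 \<le> K"
  have "wf k K (push_ones 2 c)" using k by (induction c) auto
  moreover have copy: "wf k K (copy i j)" if "i < 10" "j < 10" for i j
    using k that by (simp add: copy_def wf_move)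
  moreover have "wf k K multiply" using k copy by (simp add: multiply_def wf_move)
  then have "wf k K (power_prog d)" by (induction d) auto
  ultimately show ?thesis using k by (simp add: sizes_def)
qed

lemma wf_tableau_prog: "11 < k \<Longrightarrow> 3 \<le> K \<Longrightarrow> wf k K (tableau_prog c d tb t0 tin tw)"
  by (simp add: tableau_prog_def wf_sizes wf_move first_row_def input_row_def rows_def wf_sweep
      wf_emit_conjunct wf_clear wf_emit del: emit.simps)

section \<open>Correctness of the reduction\<close>

type_synonym constraint = "(nat \<times> nat) \<times> (nat \<times> nat) list \<times> (nat list \<Rightarrow> bool)"

text \<open>Listed in the order in which the program prints the conjuncts, so that the printed term
  is literally the conjunction of these constraints.\<close>

definition constraints :: "machine \<Rightarrow> (nat \<Rightarrow> tile) \<Rightarrow> nat \<Rightarrow> bool list \<Rightarrow> constraint list" where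
  "constraints M h N x =
    map (\<lambda>i. ((0, i), [(0, 0)], \<lambda>es. blank_tile M (h (es ! 0)))) [0..<N] @
    [((0, N), [(0, 0)], \<lambda>es. origin_tile (h (es ! 0)))] @
    map (\<lambda>i. ((0, N + i), [(0, 0)], \<lambda>es. input_tile M (x ! i) (h (es ! 0)))) [0..<length x] @
    map (\<lambda>i. ((0, N + length x + i), [(0, 0)], \<lambda>es. blank_tile M (h (es ! 0)))) [0..<N] @
    concat (map (\<lambda>s. map (\<lambda>i. ((s, i), [(0, 0), (0, 1), (0, 2), (1, 1)],
      \<lambda>es. window M (h (es ! 0)) (h (es ! 1)) (h (es ! 2)) (h (es ! 3)))) [0..<2 * N]) [0..<N])"

lemma constraints_iff:
  "(\<forall>((s, i), ds, W) \<in> set (constraints M h N x). W (map (\<lambda>(a, b). g (s + a) (i + b)) ds)) \<longleftrightarrow>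
    tableau M (\<lambda>s i. h (g s i)) x N"
proof -
  have upt: "(\<forall>i \<in> {0..<n}. P i) \<longleftrightarrow> (\<forall>i < n. P i)" for n :: nat and P by auto
  show ?thesis
    by (simp add: constraints_def tableau_def ball_Un upt numeral_2_eq_2 numeral_3_eq_3 conj_ac)
qed

definition machine_term :: "machine \<Rightarrow> nat \<Rightarrow> (nat \<Rightarrow> tile) \<Rightarrow> nat \<Rightarrow> bool list \<Rightarrow> ol_term" where
  "machine_term M E h = tableau_term
    (template E [(0, 0)] (\<lambda>es. blank_tile M (h (es ! 0))))
    (template E [(0, 0)] (\<lambda>es. origin_tile (h (es ! 0))))
    (\<lambda>b. template E [(0, 0)] (\<lambda>es. input_tile M b (h (es ! 0))))
    (template E [(0, 0), (0, 1), (0, 2), (1, 1)]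
      (\<lambda>es. window M (h (es ! 0)) (h (es ! 1)) (h (es ! 2)) (h (es ! 3))))"

lemma machine_term_eq: "machine_term M E h N x =
    conj_term (map (\<lambda>((s, i), ds, W). rename (place s i) (template E ds W)) (constraints M h N x))"
  by (simp add: machine_term_def tableau_term_def first_terms_def row_terms_def[abs_def] constraints_def
      map_concat comp_def)

lemma (in tableau_machine) machine_term_complete:
  assumes h: "bij_betw h {0..<E} tiles" and run: "(step M ^^ Suc N) (initial M x) c"
  shows "\<exists>a::nat \<Rightarrow> 'a::orthocomplemented_lattice. ol_eval a (machine_term M E h N x) = top"
proof -
  obtain t where t: "tableau M t x N" "\<And>s i. t s i \<in> tiles"
    using run_tableau[OF run] by blast
  define g where "g s i = inv_into {0..<E} h (t s i)" for s i
  have hg: "h (g s i) = t s i" for s i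
    using t(2) h by (simp add: g_def bij_betw_inv_into_right)
  have gE: "g s i < E" for s i
    using bij_betwE[OF bij_betw_inv_into[OF h]] t(2)[of s i] by (simp add: g_def)
  have "\<forall>((s, i), ds, W) \<in> set (constraints M h N x). W (map (\<lambda>(a, b). g (s + a) (i + b)) ds)"
    unfolding constraints_iff hg by (rule t(1))
  then show ?thesis
    unfolding machine_term_eq by (intro template_complete[where g = g]) (use gE in auto)
qed

lemma (in tableau_machine) machine_term_sound:
  assumes L: "height_two TYPE('a::modular_ortholattice)"
    and a: "ol_eval (a::nat \<Rightarrow> 'a) (machine_term M E h N x) \<noteq> bot"
  shows "\<exists>c. (step M ^^ N) (initial M x) c"
proof -
  interpret height_two "TYPE('a)" by (rule L)
  obtain g where "\<forall>((s, i), ds, W) \<in> set (constraints M h N x).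
      W (map (\<lambda>(a, b). g (s + a) (i + b)) ds) \<and> (\<forall>(a, b) \<in> set ds. g (s + a) (i + b) < E)"
    using template_sound[OF a[unfolded machine_term_eq]] by blast
  then have "\<forall>((s, i), ds, W) \<in> set (constraints M h N x). W (map (\<lambda>(a, b). g (s + a) (i + b)) ds)"
    by fast
  then show ?thesis unfolding constraints_iff by (rule tableau_run)
qed

text \<open>The program has to compute the size of the tableau, and a power is repeated
  multiplication. Strictness makes a run of that length exceed the time bound, so that it must
  contain an idle step.\<close>

lemma poly_less_power: "\<exists>c d. 1 \<le> c \<and> (\<forall>n. poly (p::nat poly) n < (n + c) ^ d)"
proof (induction p)
  case 0
  show ?case by (intro exI[of _ 1] exI[of _ 0]) simp
next
  case (pCons a p)
  then obtain c d where cd: "1 \<le> c" "\<And>n. poly p n < (n + c) ^ d" by blast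
  have "a + n * poly p n < (n + (c + a + 1)) ^ Suc d" for n
  proof -
    define X where "X = (n + (c + a + 1)) ^ d"
    have "poly p n \<le> X"
      using cd(2)[of n] power_mono[of "n + c" "n + (c + a + 1)" d] by (simp add: X_def)
    then have 1: "n * poly p n \<le> n * X" by (rule mult_le_mono2)
    have "1 \<le> X" by (simp add: X_def)
    then have 2: "(c + a + 1) * 1 \<le> (c + a + 1) * X" by (rule mult_le_mono2)
    have "a + n * poly p n < (c + a + 1) * 1 + n * poly p n" by simp
    also have "\<dots> \<le> (c + a + 1) * X + n * X" using 2 1 by (rule add_mono)
    also have "\<dots> = (n + (c + a + 1)) ^ Suc d" by (simp add: X_def algebra_simps)
    finally show ?thesis .
  qed
  then show ?case by (intro exI[of _ "c + a + 1"] exI[of _ "Suc d"]) simp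
qed

lemma NP_hard:
  assumes L: "height_two TYPE('a::modular_ortholattice)" and A: "A \<in> NP"
  shows "polynomial_reducible A (strong_SAT TYPE('a)) \<and> polynomial_reducible A (weak_SAT TYPE('a))"
proof -
  obtain M p where M: "turing_machine M" "\<And>x. x \<in> A \<longleftrightarrow> accepts M x"
    and p: "\<And>x n c. (step M ^^ n) (initial M x) c \<Longrightarrow> n \<le> poly p (length x)"
    using A unfolding NP_def polynomial_time_def by blast
  obtain c d where cd: "1 \<le> c" "\<And>n. poly p n < (n + c) ^ d" using poly_less_power by blast
  interpret tableau_machine "idling M" "tape_symbols M"
    by (rule tableau_machine_idling[OF M(1)])
  obtain h where h: "bij_betw h {0..<card tiles} tiles"
    using ex_bij_betw_nat_finite[OF finite_tiles] by blast
  define F where "F x = machine_term (idling M) (card tiles) h ((length x + c) ^ d) x" for x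
  have complete: "\<exists>a::nat \<Rightarrow> 'a. ol_eval a (F x) = top" if "x \<in> A" for x
  proof -
    have "poly p (length x) \<le> Suc ((length x + c) ^ d)" using cd(2)[of "length x"] by simp
    with M(1) p that[unfolded M(2)]
    have "\<exists>c'. (step (idling M) ^^ Suc ((length x + c) ^ d)) (initial M x) c'"
      by (rule accepting_run[where m = "poly p (length x)"])
    then obtain c' where "(step (idling M) ^^ Suc ((length x + c) ^ d)) (initial (idling M) x) c'"
      unfolding initial_idling by blast
    then show ?thesis unfolding F_def by (rule machine_term_complete[OF h])
  qed
  have sound: "x \<in> A" if a: "ol_eval (a::nat \<Rightarrow> 'a) (F x) \<noteq> bot" for x a
  proof -
    obtain c' where "(step (idling M) ^^ ((length x + c) ^ d)) (initial M x) c'"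
      using machine_term_sound[OF L a[unfolded F_def]] by auto
    with M(1) p have "accepts M x"
      by (rule run_accepting[where m = "poly p (length x)"]) (assumption, rule cd(2))
    then show ?thesis unfolding M(2) .
  qed
  have "(bot::'a) \<noteq> top" using height_two.bot_neq_top[OF L] .
  then have strong: "x \<in> A \<longleftrightarrow> encode (F x) \<in> strong_SAT TYPE('a)" for x
    using complete[of x] sound[of _ x] inj_encode unfolding strong_SAT_def
    by (auto dest!: injD[OF inj_encode]) metis
  have weak: "x \<in> A \<longleftrightarrow> encode (F x) \<in> weak_SAT TYPE('a)" for x
    using complete[of x] sound[of _ x] \<open>(bot::'a) \<noteq> top\<close> unfolding weak_SAT_def
    by (auto dest!: injD[OF inj_encode]) metis
  obtain tb t0 tin tw where F: "\<And>x. F x = tableau_term tb t0 tin tw ((length x + c) ^ d) x"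
    unfolding F_def machine_term_def by blast
  let ?P = "tableau_prog c d tb t0 tin tw" and ?S = "smult 2 ([:c, 1:] ^ d) + [:c, 2:]"
  have S: "2 * (length x + c) ^ d + 2 * length x + c \<le> poly ?S (length x)" for x :: "bool list"
    by (simp add: poly_power add.commute)
  \<comment> \<open>Twelve stacks make \<open>11\<close> the output tape, and the three symbols are
    the blank and the two bits. With the condition \<open>\<lambda>_. False\<close> the machine
    halts as soon as the program ends.\<close>
  interpret R: guess_and_run 12 3 1 ?P "\<lambda>_. False" ?S
  proof
    fix cs :: "nat list" and x :: "bool list"
    assume cs: "length cs = length x" "set cs \<subseteq> {1..1}"
    then have "cs = replicate (length x) 1" by (intro replicate_eqI) auto
    then show "\<exists>\<tau>. exec (poly ?S (length x)) ?P (start x cs) = Some \<tau>"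
      using exec_tableau_prog[OF cd(1) S] by blast
  qed (simp_all add: wf_tableau_prog)
  have "R.result x (replicate (length x) 1) (12 - 1) = rev (map bit (encode (F x)))" for x
    using exec_tableau_prog[OF cd(1) S[of x], of tb t0 tin tw] unfolding R.result_def F by auto
  then have "computes R.M (\<lambda>x. encode (F x))" by (rule R.computes)
  moreover have "turing_machine R.M" "deterministic R.M" "polynomial_time R.M"
    using R.turing_machine R.deterministic R.polynomial_time by simp_all
  ultimately show ?thesis
    using strong weak unfolding polynomial_reducible_def by blast
qed

section \<open>Membership in NP\<close>

subsection \<open>Symbolic evaluation\<close>

text \<open>
  The elements of a modular ortholattice of height two are represented by a sign and a label: label \<open>0\<close>
  stands for \<open>bot\<close> and \<open>top\<close>, any other label \<open>l\<close> for the two elements \<open>q l\<close> and \<open>- q l\<close>.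
\<close>

type_synonym val = "bool \<times> nat"

definition vneg :: "val \<Rightarrow> val" where
  "vneg x = (\<not> fst x, snd x)"

definition vmeet :: "val \<Rightarrow> val \<Rightarrow> val" where
  "vmeet x y = (if x = (True, 0) then y else if y = (True, 0) then x else if x =
      y then x else (False, 0))"

definition vjoin :: "val \<Rightarrow> val \<Rightarrow> val" where
  "vjoin x y = vneg (vmeet (vneg x) (vneg y))"

primrec veval :: "(nat \<Rightarrow> val) \<Rightarrow> ol_term \<Rightarrow> val" where
  "veval \<alpha> (Var i) = \<alpha> i"
| "veval \<alpha> Zero = (False, 0)"
| "veval \<alpha> One = (True, 0)"
| "veval \<alpha> (Neg t) = vneg (veval \<alpha> t)"
| "veval \<alpha> (Meet s t) = vmeet (veval \<alpha> s) (veval \<alpha> t)"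
| "veval \<alpha> (Join s t) = vjoin (veval \<alpha> s) (veval \<alpha> t)"

primrec vars :: "ol_term \<Rightarrow> nat set" where
  "vars (Var i) = {i}"
| "vars Zero = {}"
| "vars One = {}"
| "vars (Neg t) = vars t"
| "vars (Meet s t) = vars s \<union> vars t"
| "vars (Join s t) = vars s \<union> vars t"

definition interp :: "(nat \<Rightarrow> 'a) \<Rightarrow> val \<Rightarrow> 'a::orthocomplemented_lattice" where
  "interp q x = (let y = (if snd x = 0 then top else q (snd x)) in if fst x then y else - y)"

definition independent :: "(nat \<Rightarrow> 'a::orthocomplemented_lattice) \<Rightarrow> nat \<Rightarrow> bool" where
  "independent q m \<longleftrightarrow> (\<forall>l \<in> {1..m}. q l \<noteq> bot \<and> q l \<noteq> top \<and>
    (\<forall>l' \<in> {1..m}. l \<noteq> l' \<longrightarrow> q l \<noteq> q l' \<and> q l \<noteq> - q l'))"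

lemma snd_vneg [simp]: "snd (vneg x) = snd x"
  by (simp add: vneg_def)

lemma interp_vneg: "interp q (vneg x) = - interp q x"
  by (simp add: interp_def vneg_def Let_def)

context height_two
begin

text \<open>Distinct labels stand for distinct blocks, and by \<open>compl_neq\<close> the two signs
  of one label differ. Injectivity turns the equality tests of \<open>inf_eq\<close> into the tests
  on codes made by \<open>vmeet\<close>.\<close>

lemma interp_inject:
  assumes "independent (q::nat \<Rightarrow> 'a) m" "snd x \<le> m" "snd y \<le> m" "interp q x = interp q y"
  shows "x = y"
proof -
  define e where "e l = (if l = 0 then top else q l)" for l
  have e: "e l \<noteq> e l' \<and> e l \<noteq> - e l'" if "l \<noteq> l'" "l \<le> m" "l' \<le> m" for l l'
  proof -
    have top: "q l \<noteq> top \<and> top \<noteq> - q l" if "1 \<le> l" "l \<le> m" for l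
      using assms(1) that compl_eq_swap[of "q l" top] unfolding independent_def
      by (metis atLeastAtMost_iff orthocomplemented_lattice_class.compl_top_eq)
    show ?thesis
    proof (cases "l = 0 \<or> l' = 0")
      case True
      then show ?thesis using top[of l] top[of l'] that compl_eq_swap[of top "q l"]
        by (auto simp: e_def)
    next
      case False
      then show ?thesis using assms(1) that unfolding independent_def e_def by simp
    qed
  qed
  have eq: "interp q z = (if fst z then e (snd z) else - e (snd z))" for z
    by (simp add: interp_def e_def)
  have snd: "snd x = snd y"
  proof (rule ccontr)
    assume "snd x \<noteq> snd y"
    with e[of "snd x" "snd y"] assms(2-4) compl_eq_swap[of "e (snd x)" "e (snd y)"]
    show False unfolding eq by (auto split: if_splits)
  qed
  have "fst x = fst y"
    using assms(4) compl_neq[of "e (snd y)"] unfolding eq snd by (auto split: if_splits)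
  with snd show ?thesis by (simp add: prod_eq_iff)
qed

lemma interp_vmeet:
  assumes "independent (q::nat \<Rightarrow> 'a) m" "snd x \<le> m" "snd y \<le> m"
  shows "interp q (vmeet x y) = inf (interp q x) (interp q y)"
proof -
  have top: "interp q z = top \<longleftrightarrow> z = (True, 0)" if "snd z \<le> m" for z
    using interp_inject[OF assms(1) that, of "(True, 0)"] by (auto simp: interp_def)
  have eq: "interp q x = interp q y \<longleftrightarrow> x = y"
    using interp_inject[OF assms] by blast
  show ?thesis
    unfolding inf_eq top[OF assms(2)] top[OF assms(3)] eq vmeet_def
    by (simp add: interp_def)
qed

lemma interp_veval:
  assumes q: "independent (q::nat \<Rightarrow> 'a) m"
    and "\<And>i. i \<in> vars t \<Longrightarrow> snd (\<alpha> i) \<le> m \<and> interp q (\<alpha> i) = a i"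
  shows "snd (veval \<alpha> t) \<le> m \<and> interp q (veval \<alpha> t) = ol_eval a t"
  using assms(2)
proof (induction t)
  case (Meet s t)
  then have st: "snd (veval \<alpha> s) \<le> m \<and> interp q (veval \<alpha> s) = ol_eval a s"
    "snd (veval \<alpha> t) \<le> m \<and> interp q (veval \<alpha> t) = ol_eval a t" by auto
  then have "snd (vmeet (veval \<alpha> s) (veval \<alpha> t)) \<le> m" by (simp add: vmeet_def)
  with st show ?case by (simp add: interp_vmeet[OF q])
next
  case (Join s t)
  then have st: "snd (veval \<alpha> s) \<le> m \<and> interp q (veval \<alpha> s) = ol_eval a s"
    "snd (veval \<alpha> t) \<le> m \<and> interp q (veval \<alpha> t) = ol_eval a t" by auto
  then have "snd (vjoin (veval \<alpha> s) (veval \<alpha> t)) \<le> m" by (simp add: vjoin_def vmeet_def vneg_def)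
  with st show ?case by (simp add: vjoin_def interp_vneg interp_vmeet[OF q])
next
  case (Neg t)
  then show ?case by (simp add: interp_vneg)
qed (auto simp: interp_def)

lemma independent_Suc:
  assumes q: "independent (q::nat \<Rightarrow> 'a) m" and x: "x \<noteq> bot" "x \<noteq> top"
    and new: "\<And>l. l \<in> {1..m} \<Longrightarrow> x \<noteq> q l \<and> x \<noteq> - q l"
  shows "independent (q(Suc m := x)) (Suc m)"
  unfolding independent_def
proof (intro ballI conjI impI)
  fix l assume l: "l \<in> {1..Suc m}"
  have old: "q l \<noteq> bot \<and> q l \<noteq> top \<and> (\<forall>l' \<in> {1..m}. l \<noteq> l' \<longrightarrow> q l \<noteq> q l' \<and> q l \<noteq> - q l')"
    if "l \<in> {1..m}" for l
    using q that unfolding independent_def by blast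
  show "(q(Suc m := x)) l \<noteq> bot" "(q(Suc m := x)) l \<noteq> top"
    using l x old[of l] by auto
  fix l' assume l': "l' \<in> {1..Suc m}" "l \<noteq> l'"
  consider "l = Suc m" "l' \<in> {1..m}" | "l' = Suc m" "l \<in> {1..m}" | "l \<in> {1..m}" "l' \<in> {1..m}"
    using l l' by fastforce
  then have "(q(Suc m := x)) l \<noteq> (q(Suc m := x)) l' \<and> (q(Suc m := x)) l \<noteq> - (q(Suc m := x)) l'"
  proof cases
    case 1
    then show ?thesis using new[of l'] by simp
  next
    case 2
    then show ?thesis using new[of l] compl_eq_swap[of x "q l"] by auto
  next
    case 3
    then show ?thesis using old[of l] l'(2) by simp
  qed
  then show "(q(Suc m := x)) l \<noteq> (q(Suc m := x)) l'" "(q(Suc m := x)) l \<noteq> - (q(Suc m := x)) l'"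
    by blast+
qed

text \<open>A value not yet denoted by a code becomes the representative of a new block. This yields
  at most one label per variable, which later bounds the certificate.\<close>

lemma representatives:
  assumes "finite (V::nat set)"
  shows "\<exists>q m \<alpha>. independent (q::nat \<Rightarrow> 'a) m \<and> m \<le> card V \<and>
    (\<forall>i \<in> V. snd (\<alpha> i) \<le> m \<and> interp q (\<alpha> i) = a i)"
  using assms
proof (induction V rule: finite_induct)
  case empty
  show ?case by (intro exI[of _ undefined] exI[of _ 0]) (simp add: independent_def)
next
  case (insert j V)
  then obtain q m \<alpha> where q: "independent (q::nat \<Rightarrow> 'a) m" "m \<le> card V"
    and \<alpha>: "\<And>i. i \<in> V \<Longrightarrow> snd (\<alpha> i) \<le> m \<and> interp q (\<alpha> i) = a i" by blast
  show ?case
  proof (cases "\<exists>x. snd x \<le> m \<and> interp q x = a j")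
    case True
    then obtain x where "snd x \<le> m \<and> interp q x = a j" by blast
    then show ?thesis using q \<alpha> insert.hyps
      by (intro exI[of _ q] exI[of _ m] exI[of _ "\<alpha>(j := x)"]) auto
  next
    case False
    define q' where "q' = q(Suc m := a j)"
    have new: "a j \<noteq> interp q (b, l)" if "l \<le> m" for b l
      using False that by (metis snd_conv)
    have "a j \<noteq> bot" "a j \<noteq> top"
      using new[of 0 False] new[of 0 True] by (simp_all add: interp_def)
    moreover have "a j \<noteq> q l \<and> a j \<noteq> - q l" if "l \<in> {1..m}" for l
      using new[of l True] new[of l False] that by (simp add: interp_def)
    ultimately have ind: "independent q' (Suc m)"
      unfolding q'_def by (rule independent_Suc[OF q(1)])
    have "interp q' x = interp q x" if "snd x \<le> m" for x
      using that by (simp add: interp_def q'_def)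
    then have "snd ((\<alpha>(j := (True, Suc m))) i) \<le> Suc m \<and> interp q' ((\<alpha>(j := (True, Suc m))) i) = a i"
      if "i \<in> insert j V" for i
      using that \<alpha>[of i] by (cases "i = j") (auto simp: interp_def q'_def)
    then show ?thesis using ind q(2) insert.hyps
      by (intro exI[of _ q'] exI[of _ "Suc m"] exI[of _ "\<alpha>(j := (True, Suc m))"]) simp
  qed
qed

end


subsection \<open>Parsing from right to left\<close>

text \<open>Read backwards, prefix notation has the operands of an operation already evaluated on
  the stack, the left one on top. \<open>nm\<close> collects digits until the letter
  \<open>x\<close> arrives; any other non-digit letter rejects pending digits, and \<open>x\<close>
  rejects a name that does not begin with 1.\<close>

fun parse_letter :: "(bool list \<Rightarrow> val) \<Rightarrow> bool \<Rightarrow> bool \<Rightarrow> bool \<Rightarrow> bool list \<times> val list \<Rightarrow>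
    (bool list \<times> val list) option" where
  "parse_letter look True True b (nm, vs) = Some (b # nm, vs)"
| "parse_letter look True False True (nm, vs) =
    (if \<exists>bs. nm = True # bs then Some ([], look nm # vs) else None)"
| "parse_letter look False False b (nm, vs) = (if nm = [] then Some ([], (b, 0) # vs) else None)"
| "parse_letter look False True False (nm, x # vs) = (if nm = [] then Some ([], vneg x # vs) else None)"
| "parse_letter look False True True (nm, x # y # vs) = (if nm = [] then Some ([],
    vmeet x y # vs) else None)"
| "parse_letter look True False False (nm, x # y # vs) = (if nm = [] then Some ([],
    vjoin x y # vs) else None)"
| "parse_letter look _ _ _ _ = None"

fun parse :: "(bool list \<Rightarrow> val) \<Rightarrow> bool list \<Rightarrow> bool list \<times> val list \<Rightarrow> (bool list \<times> val list) option" where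
  "parse look [] st = Some st"
| "parse look (b3 # b2 # b1 # r) st = Option.bind (parse_letter look b1 b2 b3 st) (parse look r)"
| "parse look _ st = None"

lemma parse_digits: "parse look (rev (digits bs) @ r) (nm, vs) = parse look r (bs @ nm, vs)"
  by (induction bs arbitrary: r nm) (auto simp: digits_def)

lemma encode_Var: "encode (Var i) = [True, False, True] @ digits (binary (Suc i))"
  by (simp add: digits_def)

lemma binary_Suc: "\<exists>bs. binary (Suc i) = True # bs"
proof (induction i rule: less_induct)
  case (less i)
  show ?case
  proof (cases "Suc i \<le> 1")
    case True
    then show ?thesis by (simp add: binary_small)
  next
    case False
    then have "Suc i div 2 = Suc (Suc i div 2 - 1)" "Suc i div 2 - 1 < i" by auto
    then show ?thesis using less[of "Suc i div 2 - 1"] False by (auto simp: binary_large)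
  qed
qed

lemma parse_encode:
  "parse look (rev (encode t) @ r) ([], vs) = parse look r ([], veval (\<lambda>i. look (binary (Suc i))) t # vs)"
proof (induction t arbitrary: r vs)
  case (Var i)
  then show ?case using binary_Suc[of i]
    unfolding encode_Var rev_append append_assoc parse_digits by auto
qed auto

lemma binary_iff: "(\<exists>i. nm = binary (Suc i)) \<longleftrightarrow> (\<exists>bs. nm = True # bs)"
proof
  assume "\<exists>bs. nm = True # bs"
  then obtain bs where nm: "nm = True # bs" by blast
  have "binary (number bs) = True # bs" by (rule binary_number)
  with number_neq_0[OF this] nm show "\<exists>i. nm = binary (Suc i)" by (metis not0_implies_Suc)
qed (use binary_Suc in auto)

text \<open>The values are the image of a stack of terms. Pending digits followed by the codes of
  these terms spell the part of the word already read, and every letter preserves this.\<close>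

lemma parse_letter_sound:
  assumes "parse_letter look b1 b2 b3 (nm, map E ts) = Some (nm', vs')"
    and E: "E = veval (\<lambda>i. look (binary (Suc i)))"
  shows "\<exists>ts'. vs' = map E ts' \<and>
    [b1, b2, b3] @ digits nm @ concat (map encode ts) = digits nm' @ concat (map encode ts')"
proof -
  consider "b1" "b2" | "b1" "\<not> b2" "b3" | "b1" "\<not> b2" "\<not> b3" | "\<not> b1" "\<not> b2"
    | "\<not> b1" "b2" "\<not> b3" | "\<not> b1" "b2" "b3" by blast
  then show ?thesis
  proof cases
    case 1
    with assms(1) show ?thesis by (intro exI[of _ ts]) (auto simp: digits_def)
  next
    case 2
    with assms(1) obtain bs where nm: "nm = True # bs" "nm' = []" "vs' = look nm # map E ts"
      by (auto split: if_splits)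
    then obtain i where i: "nm = binary (Suc i)" using binary_iff by blast
    show ?thesis using 2 nm(2,3) unfolding i
      by (intro exI[of _ "Var i # ts"]) (simp add: E digits_def)
  next
    case 3
    with assms(1) obtain t u ts' where "ts = t # u # ts'" "nm = []" "nm' = []"
      "vs' = vjoin (E t) (E u) # map E ts'"
      by (cases ts; cases "tl ts") (auto split: if_splits)
    with 3 show ?thesis by (intro exI[of _ "Join t u # ts'"]) (simp add: E digits_def)
  next
    case 4
    with assms(1) have "nm = []" "nm' = []" "vs' = (b3, 0) # map E ts" by (auto split: if_splits)
    with 4 show ?thesis by (intro exI[of _ "(if b3 then One else Zero) # ts"]) (simp add: E digits_def)
  next
    case 5
    with assms(1) obtain t ts' where "ts = t # ts'" "nm = []" "nm' = []" "vs' = vneg (E t) # map E ts'"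
      by (cases ts) (auto split: if_splits)
    with 5 show ?thesis by (intro exI[of _ "Neg t # ts'"]) (simp add: E digits_def)
  next
    case 6
    with assms(1) obtain t u ts' where "ts = t # u # ts'" "nm = []" "nm' = []"
      "vs' = vmeet (E t) (E u) # map E ts'"
      by (cases ts; cases "tl ts") (auto split: if_splits)
    with 6 show ?thesis by (intro exI[of _ "Meet t u # ts'"]) (simp add: E digits_def)
  qed
qed

lemma parse_sound:
  assumes "parse look r (nm, map E ts) = Some ([], [v])" and E: "E = veval (\<lambda>i. look (binary (Suc i)))"
  shows "\<exists>t. rev r @ digits nm @ concat (map encode ts) = encode t \<and> v = E t"
  using assms(1)
proof (induction "length r" arbitrary: r nm ts rule: less_induct)
  case less
  show ?case
  proof (cases "r = []")
    case True
    then show ?thesis using less.prems by (cases ts) (auto simp: digits_def)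
  next
    case False
    then obtain b3 b2 b1 r'' where r: "r = b3 # b2 # b1 # r''"
      using less.prems by (metis list.exhaust option.distinct(1) parse.simps(3,4))
    obtain nm' vs' where l: "parse_letter look b1 b2 b3 (nm, map E ts) = Some (nm', vs')"
      "parse look r'' (nm', vs') = Some ([], [v])"
      using less.prems unfolding r by (auto split: bind_splits)
    obtain ts' where ts': "vs' = map E ts'"
      "[b1, b2, b3] @ digits nm @ concat (map encode ts) = digits nm' @ concat (map encode ts')"
      using parse_letter_sound[OF l(1) E] by blast
    have "\<exists>t. rev r'' @ digits nm' @ concat (map encode ts') = encode t \<and> v = E t"
      using less.hyps[of r'' nm' ts'] l(2) ts'(1) r by simp
    then show ?thesis using ts'(2) by (simp add: r)
  qed
qed

lemma parse_iff:
  "parse look (rev x) ([], []) = Some ([], [v]) \<longleftrightarrow>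
    (\<exists>t. x = encode t \<and> v = veval (\<lambda>i. look (binary (Suc i))) t)"
proof
  assume "parse look (rev x) ([], []) = Some ([], [v])"
  with parse_sound[of look "rev x" "[]" _ "[]" v, OF _ refl]
  show "\<exists>t. x = encode t \<and> v = veval (\<lambda>i. look (binary (Suc i))) t" by (simp add: digits_def)
qed (use parse_encode[of look _ "[]" "[]"] in auto)


subsection \<open>Certificates\<close>

text \<open>
  A certificate lists names of variables in binary, each followed by its sign (\<open>3\<close> or \<open>4\<close>). The
  label of a variable is the number of letters \<open>5\<close> preceding it. A scan for the name \<open>u\<close> keeps the
  unmatched and the matched part of the name, the number of mismatches, the current label, the
  number of remaining labels, and the sign found.
\<close>

type_synonym scan = "nat list \<times> nat list \<times> nat \<times> nat \<times> nat \<times> nat list"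

fun scan1 :: "nat \<Rightarrow> scan \<Rightarrow> scan" where
  "scan1 d (u, v, f, l, m, s) =
    (if d = 5 then (if s = [] \<and> m \<noteq> 0 then (u, v, f, Suc l, m - 1, s) else (u, v, f, l, m, s))
     else if d \<le> 2 then
       (if hd0 u = d then (tl u, hd0 u # v, f, l, m, s) else (u, v, Suc f, l, m, s))
     else (rev v @ u, [], 0, l, m, if f = 0 \<and> u = [] \<and> s = [] then [d - 2] else s))"

definition scan :: "nat list \<Rightarrow> nat \<Rightarrow> bool list \<Rightarrow> scan" where
  "scan D m nm = fold scan1 D (map bit nm, [], 0, 0, m, [])"

text \<open>Any string whatsoever gives each name one value with label at most \<open>m\<close>, a
  missing name getting the negative sign. So certificates need no check of their form, and all
  occurrences of a variable agree. The 2 is \<open>bit True\<close>, obtained from the sign letter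
  4.\<close>

definition lookup :: "nat list \<Rightarrow> nat \<Rightarrow> bool list \<Rightarrow> val" where
  "lookup D m nm = (case scan D m nm of (u, v, f, l, m, s) \<Rightarrow> (s = [2], l))"

definition entry :: "bool list \<Rightarrow> bool \<Rightarrow> nat list" where
  "entry w b = map bit w @ [if b then 4 else 3]"

text \<open>When the name is exhausted, a further digit meets the blank and counts as a mismatch. No
  mismatch and nothing unmatched thus means equality, not just a common prefix.
  \<open>rev v @ u\<close> preserves the name for the next entry.\<close>

lemma scan_bits:
  "\<exists>u' v' f'. fold scan1 (map bit w) (u, v, f, l, m, s) = (u', v', f', l, m, s) \<and>
    rev v' @ u' = rev v @ u \<and> (f' = 0 \<and> u' = [] \<longleftrightarrow> f = 0 \<and> u = map bit w)"
proof (induction w arbitrary: u v f)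
  case Nil
  show ?case by auto
next
  case (Cons b w)
  have d: "bit b \<noteq> 5" "bit b \<le> 2" "bit b \<noteq> 0" by (auto simp: bit_def)
  show ?case
  proof (cases "hd0 u = bit b")
    case True
    then obtain u1 where u: "u = bit b # u1" using d(3) by (cases u) auto
    show ?thesis using Cons.IH[of u1 "bit b # v" f] d by (simp add: u)
  next
    case False
    then have "u \<noteq> map bit (b # w)" by auto
    with Cons.IH[of u v "Suc f"] d False show ?thesis by fastforce
  qed
qed

lemma scan_entry:
  "fold scan1 (entry w b) (u, [], 0, l, m, s) =
    (u, [], 0, l, m, if s = [] \<and> u = map bit w then [bit b] else s)"
proof -
  obtain u' v' f' where "fold scan1 (map bit w) (u, [], 0, l, m, s) = (u', v', f', l, m, s)"
    "rev v' @ u' = u" "f' = 0 \<and> u' = [] \<longleftrightarrow> u = map bit w"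
    using scan_bits[of w u "[]" 0 l m s] by auto
  then show ?thesis by (auto simp: entry_def bit_def)
qed

definition var_name :: "nat \<Rightarrow> bool list" where
  "var_name i = binary (Suc i)"

lemma var_name_bits_inject: "map bit (var_name i) = map bit (var_name j) \<longleftrightarrow> i = j"
proof
  assume "map bit (var_name i) = map bit (var_name j)"
  moreover have "inj bit" by (auto simp: inj_def bit_def)
  ultimately have "var_name i = var_name j" by (simp add: inj_map_eq_map)
  then show "i = j" using binary_inject[of "Suc i" "Suc j"] by (simp add: var_name_def)
qed simp

definition block :: "(nat \<Rightarrow> val) \<Rightarrow> nat list \<Rightarrow> nat \<Rightarrow> nat list" where
  "block \<alpha> vs l = concat (map (\<lambda>i. entry (var_name i) (fst (\<alpha> i))) (filter (\<lambda>i. snd (\<alpha> i) = l) vs)) @ [5]"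

definition certificate :: "(nat \<Rightarrow> val) \<Rightarrow> nat list \<Rightarrow> nat \<Rightarrow> nat list" where
  "certificate \<alpha> vs k = concat (map (block \<alpha> vs) [0..<k])"

lemma scan_block:
  "fold scan1 (block \<alpha> vs l') (map bit (var_name j), [], 0, l, Suc m, s) =
    (if s \<noteq> [] then (map bit (var_name j), [], 0, l, Suc m, s)
     else if j \<in> set vs \<and> snd (\<alpha> j) = l' then (map bit (var_name j), [], 0, l, Suc m, [bit (fst (\<alpha> j))])
     else (map bit (var_name j), [], 0, Suc l, m, []))"
proof -
  have "fold scan1 (concat (map (\<lambda>i. entry (var_name i) (fst (\<alpha> i))) is))
      (map bit (var_name j), [], 0, l, m, s) =
    (map bit (var_name j), [], 0, l, m, if s = [] \<and> j \<in> set is then [bit (fst (\<alpha> j))] else s)" for "is" m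
    by (induction "is" arbitrary: s) (auto simp: scan_entry var_name_bits_inject)
  from this[of "filter (\<lambda>i. snd (\<alpha> i) = l') vs" "Suc m"] show ?thesis
    unfolding block_def by simp
qed

lemma scan_block_found:
  "s \<noteq> [] \<Longrightarrow> fold scan1 (block \<alpha> vs l') (map bit (var_name j), [], 0, l, m, s) =
    (map bit (var_name j), [], 0, l, m, s)"
proof -
  assume s: "s \<noteq> []"
  have "fold scan1 (concat (map (\<lambda>i. entry (var_name i) (fst (\<alpha> i))) is))
      (map bit (var_name j), [], 0, l, m, s) = (map bit (var_name j), [], 0, l, m, s)" for "is"
    using s by (induction "is") (auto simp: scan_entry)
  then show ?thesis using s unfolding block_def by simp
qed

lemma lookup_certificate:
  assumes "j \<in> set vs" "snd (\<alpha> j) < k" "snd (\<alpha> j) \<le> m"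
    and m: "k \<le> Suc m"
  shows "lookup (certificate \<alpha> vs k @ replicate p 5) m (var_name j) = \<alpha> j"
proof -
  let ?u = "map bit (var_name j)" and ?l = "snd (\<alpha> j)"
  have fin: "fold scan1 (replicate p 5) (u, v, f, l, m', s) = (u, v, f, l, m', s)" if "s \<noteq> []"
      for u v f l m' s
    using that by (induction p) auto
  have "fold scan1 (certificate \<alpha> vs n) (?u, [], 0, 0, m, []) =
      (if n \<le> ?l then (?u, [], 0, n, m - n, []) else (?u, [], 0, ?l, m - ?l, [bit (fst (\<alpha> j))]))" for n
  proof (induction n)
    case 0
    show ?case by (simp add: certificate_def)
  next
    case (Suc n)
    have step: "fold scan1 (certificate \<alpha> vs (Suc n)) st =
        fold scan1 (block \<alpha> vs n) (fold scan1 (certificate \<alpha> vs n) st)" for st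
      by (simp add: certificate_def)
    consider "n < ?l" | "n = ?l" | "?l < n" by linarith
    then show ?case
    proof cases
      case 1
      then have "m - n = Suc (m - Suc n)" using assms(3) by simp
      with 1 show ?thesis using scan_block[of \<alpha> vs n j n "m - Suc n" "[]"] unfolding step Suc by simp
    next
      \<comment> \<open>\<open>scan_block\<close> presupposes a remaining label. If the label sought
        is \<open>m\<close> itself the supply is exhausted, but the entry is found before the letter
        5 that ends its block.\<close>
      case 2
      show ?thesis
      proof (cases "m - n")
        case 0
        have "fold scan1 (concat (map (\<lambda>i. entry (var_name i) (fst (\<alpha> i))) is))
            (?u, [], 0, n, 0, s) = (?u, [], 0, n, 0, if s = [] \<and>
                j \<in> set is then [bit (fst (\<alpha> j))] else s)" for "is" s
          by (induction "is" arbitrary: s) (auto simp: scan_entry var_name_bits_inject)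
        then show ?thesis using 2 0 assms(1) unfolding step Suc by (simp add: block_def)
      next
        case (Suc m')
        with 2 show ?thesis using scan_block[of \<alpha> vs n j n m' "[]"] assms(1)
          unfolding step Suc.IH by simp
      qed
    next
      case 3
      then show ?thesis unfolding step Suc by (simp add: scan_block_found)
    qed
  qed
  from this[of k] assms(2) fin
  have "scan (certificate \<alpha> vs k @ replicate p 5) m (var_name j) = (?u, [], 0, ?l, m - ?l,
      [bit (fst (\<alpha> j))])"
    by (simp add: scan_def)
  then show ?thesis by (cases "\<alpha> j") (simp add: lookup_def bit_def)
qed

lemma length_certificate:
  assumes "distinct vs"
  shows "length (certificate \<alpha> vs k) =
    (\<Sum>i \<in> {i \<in> set vs. snd (\<alpha> i) < k}. length (var_name i) + 1) + k"
proof (induction k)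
  case 0
  show ?case by (simp add: certificate_def)
next
  case (Suc k)
  have "length (block \<alpha> vs k) = (\<Sum>i \<leftarrow> filter (\<lambda>i. snd (\<alpha> i) = k) vs. length (var_name i) + 1) + 1"
    by (simp add: block_def length_concat comp_def entry_def)
  also have "\<dots> = (\<Sum>i \<in> {i \<in> set vs. snd (\<alpha> i) = k}. length (var_name i) + 1) + 1"
    using assms by (subst sum_list_distinct_conv_sum_set) auto
  finally have 1: "length (block \<alpha> vs k) = (\<Sum>i \<in> {i \<in> set vs. snd (\<alpha> i) =
      k}. length (var_name i) + 1) + 1" .
  have "{i \<in> set vs. snd (\<alpha> i) < Suc k} = {i \<in> set vs. snd (\<alpha> i) < k} \<union> {i \<in> set vs. snd (\<alpha> i) = k}"
    by auto
  then have "(\<Sum>i \<in> {i \<in> set vs. snd (\<alpha> i) < Suc k}. length (var_name i) + 1) =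
      (\<Sum>i \<in> {i \<in> set vs. snd (\<alpha> i) < k}. length (var_name i) + 1) +
      (\<Sum>i \<in> {i \<in> set vs. snd (\<alpha> i) = k}. length (var_name i) + 1)"
    by (simp only:) (rule sum.union_disjoint; auto)
  with Suc 1 show ?case by (simp add: certificate_def)
qed

lemma set_certificate: "set (certificate \<alpha> vs k) \<subseteq> {1..5}"
  by (auto simp: certificate_def block_def entry_def bit_def)

lemma finite_vars: "finite (vars t)"
  by (induction t) auto

text \<open>This makes the certificate fit: it spends one letter per digit and one per sign for each
  variable, plus at most one separator per variable and one more for label 0. The term spends three
  bits on each digit and three on the letter \<open>x\<close>.\<close>

lemma length_encode: "(\<Sum>i \<in> vars t. length (var_name i) + 2) + 1 \<le> length (encode t)"
proof (induction t)
  case (Var i)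
  show ?case unfolding encode_Var
      by (simp add: var_name_def digits_def length_concat comp_def sum_list_triv)
next
  case (Meet s t)
  have "(\<Sum>i \<in> vars s \<union> vars t. length (var_name i) + 2) \<le>
      (\<Sum>i \<in> vars s. length (var_name i) + 2) + (\<Sum>i \<in> vars t. length (var_name i) + 2)"
    using sum.union_inter[OF finite_vars finite_vars, of "\<lambda>i. length (var_name i) + 2" s t] by linarith
  with Meet show ?case by simp
next
  case (Join s t)
  have "(\<Sum>i \<in> vars s \<union> vars t. length (var_name i) + 2) \<le>
      (\<Sum>i \<in> vars s. length (var_name i) + 2) + (\<Sum>i \<in> vars t. length (var_name i) + 2)"
    using sum.union_inter[OF finite_vars finite_vars, of "\<lambda>i. length (var_name i) + 2" s t] by linarith
  with Join show ?case by simp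
qed auto

subsection \<open>The verifier\<close>

text \<open>
  Stacks: \<open>1\<close> input, last letter on top; \<open>2\<close> certificate; \<open>3\<close> supply of labels; \<open>5\<close> name being read;
  \<open>7\<close> values, each with its sign on top of its label in unary; \<open>13\<close> failure. The other stacks are
  auxiliary: \<open>4\<close>, \<open>6\<close>, \<open>14\<close> hold the scanned part of the certificate, the matched part of the
  name and the mismatches, and \<open>8\<close> to \<open>12\<close> labels and signs of operands.
\<close>

definition store_vals :: "val list \<Rightarrow> nat list" where
  "store_vals vs = concat (map (\<lambda>(b, l). bit b # replicate l 3) vs)"

lemma store_vals_simps [simp]:
  "store_vals [] = []" "store_vals ((b, l) # vs) = bit b # replicate l 3 @ store_vals vs"
  by (simp_all add: store_vals_def)

text \<open>Labels use the symbol 3 and signs the symbols 1 and 2, so a label ends where the top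
  differs from 3.\<close>

lemma hd0_store_vals: "hd0 (store_vals vs) \<noteq> 3"
  by (cases vs) (auto simp: bit_def split: if_splits)

lemma hd0_replicate: "hd0 (replicate n x) = 0 \<longleftrightarrow> n = 0 \<or> x = 0"
  by (cases n) auto

definition fail :: prog where
  "fail = Push 13 (\<lambda>_. 1)"

definition take_entry :: "nat \<Rightarrow> nat \<Rightarrow> prog" where
  "take_entry a s = Push s (\<lambda>r. r 7) ;; Pop 7 ;; Loop (\<lambda>r. r 7 = 3) (Pop 7 ;; Push a (\<lambda>_. 3))"

lemma exec_take_entry:
  assumes "\<sigma> 7 = bit b # replicate l 3 @ ws" "hd0 ws \<noteq> 3" "\<sigma> a = []" "\<sigma> s = []" "l \<le> S"
    and "a \<noteq> 7" "s \<noteq> 7" "a \<noteq> s"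
  shows "exec S (take_entry a s) \<sigma> = Some (\<sigma>(7 := ws, a := replicate l 3, s := [bit b]))"
proof -
  let ?st = "\<lambda>q. \<sigma>(7 := replicate (l - q) 3 @ ws, a := replicate q 3, s := [bit b])"
  let ?F = "exec S (Pop 7 ;; Push a (\<lambda>_. 3))"
  have "iterate (\<lambda>r. r 7 = 3) ?F S (?st 0) = Some (?st l)"
  proof (rule iterate_stages[where st = ?st])
    fix q
    assume q: "q < l"
    then have d: "replicate (l - q) (3::nat) = 3 # replicate (l - Suc q) 3"
      by (rule replicate_minus)
    have "?F (?st q) = Some (?st (Suc q))"
      using assms(6-8) by (simp add: d) (auto simp: fun_eq_iff)
    moreover have "tops (?st q) 7 = 3" using assms(6-8) by (simp add: d tops_def)
    ultimately show "tops (?st q) 7 = 3 \<and> ?F (?st q) = Some (?st (Suc q))" by blast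
  next
    show "tops (?st l) 7 \<noteq> 3" using assms(2,6-8) by (simp add: tops_def)
  qed (rule assms(5))
  then have loop: "exec S (Loop (\<lambda>r. r 7 = 3) (Pop 7 ;; Push a (\<lambda>_. 3))) (?st 0) = Some (?st l)"
    by (simp only: exec.simps(6))
  have push: "exec S (Push s (\<lambda>r. r 7)) \<sigma> = Some (\<sigma>(s := [bit b]))"
    using assms(1,4,7) by (simp add: tops_def)
  have "(\<sigma>(s := [bit b]))(7 := replicate l 3 @ ws) = ?st 0"
    using assms(3,6-8) by (auto simp: fun_eq_iff)
  then have pop: "exec S (Pop 7) (\<sigma>(s := [bit b])) = Some (?st 0)"
    using assms(1,7) by simp
  show ?thesis
    unfolding take_entry_def exec.simps(4) push pop bind.bind_lunit loop by simp
qed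

definition flip :: "nat \<Rightarrow> prog" where
  "flip j = Cond (\<lambda>r. r j = 2) (Pop j ;; Push j (\<lambda>_. 1)) (Pop j ;; Push j (\<lambda>_. 2))"

lemma exec_flip: "\<sigma> j = bit b # xs \<Longrightarrow> exec S (flip j) \<sigma> = Some (\<sigma>(j := bit (\<not> b) # xs))"
  by (cases b) (simp_all add: flip_def tops_def bit_def)

text \<open>The loop cancels the labels against each other and collects the common part on
  \<open>12\<close>. If \<open>12\<close> and \<open>8\<close> are empty and the sign on
  \<open>9\<close> is positive, the first operand is \<open>top\<close> and the label of the other
  is intact on \<open>10\<close>; dually for the second. Empty \<open>8\<close> and
  \<open>10\<close> mean equal labels. All remaining cases give the code of
  \<open>bot\<close>.\<close>

definition meet_prog :: prog where
  "meet_prog = Loop (\<lambda>r. r 8 \<noteq> 0 \<and> r 10 \<noteq> 0) (Pop 8 ;; Pop 10 ;; Push 12 (\<lambda>_. 3)) ;;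
    Cond (\<lambda>r. r 12 = 0 \<and> r 8 = 0 \<and> r 9 = 2) (move 10 7 ;; Push 7 (\<lambda>r. r 11))
    (Cond (\<lambda>r. r 12 = 0 \<and> r 10 = 0 \<and> r 11 = 2) (move 8 7 ;; Push 7 (\<lambda>r. r 9))
    (Cond (\<lambda>r. r 12 \<noteq> 0 \<and> r 8 = 0 \<and> r 10 = 0 \<and> r 9 = r 11) (move 12 7 ;; Push 7 (\<lambda>r. r 9))
    (Push 7 (\<lambda>_. 1)))) ;;
    clear 8 ;; clear 10 ;; clear 12 ;; Pop 9 ;; Pop 11"

lemma exec_meet_prog:
  assumes "\<sigma> 8 = replicate l1 3" "\<sigma> 9 = [bit b1]" "\<sigma> 10 = replicate l2 3" "\<sigma> 11 = [bit b2]" "\<sigma> 12 = []"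
    and "l1 \<le> S" "l2 \<le> S"
  shows "exec S meet_prog \<sigma> = Some (\<sigma>(7 := store_vals [vmeet (b1, l1) (b2, l2)] @ \<sigma> 7,
    8 := [], 9 := [], 10 := [], 11 := [], 12 := []))"
proof -
  let ?m = "min l1 l2"
  let ?st = "\<lambda>q. \<sigma>(8 := replicate (l1 - q) 3, 10 := replicate (l2 - q) 3, 12 := replicate q 3)"
  let ?F = "exec S (Pop 8 ;; Pop 10 ;; Push 12 (\<lambda>_. 3))"
  have "iterate (\<lambda>r. r 8 \<noteq> 0 \<and> r 10 \<noteq> 0) ?F S (?st 0) = Some (?st ?m)"
  proof (rule iterate_stages[where st = ?st])
    fix q
    assume q: "q < ?m"
    then have d: "replicate (l1 - q) (3::nat) = 3 # replicate (l1 - Suc q) 3"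
      "replicate (l2 - q) (3::nat) = 3 # replicate (l2 - Suc q) 3"
      using replicate_minus[of q l1] replicate_minus[of q l2] by simp_all
    have "?F (?st q) = Some (?st (Suc q))"
      by (simp add: d)
    moreover have "tops (?st q) 8 \<noteq> 0 \<and> tops (?st q) 10 \<noteq> 0" by (simp add: d tops_def)
    ultimately show "(tops (?st q) 8 \<noteq> 0 \<and> tops (?st q) 10 \<noteq> 0) \<and> ?F (?st q) = Some (?st (Suc q))"
      by blast
  next
    show "\<not> (tops (?st ?m) 8 \<noteq> 0 \<and> tops (?st ?m) 10 \<noteq> 0)" by (simp add: tops_def min_def)
    show "?m \<le> S" using assms(6) by simp
  qed
  moreover have "?st 0 = \<sigma>" using assms by (simp add: fun_eq_iff)
  ultimately have loop: "exec S (Loop (\<lambda>r. r 8 \<noteq> 0 \<and> r 10 \<noteq> 0) (Pop 8 ;; Pop 10 ;;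
      Push 12 (\<lambda>_. 3))) \<sigma> = Some (?st ?m)"
    by simp
  let ?C = "Cond (\<lambda>r. r 12 = 0 \<and> r 8 = 0 \<and> r 9 = 2) (move 10 7 ;; Push 7 (\<lambda>r. r 11))
    (Cond (\<lambda>r. r 12 = 0 \<and> r 10 = 0 \<and> r 11 = 2) (move 8 7 ;; Push 7 (\<lambda>r. r 9))
    (Cond (\<lambda>r. r 12 \<noteq> 0 \<and> r 8 = 0 \<and> r 10 = 0 \<and> r 9 = r 11) (move 12 7 ;; Push 7 (\<lambda>r. r 9))
    (Push 7 (\<lambda>_. 1))))"
  have hd: "hd0 (replicate n 3) = 0 \<longleftrightarrow> n = 0" for n by (cases n) auto
  have "\<exists>x8 x10 x12. exec S ?C (?st ?m) = Some (\<sigma>(7 := store_vals [vmeet (b1, l1) (b2, l2)] @ \<sigma> 7,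
      8 := replicate x8 3, 10 := replicate x10 3, 12 := replicate x12 3)) \<and> x8 \<le> S \<and> x10 \<le> S \<and> x12 \<le> S"
  proof -
    have t: "tops (?st ?m) 8 = 0 \<longleftrightarrow> l1 \<le> l2" "tops (?st ?m) 10 = 0 \<longleftrightarrow> l2 \<le> l1"
      "tops (?st ?m) 12 = 0 \<longleftrightarrow> l1 = 0 \<or> l2 = 0" "tops (?st ?m) 9 = bit b1" "tops (?st ?m) 11 = bit b2"
      using assms by (auto simp: tops_def hd min_def)
    consider "l1 = 0" "b1" | "\<not> (l1 = 0 \<and> b1)" "l2 = 0" "b2"
      | "\<not> (l1 = 0 \<and> b1)" "\<not> (l2 = 0 \<and> b2)" "l1 = l2" "b1 = b2" "l1 \<noteq> 0"
      | "\<not> (l1 = 0 \<and> b1)" "\<not> (l2 = 0 \<and> b2)" "\<not> (l1 = l2 \<and> b1 = b2 \<and> l1 \<noteq> 0)" by blast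
    then show ?thesis
    proof cases
      case 1
      then have "exec S ?C (?st ?m) = exec S (move 10 7 ;; Push 7 (\<lambda>r. r 11)) (?st ?m)"
        using t by (simp add: bit_def)
      also have "\<dots> = Some (\<sigma>(7 := store_vals [(b2, l2)] @ \<sigma> 7, 8 := replicate 0 3, 10 :=
          replicate 0 3, 12 := replicate 0 3))"
        using 1 assms by (simp add: exec_move tops_def) (auto simp: fun_eq_iff)
      finally show ?thesis using 1 by (fastforce simp: vmeet_def)
    next
      case 2
      then have "exec S ?C (?st ?m) = exec S (move 8 7 ;; Push 7 (\<lambda>r. r 9)) (?st ?m)"
        using t by (auto simp: bit_def)
      also have "\<dots> = Some (\<sigma>(7 := store_vals [(b1, l1)] @ \<sigma> 7, 8 := replicate 0 3, 10 :=
          replicate 0 3, 12 := replicate 0 3))"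
        using 2 assms by (simp add: exec_move tops_def) (auto simp: fun_eq_iff)
      finally show ?thesis using 2 by (fastforce simp: vmeet_def)
    next
      case 3
      then have "exec S ?C (?st ?m) = exec S (move 12 7 ;; Push 7 (\<lambda>r. r 9)) (?st ?m)"
        using t by (auto simp: bit_def)
      also have "\<dots> = Some (\<sigma>(7 := store_vals [(b1, l1)] @ \<sigma> 7, 8 := replicate 0 3, 10 :=
          replicate 0 3, 12 := replicate 0 3))"
        using 3 assms by (simp add: exec_move tops_def) (auto simp: fun_eq_iff)
      finally show ?thesis using 3 by (fastforce simp: vmeet_def)
    next
      case 4
      then have "exec S ?C (?st ?m) = exec S (Push 7 (\<lambda>_. 1)) (?st ?m)"
        using t by (auto simp: bit_def)
      also have "\<dots> = Some (\<sigma>(7 := store_vals [(False, 0)] @ \<sigma> 7, 8 := replicate (l1 - ?m) 3,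
          10 := replicate (l2 - ?m) 3, 12 := replicate ?m 3))"
        by (simp add: bit_def fun_eq_iff)
      finally have e: "exec S ?C (?st ?m) = Some (\<sigma>(7 := store_vals [(False, 0)] @ \<sigma> 7, 8 :=
          replicate (l1 - ?m) 3,
          10 := replicate (l2 - ?m) 3, 12 := replicate ?m 3))" .
      have v: "vmeet (b1, l1) (b2, l2) = (False, 0)" using 4 by (auto simp: vmeet_def)
      show ?thesis unfolding v
        by (rule exI[of _ "l1 - ?m"], rule exI[of _ "l2 - ?m"], rule exI[of _ ?m], intro conjI, rule e)
          (use assms(6,7) in auto)
    qed
  qed
  then obtain x8 x10 x12 where C: "exec S ?C (?st ?m) = Some (\<sigma>(7 := store_vals [vmeet (b1, l1) (b2,
      l2)] @ \<sigma> 7,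
      8 := replicate x8 3, 10 := replicate x10 3, 12 := replicate x12 3))"
    and x: "x8 \<le> S" "x10 \<le> S" "x12 \<le> S" by blast
  have "exec S meet_prog \<sigma> = exec S (clear 8 ;; clear 10 ;; clear 12 ;; Pop 9 ;; Pop 11)
      (\<sigma>(7 := store_vals [vmeet (b1, l1) (b2, l2)] @ \<sigma> 7,
        8 := replicate x8 3, 10 := replicate x10 3, 12 := replicate x12 3))"
    unfolding meet_prog_def exec.simps(4)[of S "Loop _ _"] loop bind.bind_lunit
    unfolding exec.simps(4)[of S ?C] C bind.bind_lunit ..
  also have "\<dots> = Some (\<sigma>(7 := store_vals [vmeet (b1, l1) (b2, l2)] @ \<sigma> 7,
      8 := [], 9 := [], 10 := [], 11 := [], 12 := []))"
    using x assms(2,4) by (simp add: exec_clear) (simp add: fun_eq_iff)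
  finally show ?thesis .
qed

definition binary_op :: "bool \<Rightarrow> prog" where
  "binary_op join = Cond (\<lambda>r. r 7 = 0) fail (take_entry 8 9 ;;
    Cond (\<lambda>r. r 7 = 0) fail (take_entry 10 11 ;;
      (if join then flip 9 ;; flip 11 ;; meet_prog ;; flip 7 else meet_prog)))"

lemma exec_binary_op:
  assumes "\<sigma> 7 = store_vals vs" "\<And>j. j \<in> {8, 9, 10, 11, 12} \<Longrightarrow> \<sigma> j = []" "\<And>v. v \<in> set vs \<Longrightarrow> snd v \<le> S"
  shows "case vs of x # y # ws \<Rightarrow> exec S (binary_op join) \<sigma> =
      Some (\<sigma>(7 := store_vals ((if join then vjoin x y else vmeet x y) # ws)))
    | _ \<Rightarrow> \<exists>\<tau>. exec S (binary_op join) \<sigma> = Some \<tau> \<and> hd0 (\<tau> 13) \<noteq> 0"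
proof (cases vs)
  case Nil
  then show ?thesis using assms(1) by (simp add: binary_op_def fail_def tops_def)
next
  case (Cons x us)
  obtain b1 l1 where x: "x = (b1, l1)" by (cases x)
  let ?\<sigma>1 = "\<sigma>(7 := store_vals us, 8 := replicate l1 3, 9 := [bit b1])"
  have l1: "l1 \<le> S" using assms(3)[of x] Cons x by simp
  have 1: "exec S (take_entry 8 9) \<sigma> = Some ?\<sigma>1"
    by (rule exec_take_entry) (use assms(1,2) l1 in \<open>simp_all add: Cons x hd0_store_vals\<close>)
  have top: "tops \<sigma> 7 \<noteq> 0" using assms(1) by (simp add: tops_def Cons x bit_def)
  show ?thesis
  proof (cases us)
    case Nil
    then show ?thesis using 1 top by (simp add: Cons binary_op_def fail_def tops_def)
  next
    case (Cons y ws)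
    obtain b2 l2 where y: "y = (b2, l2)" by (cases y)
    let ?\<sigma>2 = "?\<sigma>1(7 := store_vals ws, 10 := replicate l2 3, 11 := [bit b2])"
    have l2: "l2 \<le> S" using assms(3)[of y] \<open>vs = x # us\<close> Cons y by simp
    have 2: "exec S (take_entry 10 11) ?\<sigma>1 = Some ?\<sigma>2"
      by (rule exec_take_entry) (use assms(2) l2 in \<open>simp_all add: Cons y hd0_store_vals\<close>)
    have top2: "tops ?\<sigma>1 7 \<noteq> 0" by (simp add: tops_def Cons y bit_def)
    have "exec S (binary_op join) \<sigma> = exec S
        (if join then flip 9 ;; flip 11 ;; meet_prog ;; flip 7 else meet_prog) ?\<sigma>2"
      using top top2 by (simp add: binary_op_def 1 2)
    also have "\<dots> = Some (\<sigma>(7 := store_vals ((if join then vjoin x y else vmeet x y) # ws)))"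
    proof (cases "join")
      case False
      have "?\<sigma>2(7 := store_vals [vmeet x y] @ ?\<sigma>2 7, 8 := [], 9 := [], 10 := [], 11 := [], 12 := []) =
          \<sigma>(7 := store_vals (vmeet x y # ws))"
        using assms(2) by (auto simp: fun_eq_iff store_vals_def)
      moreover have "exec S meet_prog ?\<sigma>2 = Some (?\<sigma>2(7 := store_vals [vmeet x y] @ ?\<sigma>2 7,
          8 := [], 9 := [], 10 := [], 11 := [], 12 := []))"
        unfolding x y by (rule exec_meet_prog) (use assms(2) l1 l2 in simp_all)
      ultimately show ?thesis using False by (simp only: if_False)
    next
      case True
      let ?\<sigma>3 = "?\<sigma>2(9 := [bit (\<not> b1)], 11 := [bit (\<not> b2)])"
      obtain b l where m: "vmeet (\<not> b1, l1) (\<not> b2, l2) = (b, l)" by (metis prod.exhaust)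
      have f: "exec S (flip 9 ;; flip 11) ?\<sigma>2 = Some ?\<sigma>3"
        by (simp add: exec_flip)
      have "exec S meet_prog ?\<sigma>3 = Some (?\<sigma>3(7 := store_vals [vmeet (\<not> b1, l1) (\<not> b2, l2)] @ ?\<sigma>3 7,
          8 := [], 9 := [], 10 := [], 11 := [], 12 := []))"
        by (rule exec_meet_prog) (use assms(2) l1 l2 in simp_all)
      also have "?\<sigma>3(7 := store_vals [vmeet (\<not> b1, l1) (\<not> b2, l2)] @ ?\<sigma>3 7,
          8 := [], 9 := [], 10 := [], 11 := [], 12 := []) = \<sigma>(7 := store_vals ((b, l) # ws))"
        unfolding m using assms(2) by (auto simp: fun_eq_iff)
      finally have R: "exec S meet_prog ?\<sigma>3 = Some (\<sigma>(7 := store_vals ((b, l) # ws)))" .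
      have "exec S (flip 7) (\<sigma>(7 := store_vals ((b, l) # ws))) = Some (\<sigma>(7 := store_vals ((\<not> b,
          l) # ws)))"
        by (simp add: exec_flip)
      then have "exec S (meet_prog ;; flip 7) ?\<sigma>3 = Some (\<sigma>(7 := store_vals ((\<not> b, l) # ws)))"
        unfolding exec.simps(4) R bind.bind_lunit .
      moreover have "vjoin x y = (\<not> b, l)" using m by (simp add: vjoin_def vneg_def x y)
      ultimately show ?thesis using True f by (auto split: bind_splits)
    qed
    finally show ?thesis by (simp add: \<open>vs = x # us\<close> Cons)
  qed
qed


subsection \<open>Looking up a variable\<close>

definition scan_letter :: prog where
  "scan_letter = Cond (\<lambda>r. r 2 = 5) (Cond (\<lambda>r. r 9 = 0 \<and> r 3 \<noteq> 0) (Pop 3 ;; Push 8 (\<lambda>_. 3)) Skip)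
    (Cond (\<lambda>r. r 2 \<le> 2) (Cond (\<lambda>r. r 5 = r 2) (Push 6 (\<lambda>r. r 5) ;; Pop 5) (Push 14 (\<lambda>_. 1)))
    (Cond (\<lambda>r. r 14 = 0 \<and> r 5 = 0 \<and> r 9 = 0) (Push 9 (\<lambda>r. r 2 - 2)) Skip ;; move 6 5 ;; clear 14))"

fun scan_store :: "store \<Rightarrow> scan \<Rightarrow> store" where
  "scan_store \<sigma> (u, v, f, l, m, s) =
    \<sigma>(5 := u, 6 := v, 14 := replicate f 1, 8 := replicate l 3, 3 := replicate m 1, 9 := s)"

fun scan_inv :: "nat \<Rightarrow> nat \<Rightarrow> nat \<Rightarrow> scan \<Rightarrow> bool" where
  "scan_inv c n m' (u, v, f, l, m, s) \<longleftrightarrow> set u \<subseteq> {1, 2} \<and> set v \<subseteq> {1, 2} \<and> length u + length v = c \<and>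
    f \<le> n \<and> l + m = m' \<and> 0 \<notin> set s"

lemma hd0_eq_0: "0 \<notin> set xs \<Longrightarrow> hd0 xs = 0 \<longleftrightarrow> xs = []"
  by (cases xs) auto

lemma scan_inv_step:
  assumes "scan_inv c n m' st" "d \<in> {1..5}"
  shows "scan_inv c (Suc n) m' (scan1 d st)"
proof -
  obtain u v f l m s where st: "st = (u, v, f, l, m, s)" by (metis prod.exhaust)
  show ?thesis
  proof (cases u)
    case Nil
    with assms show ?thesis unfolding st by auto
  next
    case (Cons x xs)
    with assms show ?thesis unfolding st by auto
  qed
qed

lemma exec_scan_letter:
  assumes "scan_inv c n m' st" "c \<le> S" "n \<le> S" "hd0 (\<sigma> 2) = d" "d \<in> {1..5}"
  shows "exec S scan_letter (scan_store \<sigma> st) = Some (scan_store \<sigma> (scan1 d st))"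
proof -
  obtain u v f l m s where st: "st = (u, v, f, l, m, s)" by (metis prod.exhaust)
  have inv: "set u \<subseteq> {1, 2}" "set v \<subseteq> {1, 2}" "length u + length v = c" "f \<le> n" "0 \<notin> set s"
    using assms(1) by (simp_all add: st)
  have zeros: "0 \<notin> set u" "0 \<notin> set v" using inv(1,2) by auto
  let ?\<sigma> = "scan_store \<sigma> st"
  have t: "tops ?\<sigma> 2 = d" "tops ?\<sigma> 5 = hd0 u" "tops ?\<sigma> 9 = 0 \<longleftrightarrow> s = []"
    "tops ?\<sigma> 3 = 0 \<longleftrightarrow> m = 0" "tops ?\<sigma> 14 = 0 \<longleftrightarrow> f = 0"
    using assms(4) hd0_eq_0[OF inv(5)] by (simp_all add: st tops_def hd0_replicate)
  consider "d = 5" | "d \<noteq> 5" "d \<le> 2" | "d \<noteq> 5" "\<not> d \<le> 2" by blast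
  then show ?thesis
  proof cases
    case 1
    show ?thesis
    proof (cases "s = [] \<and> m \<noteq> 0")
      case True
      then obtain m1 where "m = Suc m1" by (cases m) auto
      with True 1 t show ?thesis
        by (simp add: scan_letter_def) (simp add: st fun_eq_iff)
    next
      case False
      with 1 t show ?thesis by (auto simp: scan_letter_def st)
    qed
  next
    case 2
    show ?thesis
    proof (cases "hd0 u = d")
      case True
      then obtain u1 where u: "u = d # u1" using assms(5) by (cases u) auto
      with 2 t show ?thesis
        by (simp add: scan_letter_def) (simp add: st tops_def fun_eq_iff)
    next
      case False
      with 2 t show ?thesis
        by (simp add: scan_letter_def) (simp add: st fun_eq_iff)
    qed
  next
    case 3
    let ?s = "if f = 0 \<and> u = [] \<and> s = [] then [d - 2] else s"
    have "exec S (Cond (\<lambda>r. r 14 = 0 \<and> r 5 = 0 \<and> r 9 = 0) (Push 9 (\<lambda>r. r 2 - 2)) Skip) ?\<sigma> =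
        Some (scan_store \<sigma> (u, v, f, l, m, ?s))"
      using t hd0_eq_0[OF zeros(1)] by (auto simp: st fun_eq_iff)
    moreover have "exec S (move 6 5) (scan_store \<sigma> (u, v, f, l, m, ?s)) =
        Some (scan_store \<sigma> (rev v @ u, [], f, l, m, ?s))"
      using zeros(2) inv(3) assms(2) by (subst exec_move) (auto simp: fun_eq_iff)
    moreover have "exec S (clear 14) (scan_store \<sigma> (rev v @ u, [], f, l, m, ?s)) =
        Some (scan_store \<sigma> (rev v @ u, [], 0, l, m, ?s))"
      using inv(4) assms(3) by (subst exec_clear) (auto simp: fun_eq_iff)
    ultimately have "exec S (Cond (\<lambda>r. r 14 = 0 \<and> r 5 = 0 \<and> r 9 = 0) (Push 9 (\<lambda>r. r 2 - 2)) Skip ;;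
        move 6 5 ;; clear 14) ?\<sigma> =
        Some (scan_store \<sigma> (rev v @ u, [], 0, l, m, ?s))"
      by (simp only: exec.simps(4) bind.bind_lunit)
    moreover have "exec S scan_letter ?\<sigma> = exec S (Cond (\<lambda>r. r 14 = 0 \<and> r 5 = 0 \<and> r 9 =
        0) (Push 9 (\<lambda>r. r 2 - 2)) Skip ;; move 6 5 ;; clear 14) ?\<sigma>"
      unfolding scan_letter_def exec.simps(5)[of S "\<lambda>r. r 2 = 5"] exec.simps(5)[of S "\<lambda>r. r 2 \<le> 2"] t(1)
      using 3 by (simp only: if_False)
    moreover have "scan1 d st = (rev v @ u, [], 0, l, m, ?s)" using 3 by (simp add: st)
    ultimately show ?thesis by (simp only:)
  qed
qed

text \<open>Labels counted by the scan are borrowed from the supply on \<open>3\<close> and returned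
  while the label is pushed on \<open>7\<close>. The certificate passes through \<open>4\<close> and
  is restored, so the next variable finds both unchanged.\<close>

definition lookup_prog :: prog where
  "lookup_prog = Loop (\<lambda>r. r 2 \<noteq> 0) (scan_letter ;; Push 4 (\<lambda>r. r 2) ;; Pop 2) ;;
    move 4 2 ;; clear 5 ;; clear 6 ;; clear 14 ;;
    Loop (\<lambda>r. r 8 \<noteq> 0) (Pop 8 ;; Push 7 (\<lambda>_. 3) ;; Push 3 (\<lambda>_. 1)) ;;
    Push 7 (\<lambda>r. if r 9 = 2 then 2 else 1) ;; clear 9"

lemma scan_inv_fold:
  "scan_inv c n m' st \<Longrightarrow> set D \<subseteq> {1..5} \<Longrightarrow> scan_inv c (n + length D) m' (fold scan1 D st)"
proof (induction D arbitrary: n st)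
  case (Cons d D)
  then show ?case using scan_inv_step[of c n m' st d] Cons.IH[of "Suc n" "scan1 d st"] by simp
qed simp

lemma exec_lookup_prog:
  assumes D: "\<sigma> 2 = D" "set D \<subseteq> {1..5}" "length D \<le> S"
    and m: "\<sigma> 3 = replicate m 1" "m \<le> S" and nm: "\<sigma> 5 = map bit nm" "length nm \<le> S"
    and empty: "\<And>j. j \<in> {4, 6, 8, 9, 14} \<Longrightarrow> \<sigma> j = []"
  shows "exec S lookup_prog \<sigma> = Some (\<sigma>(5 := [], 7 := store_vals [lookup D m nm] @ \<sigma> 7))"
proof -
  let ?i = "(map bit nm, [], 0, 0, m, []) :: scan"
  let ?st = "\<lambda>q. (scan_store \<sigma> (fold scan1 (take q D) ?i))(2 := drop q D, 4 := rev (take q D))"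
  let ?F = "exec S (scan_letter ;; Push 4 (\<lambda>r. r 2) ;; Pop 2)"
  have inv: "scan_inv (length nm) q m (fold scan1 (take q D) ?i)" if "q \<le> length D" for q
  proof -
    have "set (take q D) \<subseteq> {1..5}" using D(2) set_take_subset[of q D] by blast
    then show ?thesis
      using scan_inv_fold[of "length nm" 0 m ?i "take q D"] that by (auto simp: bit_def)
  qed
  have upd: "(scan_store \<sigma> x)(2 := ys, 4 := zs) = scan_store (\<sigma>(2 := ys, 4 := zs)) x" for x ys zs
    by (cases x) (auto simp: fun_eq_iff)
  have sc: "scan_store \<sigma> x 2 = \<sigma> 2 \<and> scan_store \<sigma> x 4 = \<sigma> 4" for \<sigma> x
    by (cases x) simp
  have "iterate (\<lambda>r. r 2 \<noteq> 0) ?F S (?st 0) = Some (?st (length D))"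
  proof (rule iterate_stages[where st = ?st])
    fix q
    assume q: "q < length D"
    then have d: "drop q D = D ! q # drop (Suc q) D" by (simp add: Cons_nth_drop_Suc)
    have Dq: "D ! q \<in> {1..5}" using D(2) q nth_mem by blast
    have t: "take (Suc q) D = take q D @ [D ! q]" using q by (simp add: take_Suc_conv_app_nth)
    have "exec S scan_letter (?st q) =
        Some (scan_store (\<sigma>(2 := drop q D, 4 :=
            rev (take q D))) (scan1 (D ! q) (fold scan1 (take q D) ?i)))"
      unfolding upd by (rule exec_scan_letter[OF inv]) (use q D nm Dq d in auto)
    then have "?F (?st q) = exec S (Push 4 (\<lambda>r. r 2) ;; Pop 2)
        (scan_store (\<sigma>(2 := drop q D, 4 := rev (take q D))) (fold scan1 (take (Suc q) D) ?i))"
      by (simp add: t)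
    also have "\<dots> = Some (?st (Suc q))"
      unfolding upd[symmetric] by (simp add: tops_def d t fun_upd_twist)
    finally have "?F (?st q) = Some (?st (Suc q))" .
    moreover have "tops (?st q) 2 \<noteq> 0" using Dq by (simp add: tops_def d)
    ultimately show "tops (?st q) 2 \<noteq> 0 \<and> ?F (?st q) = Some (?st (Suc q))" by blast
  next
    show "\<not> tops (?st (length D)) 2 \<noteq> 0" by (simp add: tops_def)
    show "length D \<le> S" by (rule D(3))
  qed
  moreover have "?st 0 = \<sigma>" using D(1) m(1) nm(1) empty by (auto simp: fun_eq_iff)
  ultimately have loop: "exec S (Loop (\<lambda>r. r 2 \<noteq> 0) (scan_letter ;; Push 4 (\<lambda>r. r 2) ;; Pop 2)) \<sigma> =
      Some (?st (length D))"
    by (simp only: exec.simps(6))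
  obtain u v f l m' s where fin: "scan D m nm = (u, v, f, l, m', s)" by (metis prod.exhaust)
  have fin': "scan_inv (length nm) (length D) m (u, v, f, l, m', s)"
    using inv[of "length D"] fin by (simp add: scan_def)
  then have bounds: "set u \<subseteq> {1, 2}" "set v \<subseteq> {1,
      2}" "length u \<le> S" "length v \<le> S" "f \<le> S" "l + m' = m" "0 \<notin> set s"
    using nm(2) D(3) by auto
  let ?\<sigma>1 = "\<sigma>(5 := u, 6 := v, 14 := replicate f 1, 8 := replicate l 3, 3 := replicate m' 1, 9 := s,
      2 := [], 4 := rev D)"
  have st: "?st (length D) = ?\<sigma>1"
    using fin by (simp add: scan_def)
  have mv: "exec S (move 4 2) ?\<sigma>1 = Some (?\<sigma>1(4 := [], 2 := D))"
    by (subst exec_move) (use D in auto)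
  have c5: "exec S (clear 5) (?\<sigma>1(4 := [], 2 := D)) = Some (?\<sigma>1(4 := [], 2 := D, 5 := []))"
    by (rule exec_clear) (use bounds in auto)
  have c6: "exec S (clear 6) (?\<sigma>1(4 := [], 2 := D, 5 := [])) = Some (?\<sigma>1(4 := [], 2 := D, 5 := [],
      6 := []))"
    by (rule exec_clear) (use bounds in auto)
  have c14: "exec S (clear 14) (?\<sigma>1(4 := [], 2 := D, 5 := [], 6 := [])) =
      Some (?\<sigma>1(4 := [], 2 := D, 5 := [], 6 := [], 14 := []))"
    by (rule exec_clear) (use bounds in auto)
  let ?t = "\<lambda>q. \<sigma>(5 := [], 8 := replicate (l - q) 3, 7 := replicate q 3 @ \<sigma> 7, 3 :=
      replicate (q + m') 1, 9 := s)"
  have t0: "?\<sigma>1(4 := [], 2 := D, 5 := [], 6 := [], 14 := []) = ?t 0"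
    using D(1) empty by (auto simp: fun_eq_iff)
  let ?G = "exec S (Pop 8 ;; Push 7 (\<lambda>_. 3) ;; Push 3 (\<lambda>_. 1))"
  have "iterate (\<lambda>r. r 8 \<noteq> 0) ?G S (?t 0) = Some (?t l)"
  proof (rule iterate_stages[where st = ?t])
    fix q
    assume q: "q < l"
    then have d: "replicate (l - q) (3::nat) = 3 # replicate (l - Suc q) 3"
      by (rule replicate_minus)
    have "?G (?t q) = Some (?t (Suc q))"
      by (simp add: d) (simp add: fun_eq_iff)
    moreover have "tops (?t q) 8 \<noteq> 0" by (simp add: d tops_def)
    ultimately show "tops (?t q) 8 \<noteq> 0 \<and> ?G (?t q) = Some (?t (Suc q))" by blast
  next
    show "\<not> tops (?t l) 8 \<noteq> 0" by (simp add: tops_def)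
    show "l \<le> S" using bounds(6) m(2) by simp
  qed
  then have loop2: "exec S (Loop (\<lambda>r. r 8 \<noteq> 0) (Pop 8 ;; Push 7 (\<lambda>_. 3) ;; Push 3 (\<lambda>_. 1))) (?t 0) =
      Some (?t l)"
    by (simp only: exec.simps(6))
  let ?b = "if hd0 s = 2 then 2 else 1 :: nat"
  have push: "exec S (Push 7 (\<lambda>r. if r 9 = 2 then 2 else 1)) (?t l) = Some ((?t l)(7 :=
      ?b # replicate l 3 @ \<sigma> 7))"
    by (simp add: tops_def)
  have len: "length s \<le> 1"
  proof -
    have "fold scan1 E st = (u, v, f, l, m', s) \<Longrightarrow> length (snd (snd (snd (snd (snd st))))) \<le> 1 \<Longrightarrow>
        length s \<le> 1" for E st
    proof (induction E arbitrary: st)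
      case (Cons e E)
      obtain u' v' f' l' k' s' where "st = (u', v', f', l', k', s')" by (metis prod.exhaust)
      with Cons.IH[of "scan1 e st"] Cons.prems show ?case by (auto split: if_splits)
    qed simp
    from this[of D ?i] fin show ?thesis by (simp add: scan_def)
  qed
  \<comment> \<open>Clearing a recorded sign takes one round. A sign can only come from a nonempty
    certificate, whose length is bounded by \<open>S\<close>.\<close>
  have "1 \<le> S \<or> s = []"
  proof (cases "D = []")
    case True
    with fin show ?thesis by (simp add: scan_def)
  next
    case False
    then show ?thesis using D(3) by (cases D) auto
  qed
  then have c9: "exec S (clear 9) ((?t l)(7 := ?b # replicate l 3 @ \<sigma> 7)) =
      Some ((?t l)(7 := ?b # replicate l 3 @ \<sigma> 7, 9 := []))"
    by (intro exec_clear) (use bounds(7) len in auto)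
  have "s = [2] \<longleftrightarrow> hd0 s = 2" using len by (cases s) auto
  then have lk: "store_vals [lookup D m nm] = ?b # replicate l 3"
    by (simp add: lookup_def fin bit_def)
  have "(?t l)(7 := ?b # replicate l 3 @ \<sigma> 7, 9 := []) = \<sigma>(5 := [], 7 :=
      store_vals [lookup D m nm] @ \<sigma> 7)"
    unfolding lk using bounds(6) m(1) empty by (auto simp: fun_eq_iff)
  then show ?thesis
    unfolding lookup_prog_def exec.simps(4) loop bind.bind_lunit st mv c5 c6 c14 t0 loop2 push c9 by simp
qed

section \<open>Parsing and evaluation on stacks\<close>

fun letter :: "bool \<Rightarrow> bool \<Rightarrow> bool \<Rightarrow> prog" where
  "letter True True b = Push 5 (\<lambda>_. bit b)"
| "letter True False True = Cond (\<lambda>r. r 5 = 2) lookup_prog fail"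
| "letter True False False = Cond (\<lambda>r. r 5 = 0) (binary_op True) fail"
| "letter False True True = Cond (\<lambda>r. r 5 = 0) (binary_op False) fail"
| "letter False True False = Cond (\<lambda>r. r 5 = 0 \<and> r 7 \<noteq> 0) (flip 7) fail"
| "letter False False b = Cond (\<lambda>r. r 5 = 0) (Push 7 (\<lambda>_. bit b)) fail"

definition parse_store :: "nat list \<Rightarrow> nat \<Rightarrow> bool list \<Rightarrow> bool list \<Rightarrow> val list \<Rightarrow> store" where
  "parse_store D m r nm vs =
    (\<lambda>_. [])(1 := map bit r, 2 := D, 3 := replicate m 1, 5 := map bit nm, 7 := store_vals vs)"

lemma exec_fail: "\<exists>\<tau>. exec S fail \<sigma> = Some \<tau> \<and> hd0 (\<tau> 13) \<noteq> 0"
  by (simp add: fail_def)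

lemma hd0_bits:
  "hd0 (map bit nm) = 0 \<longleftrightarrow> nm = []" "hd0 (map bit nm) = 2 \<longleftrightarrow> (\<exists>bs. nm = True # bs)"
proof -
  show "hd0 (map bit nm) = 0 \<longleftrightarrow> nm = []" by (cases nm) (auto simp: bit_def)
  show "hd0 (map bit nm) = 2 \<longleftrightarrow> (\<exists>bs. nm = True # bs)" by (cases nm) (auto simp: bit_def)
qed

text \<open>Rejection must not make execution itself fail, as the machine has to halt on malformed
  words too. It is recorded on stack \<open>13\<close> instead.\<close>

lemma exec_letter:
  assumes "set D \<subseteq> {1..5}" "length D \<le> S" "m \<le> S" "length nm \<le> S" "\<And>v. v \<in> set vs \<Longrightarrow> snd v \<le> m"
  shows "case parse_letter (lookup D m) b1 b2 b3 (nm, vs) of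
      Some (nm', vs') \<Rightarrow> exec S (letter b1 b2 b3) (parse_store D m r nm vs) =
          Some (parse_store D m r nm' vs')
    | None \<Rightarrow> \<exists>\<tau>. exec S (letter b1 b2 b3) (parse_store D m r nm vs) = Some \<tau> \<and> hd0 (\<tau> 13) \<noteq> 0"
proof -
  let ?\<sigma> = "parse_store D m r nm vs"
  have t: "tops ?\<sigma> 5 = 0 \<longleftrightarrow> nm = []" "tops ?\<sigma> 5 = 2 \<longleftrightarrow> (\<exists>bs. nm = True # bs)"
    "tops ?\<sigma> 7 = 0 \<longleftrightarrow> vs = []"
    by (simp_all add: tops_def parse_store_def hd0_bits) (cases vs; auto simp: bit_def)
  have op: "case vs of x # y # ws \<Rightarrow> exec S (binary_op join) ?\<sigma> =
      Some (?\<sigma>(7 := store_vals ((if join then vjoin x y else vmeet x y) # ws)))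
    | _ \<Rightarrow> \<exists>\<tau>. exec S (binary_op join) ?\<sigma> = Some \<tau> \<and> hd0 (\<tau> 13) \<noteq> 0" for "join"
    by (rule exec_binary_op) (use assms(3,5) in \<open>force simp: parse_store_def\<close>)+
  have upd7: "(parse_store D m r nm vs)(7 := store_vals ws) = parse_store D m r nm ws" for nm vs ws
    by (simp add: parse_store_def)
  consider "b1" "b2" | "b1" "\<not> b2" "b3" | "b1" "\<not> b2" "\<not> b3" | "\<not> b1" "\<not> b2"
    | "\<not> b1" "b2" "\<not> b3" | "\<not> b1" "b2" "b3" by blast
  then show ?thesis
  proof cases
    case 1
    then show ?thesis by (simp add: parse_store_def fun_upd_twist)
  next
    case 2
    have "exec S lookup_prog ?\<sigma> = Some (?\<sigma>(5 := [], 7 := store_vals [lookup D m nm] @ ?\<sigma> 7))"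
      by (rule exec_lookup_prog[OF _ assms(1,2)]) (use assms in \<open>auto simp: parse_store_def\<close>)
    also have "?\<sigma>(5 := [], 7 := store_vals [lookup D m nm] @ ?\<sigma> 7) =
        parse_store D m r [] (lookup D m nm # vs)"
      by (simp add: parse_store_def store_vals_def fun_upd_twist)
    finally show ?thesis using 2 t(2) exec_fail[of S ?\<sigma>] by auto
  next
    case 3
    show ?thesis
    proof (cases "nm = []")
      case True
      with 3 t(1) op[of True] show ?thesis
        by (cases vs; cases "tl vs") (auto simp: upd7)
    next
      case False
      then have "parse_letter (lookup D m) b1 b2 b3 (nm, vs) = None"
        using 3 by (cases vs; cases "tl vs") auto
      with False 3 t(1) exec_fail[of S ?\<sigma>] show ?thesis by auto
    qed
  next
    case 4
    have "?\<sigma>(7 := bit b3 # ?\<sigma> 7) = parse_store D m r nm ((b3, 0) # vs)"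
      by (simp add: parse_store_def)
    with 4 t(1) exec_fail[of S ?\<sigma>] show ?thesis by auto
  next
    case 5
    show ?thesis
    proof (cases "nm = [] \<and> vs \<noteq> []")
      case True
      then obtain b l ws where vs: "vs = (b, l) # ws" by (cases vs) auto
      have "exec S (flip 7) ?\<sigma> = Some (?\<sigma>(7 := bit (\<not> b) # replicate l 3 @ store_vals ws))"
        by (rule exec_flip) (simp add: parse_store_def vs)
      also have "?\<sigma>(7 := bit (\<not> b) # replicate l 3 @ store_vals ws) = parse_store D m r nm (vneg (b,
          l) # ws)"
        by (simp add: parse_store_def vneg_def)
      finally show ?thesis using 5 True t(1,3) vs by simp
    next
      case False
      then have "parse_letter (lookup D m) b1 b2 b3 (nm, vs) = None"
        using 5 by (cases vs) auto
      with False 5 t(1,3) exec_fail[of S ?\<sigma>] show ?thesis by auto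
    qed
  next
    case 6
    show ?thesis
    proof (cases "nm = []")
      case True
      with 6 t(1) op[of False] show ?thesis
        by (cases vs; cases "tl vs") (auto simp: upd7)
    next
      case False
      then have "parse_letter (lookup D m) b1 b2 b3 (nm, vs) = None"
        using 6 by (cases vs; cases "tl vs") auto
      with False 6 t(1) exec_fail[of S ?\<sigma>] show ?thesis by auto
    qed
  qed
qed

lemma snd_lookup: "snd (lookup D m nm) \<le> m"
proof -
  have "fold scan1 D st = (u, v, f, l, m', s) \<Longrightarrow> l + m' =
      fst (snd (snd (snd st))) + fst (snd (snd (snd (snd st))))"
    for u v f l m' s st
  proof (induction D arbitrary: st)
    case (Cons d D)
    obtain u1 v1 f1 l1 m1 s1 where "st = (u1, v1, f1, l1, m1, s1)" by (metis prod.exhaust)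
    with Cons.IH[of "scan1 d st"] Cons.prems show ?case by (auto split: if_splits)
  qed simp
  then have "l + m' = m" if "scan D m nm = (u, v, f, l, m', s)" for u v f l m' s
    using that unfolding scan_def by fastforce
  then show ?thesis
    by (cases "scan D m nm") (simp add: lookup_def)
qed

lemma snd_vmeet: "snd x \<le> m \<Longrightarrow> snd y \<le> m \<Longrightarrow> snd (vmeet x y) \<le> m"
  by (simp add: vmeet_def)

lemma snd_vjoin: "snd x \<le> m \<Longrightarrow> snd y \<le> m \<Longrightarrow> snd (vjoin x y) \<le> m"
  by (simp add: vjoin_def snd_vmeet)

lemma parse_letter_bounds:
  assumes "parse_letter look b1 b2 b3 (nm, vs) = Some (nm', vs')"
    and "\<And>w. snd (look w) \<le> m" "\<forall>v \<in> set vs. snd v \<le> m"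
  shows "length nm' \<le> Suc (length nm) \<and> (\<forall>v \<in> set vs'. snd v \<le> m)"
  using assms
  by (induction look b1 b2 b3 "(nm, vs)" arbitrary: nm vs rule: parse_letter.induct)
    (auto simp: snd_vmeet snd_vjoin simp del: split_paired_All split: if_splits)

definition read_bit :: "(bool \<Rightarrow> prog) \<Rightarrow> prog" where
  "read_bit f = Cond (\<lambda>r. r 1 = 0) fail (Cond (\<lambda>r. r 1 = 2) (Pop 1 ;; f True) (Pop 1 ;; f False))"

lemma exec_read_bit:
  "exec S (read_bit f) (parse_store D m (b # r) nm vs) = exec S (f b) (parse_store D m r nm vs)"
proof -
  have "(parse_store D m (b # r) nm vs)(1 := map bit r) = parse_store D m r nm vs"
    by (simp add: parse_store_def fun_upd_twist)
  then show ?thesis by (cases b) (simp_all add: read_bit_def parse_store_def tops_def bit_def)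
qed

lemma exec_read_bit_fail:
  "\<exists>\<tau>. exec S (read_bit f) (parse_store D m [] nm vs) = Some \<tau> \<and> hd0 (\<tau> 13) \<noteq> 0"
  using exec_fail by (simp add: read_bit_def parse_store_def tops_def)

definition read_letter :: prog where
  "read_letter = read_bit (\<lambda>b3. read_bit (\<lambda>b2. read_bit (\<lambda>b1. letter b1 b2 b3)))"

definition parse_prog :: prog where
  "parse_prog = Loop (\<lambda>r. r 1 \<noteq> 0 \<and> r 13 = 0) read_letter"

text \<open>\<open>F\<close> counts the rounds left, separately from the bound \<open>S\<close> for
  loops inside a round. A round consumes three bits and adds at most one digit, so
  \<open>length r + length nm\<close> never grows.\<close>

lemma exec_parse:
  assumes D: "set D \<subseteq> {1..5}" "length D \<le> S" "m \<le> S"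
    and "length r + length nm \<le> S" "\<And>v. v \<in> set vs \<Longrightarrow> snd v \<le> m" "length r \<le> F"
  shows "\<exists>\<tau>. iterate (\<lambda>r. r 1 \<noteq> 0 \<and> r 13 = 0) (exec S read_letter) F (parse_store D m r nm vs) = Some \<tau> \<and>
    (case parse (lookup D m) r (nm, vs) of
      Some (nm', vs') \<Rightarrow> \<tau> = parse_store D m [] nm' vs' \<and> (\<forall>v \<in> set vs'. snd v \<le> m)
    | None \<Rightarrow> hd0 (\<tau> 13) \<noteq> 0)"
  using assms(4-)
proof (induction "length r" arbitrary: r nm vs F rule: less_induct)
  case less
  let ?it = "iterate (\<lambda>r. r 1 \<noteq> 0 \<and> r 13 = 0) (exec S read_letter)"
  have stop: "?it F \<tau> = Some \<tau>" if "hd0 (\<tau> 13) \<noteq> 0" for \<tau> F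
    using that by (cases F) (simp_all add: tops_def)
  show ?case
  proof (cases "r = []")
    case True
    then show ?thesis using less.prems(2) by (cases F) (simp_all add: tops_def parse_store_def)
  next
    case False
    then obtain F' where F: "F = Suc F'" using less.prems(3) by (cases F) auto
    have "tops (parse_store D m r nm vs) 1 \<noteq> 0" "tops (parse_store D m r nm vs) 13 = 0"
      using False by (simp_all add: tops_def parse_store_def hd0_bits)
    then have it: "?it F (parse_store D m r nm vs) =
        Option.bind (exec S read_letter (parse_store D m r nm vs)) (?it F')"
      by (simp add: F)
    have failed: "\<exists>\<tau>. ?it F (parse_store D m r nm vs) = Some \<tau> \<and> hd0 (\<tau> 13) \<noteq> 0"
      if "\<exists>\<tau>. exec S read_letter (parse_store D m r nm vs) = Some \<tau> \<and> hd0 (\<tau> 13) \<noteq> 0"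
      using that stop unfolding it by auto
    consider b where "r = [b]" | b c where "r = [b, c]" | b3 b2 b1 r' where "r = b3 # b2 # b1 # r'"
      using False by (metis list.exhaust)
    then show ?thesis
    proof cases
      case 1
      then show ?thesis using failed exec_read_bit_fail
        by (simp add: read_letter_def exec_read_bit)
    next
      case 2
      then show ?thesis using failed exec_read_bit_fail
        by (simp add: read_letter_def exec_read_bit)
    next
      case 3
      have ex: "exec S read_letter (parse_store D m r nm vs) =
          exec S (letter b1 b2 b3) (parse_store D m r' nm vs)"
        by (simp add: 3 read_letter_def exec_read_bit)
      have nm: "length nm \<le> S" using less.prems(1) by simp
      have letter: "case parse_letter (lookup D m) b1 b2 b3 (nm, vs) of
          Some (nm', vs') \<Rightarrow> exec S (letter b1 b2 b3) (parse_store D m r' nm vs) =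
              Some (parse_store D m r' nm' vs')
        | None \<Rightarrow> \<exists>\<tau>. exec S (letter b1 b2 b3) (parse_store D m r' nm vs) = Some \<tau> \<and> hd0 (\<tau> 13) \<noteq> 0"
        by (rule exec_letter[OF D nm less.prems(2)])
      show ?thesis
      proof (cases "parse_letter (lookup D m) b1 b2 b3 (nm, vs)")
        case None
        with letter failed ex show ?thesis by (simp add: 3)
      next
        case (Some st)
        obtain nm' vs' where st: "st = (nm', vs')" by (cases st)
        have b: "length nm' \<le> Suc (length nm) \<and> (\<forall>v \<in> set vs'. snd v \<le> m)"
          by (rule parse_letter_bounds[OF Some[unfolded st] snd_lookup]) (use less.prems(2) in blast)
        have "\<exists>\<tau>. ?it F' (parse_store D m r' nm' vs') = Some \<tau> \<and>
          (case parse (lookup D m) r' (nm', vs') of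
            Some (nm', vs') \<Rightarrow> \<tau> = parse_store D m [] nm' vs' \<and> (\<forall>v \<in> set vs'. snd v \<le> m)
          | None \<Rightarrow> hd0 (\<tau> 13) \<noteq> 0)"
          by (rule less.hyps) (use less.prems 3 b F in auto)
        moreover have "?it F (parse_store D m r nm vs) = ?it F' (parse_store D m r' nm' vs')"
          unfolding it ex using letter Some st by simp
        ultimately show ?thesis using Some st by (simp add: 3)
      qed
    qed
  qed
qed

text \<open>For \<open>None\<close> the supply of labels is the unary input length left on
  \<open>3\<close> by the guessing phase; \<open>Some c\<close> replaces it by a constant.\<close>

definition verifier :: "nat option \<Rightarrow> prog" where
  "verifier \<kappa> = (case \<kappa> of None \<Rightarrow> Skip | Some c \<Rightarrow> clear 3 ;; push_ones 3 c) ;; parse_prog ;;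
    Cond (\<lambda>r. r 13 = 0 \<and> r 7 \<noteq> 0) (take_entry 8 9) Skip"

text \<open>A complete parse leaves no pending digits and exactly one value: with this value taken
  out, \<open>7\<close> is empty and \<open>9\<close> is not. Its sign and whether its label is zero
  suffice to recognise \<open>bot\<close> and \<open>top\<close>.\<close>

definition verified :: "(bool \<Rightarrow> bool \<Rightarrow> bool) \<Rightarrow> (nat \<Rightarrow> nat) \<Rightarrow> bool" where
  "verified P r \<longleftrightarrow> r 13 = 0 \<and> r 5 = 0 \<and> r 7 = 0 \<and> r 9 \<noteq> 0 \<and> P (r 9 = 2) (r 8 = 0)"

lemma exec_verifier:
  assumes "length cs = length x" "set cs \<subseteq> {1..5}"
    and m: "m = (case \<kappa> of None \<Rightarrow> length x | Some c \<Rightarrow> c)" and S: "length x \<le> S" "m \<le> S"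
  shows "\<exists>\<tau>. exec S (verifier \<kappa>) (start x cs) = Some \<tau> \<and> (verified P (tops \<tau>) \<longleftrightarrow>
    (\<exists>v. parse (lookup (rev cs) m) (rev x) ([], []) = Some ([], [v]) \<and> P (fst v) (snd v = 0)))"
proof -
  let ?D = "rev cs"
  have start: "start x cs = parse_store ?D (length x) (rev x) [] []"
    by (auto simp: start_def loaded_def parse_store_def fun_eq_iff rev_map)
  have init: "exec S (case \<kappa> of None \<Rightarrow> Skip | Some c \<Rightarrow> clear 3 ;; push_ones 3 c) (start x cs) =
      Some (parse_store ?D m (rev x) [] [])"
  proof (cases \<kappa>)
    case None
    then show ?thesis using m start by simp
  next
    case (Some c)
    have "exec S (clear 3) (start x cs) = Some ((start x cs)(3 := []))"
      by (rule exec_clear) (use S in \<open>auto simp: start parse_store_def\<close>)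
    then show ?thesis using m Some
      by (simp add: exec_push_ones) (simp add: start parse_store_def fun_eq_iff)
  qed
  obtain \<tau> where \<tau>: "exec S parse_prog (parse_store ?D m (rev x) [] []) = Some \<tau>"
    "case parse (lookup ?D m) (rev x) ([], []) of
      Some (nm', vs') \<Rightarrow> \<tau> = parse_store ?D m [] nm' vs' \<and> (\<forall>v \<in> set vs'. snd v \<le> m)
    | None \<Rightarrow> hd0 (\<tau> 13) \<noteq> 0"
    using exec_parse[of ?D S m "rev x" "[]" "[]" S] assms S by (auto simp: parse_prog_def)
  have run: "exec S (verifier \<kappa>) (start x cs) =
      exec S (Cond (\<lambda>r. r 13 = 0 \<and> r 7 \<noteq> 0) (take_entry 8 9) Skip) \<tau>"
    unfolding verifier_def exec.simps(4) init bind.bind_lunit \<tau>(1) ..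
  show ?thesis
  proof (cases "parse (lookup ?D m) (rev x) ([], [])")
    case None
    then show ?thesis using \<tau>(2) run by (simp add: tops_def verified_def)
  next
    case (Some st)
    obtain nm vs where st: "st = (nm, vs)" by (cases st)
    have t: "\<tau> = parse_store ?D m [] nm vs" "\<And>v. v \<in> set vs \<Longrightarrow> snd v \<le> m"
      using \<tau>(2) Some st by auto
    show ?thesis
    proof (cases vs)
      case Nil
      then show ?thesis using run Some st by (simp add: t(1) parse_store_def tops_def verified_def)
    next
      case (Cons v ws)
      obtain b l where v: "v = (b, l)" by (cases v)
      have l: "l \<le> S" using t(2)[of v] Cons v S(2) by simp
      have "exec S (take_entry 8 9) \<tau> = Some (\<tau>(7 := store_vals ws, 8 := replicate l 3, 9 := [bit b]))"
        by (rule exec_take_entry) (use l in \<open>simp_all add: t(1) parse_store_def Cons v hd0_store_vals\<close>)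
      moreover have "tops \<tau> 13 = 0 \<and> tops \<tau> 7 \<noteq> 0"
        by (simp add: t(1) parse_store_def tops_def Cons v bit_def)
      ultimately have "exec S (verifier \<kappa>) (start x cs) =
          Some (\<tau>(7 := store_vals ws, 8 := replicate l 3, 9 := [bit b]))"
        unfolding run by simp
      moreover have "hd0 (store_vals ws) = 0 \<longleftrightarrow> ws = []"
        by (cases ws) (auto simp: bit_def)
      ultimately show ?thesis using Some st
        by (auto simp: verified_def tops_def t(1) parse_store_def hd0_bits hd0_replicate Cons v bit_def)
    qed
  qed
qed

lemma wf_verifier: "wf 15 6 (verifier \<kappa>)"
proof -
  have take: "wf 15 6 (take_entry a s)" if "a < 15" "s < 15" for a s
    using that by (simp add: take_entry_def)
  have fail: "wf 15 6 fail" by (simp add: fail_def)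
  have flip: "wf 15 6 (flip j)" if "j < 15" for j using that by (simp add: flip_def)
  have meet: "wf 15 6 meet_prog" by (simp add: meet_prog_def wf_move wf_clear)
  have op: "wf 15 6 (binary_op j)" for j
    by (simp add: binary_op_def take fail flip meet)
  have scan: "wf 15 6 scan_letter"
    by (auto simp: scan_letter_def wf_move wf_clear intro: le_less_trans[OF diff_le_self])
  then have "wf 15 6 lookup_prog" by (simp add: lookup_prog_def wf_move wf_clear)
  then have letter: "wf 15 6 (letter b1 b2 b3)" for b1 b2 b3
    by (cases "(b1, b2, b3)" rule: letter.cases) (simp_all add: op fail flip bit_def)
  have "wf 15 6 parse_prog"
    by (simp add: parse_prog_def read_letter_def read_bit_def fail letter del: letter.simps)
  moreover have "wf 15 6 (push_ones 3 c)" for c by (induction c) auto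
  ultimately show ?thesis by (simp add: verifier_def take wf_clear split: option.split)
qed

lemma (in height_two) independent_mono:
  "independent (q::nat \<Rightarrow> 'a) m \<Longrightarrow> m' \<le> m \<Longrightarrow> independent q m'"
  by (simp add: independent_def)

text \<open>The supply of labels is bounded by the number of nontrivial blocks only if this is finite.\<close>

lemma (in height_two) in_NP:
  fixes Q :: "'a \<Rightarrow> bool"
  assumes PQ: "\<And>q m v. independent (q::nat \<Rightarrow> 'a) m \<Longrightarrow> snd v \<le> m \<Longrightarrow> Q (interp q v) \<longleftrightarrow> P (fst v) (snd v = 0)"
  shows "{encode t | t. \<exists>a::nat \<Rightarrow> 'a. Q (ol_eval a t)} \<in> NP"
proof -
  define ex where "ex m \<longleftrightarrow> (\<exists>q::nat \<Rightarrow> 'a. independent q m)" for m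
  \<comment> \<open>If the sizes of independent families are bounded, \<open>c'\<close> is the
    largest one, and further labels would have no interpretation. Otherwise the input length is
    always available.\<close>
  obtain \<kappa> where \<kappa>: "\<And>n. ex (case \<kappa> of None \<Rightarrow> n | Some c \<Rightarrow> c)"
    "\<And>n m. ex m \<Longrightarrow> m \<le> n \<Longrightarrow> m \<le> (case \<kappa> of None \<Rightarrow> n | Some c \<Rightarrow> c)"
  proof (cases "\<forall>m. ex m")
    case True
    then show ?thesis by (intro that[of None]) simp_all
  next
    case False
    then obtain c where c: "\<not> ex c" "\<And>m. m < c \<Longrightarrow> ex m"
      using exists_least_iff[of "\<lambda>m. \<not> ex m"] by blast
    have "ex 0" by (simp add: ex_def independent_def)
    then obtain c' where c': "c = Suc c'" using c(1) by (cases c) auto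
    have le: "m \<le> c'" if "ex m" for m
    proof (rule ccontr)
      assume "\<not> m \<le> c'"
      then have "c \<le> m" using c' by simp
      then have "ex c" using that independent_mono unfolding ex_def by blast
      with c(1) show False by contradiction
    qed
    show ?thesis
      by (rule that[of "Some c'"]) (use c(2)[of c'] c' le in simp_all)
  qed
  define m where "m n = (case \<kappa> of None \<Rightarrow> n | Some c \<Rightarrow> c)" for n
  let ?c = "case \<kappa> of None \<Rightarrow> 0 | Some c \<Rightarrow> c"
  let ?S = "[:?c, 1:]"
  have S: "n \<le> poly ?S n" "m n \<le> poly ?S n" for n
    by (auto simp: m_def split: option.split)
  interpret guess_and_run 15 6 5 "verifier \<kappa>" "verified P" ?S
  proof
    fix cs :: "nat list" and x :: "bool list"
    assume "length cs = length x" "set cs \<subseteq> {1..5}"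
    from exec_verifier[OF this m_def S, of P]
    show "\<exists>\<tau>. exec (poly ?S (length x)) (verifier \<kappa>) (start x cs) = Some \<tau>" by blast
  qed (simp_all add: wf_verifier)
  have res: "verified P (tops (result x cs)) \<longleftrightarrow>
      (\<exists>v. parse (lookup (rev cs) (m (length x))) (rev x) ([], []) = Some ([], [v]) \<and>
          P (fst v) (snd v = 0))"
    if "length cs = length x" "set cs \<subseteq> {1..5}" for x cs
    using exec_verifier[OF that m_def S, of P] unfolding result_def by auto
  have "x \<in> {encode t | t. \<exists>a::nat \<Rightarrow> 'a. Q (ol_eval a t)} \<longleftrightarrow> accepts M x" for x
  proof
    assume "accepts M x"
    then obtain cs where cs: "length cs = length x" "set cs \<subseteq> {1..5}" "verified P (tops (result x cs))"
      unfolding accepts_iff by blast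
    let ?\<alpha> = "\<lambda>i. lookup (rev cs) (m (length x)) (binary (Suc i))"
    obtain t where t: "x = encode t" "P (fst (veval ?\<alpha> t)) (snd (veval ?\<alpha> t) = 0)"
      using cs(3) unfolding res[OF cs(1,2)] parse_iff by blast
    \<comment> \<open>Any independent family of this size will do: the guessed codes are arbitrary,
      and interpreting them in the family gives an assignment.\<close>
    obtain q :: "nat \<Rightarrow> 'a" where q: "independent q (m (length x))"
      using \<kappa>(1)[of "length x"] unfolding m_def ex_def by blast
    have "snd (veval ?\<alpha> t) \<le> m (length x) \<and> interp q (veval ?\<alpha> t) = ol_eval (interp q \<circ> ?\<alpha>) t"
      by (rule interp_veval[OF q]) (simp add: snd_lookup)
    with PQ[OF q, of "veval ?\<alpha> t"] t(2) have "Q (ol_eval (interp q \<circ> ?\<alpha>) t)" by simp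
    with t(1) show "x \<in> {encode t | t. \<exists>a::nat \<Rightarrow> 'a. Q (ol_eval a t)}" by blast
  next
    assume "x \<in> {encode t | t. \<exists>a::nat \<Rightarrow> 'a. Q (ol_eval a t)}"
    then obtain t a where t: "x = encode t" "Q (ol_eval (a::nat \<Rightarrow> 'a) t)" by blast
    obtain q k \<alpha> where q: "independent (q::nat \<Rightarrow> 'a) k" "k \<le> card (vars t)"
      and \<alpha>: "\<And>i. i \<in> vars t \<Longrightarrow> snd (\<alpha> i) \<le> k \<and> interp q (\<alpha> i) = a i"
      using representatives[OF finite_vars, of t a] by blast
    obtain vs where vs: "set vs = vars t" "distinct vs"
      using finite_distinct_list[OF finite_vars] by blast
    have "card (vars t) + ((\<Sum>i \<in> vars t. length (var_name i) + 1) + 1) \<le> length x"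
    proof -
      have "(\<Sum>i \<in> vars t. length (var_name i) + 2) =
          (\<Sum>i \<in> vars t. length (var_name i) + 1) + (\<Sum>i \<in> vars t. 1)"
        unfolding sum.distrib[symmetric] by simp
      then show ?thesis using length_encode[of t] by (simp only: t(1) card_eq_sum)
    qed
    moreover have "(\<Sum>i \<in> {i \<in> set vs. snd (\<alpha> i) < Suc k}. length (var_name i) + 1) \<le>
        (\<Sum>i \<in> vars t. length (var_name i) + 1)"
      using vs(1) finite_vars by (intro sum_mono2) auto
    ultimately have len: "length (certificate \<alpha> vs (Suc k)) \<le> length x"
      using length_certificate[OF vs(2), of \<alpha> "Suc k"] q(2) by linarith
    have kx: "k \<le> length x" using len length_certificate[OF vs(2), of \<alpha> "Suc k"] by simp
    have "ex k" using q(1) unfolding ex_def by blast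
    then have km: "k \<le> m (length x)" using \<kappa>(2)[OF _ kx] unfolding m_def by blast
    \<comment> \<open>A guess has exactly the input length. The padding letters 5 follow all entries
      and cannot disturb a sign already found. Since the machine stores its guess reversed, the
      string guessed is \<open>rev D\<close>.\<close>
    define D where "D = certificate \<alpha> vs (Suc k) @
        replicate (length x - length (certificate \<alpha> vs (Suc k))) 5"
    have D: "length (rev D) = length x" "set (rev D) \<subseteq> {1..5}"
      using len set_certificate[of \<alpha> vs "Suc k"] by (auto simp: D_def)
    have look: "lookup D (m (length x)) (binary (Suc i)) = \<alpha> i" if "i \<in> vars t" for i
      unfolding D_def var_name_def[symmetric]
      by (rule lookup_certificate) (use that vs(1) \<alpha>[OF that] km in auto)
    let ?\<beta> = "\<lambda>i. lookup D (m (length x)) (binary (Suc i))"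
    have "snd (veval ?\<beta> t) \<le> k \<and> interp q (veval ?\<beta> t) = ol_eval a t"
      by (rule interp_veval[OF q(1)]) (simp add: look \<alpha>)
    with PQ[OF q(1), of "veval ?\<beta> t"] t(2) have "P (fst (veval ?\<beta> t)) (snd (veval ?\<beta> t) = 0)" by simp
    then have "verified P (tops (result x (rev D)))"
      unfolding res[OF D] rev_rev_ident parse_iff using t(1) by blast
    with D show "accepts M x" unfolding accepts_iff by blast
  qed
  then show ?thesis unfolding NP_def using turing_machine polynomial_time by blast
qed

theorem theorem2p14:
  assumes "has_dimension TYPE('a::modular_ortholattice) 2"
  shows "NP_complete (strong_SAT TYPE('a)) \<and> NP_complete (weak_SAT TYPE('a))"
proof -
  interpret height_two "TYPE('a)" using assms by (rule height_two_if_dimension)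
  have "strong_SAT TYPE('a) \<in> NP"
    unfolding strong_SAT_def
  proof (rule in_NP[where Q = "\<lambda>y. y = top" and P = "\<lambda>b z. b \<and> z"])
    fix q :: "nat \<Rightarrow> 'a" and m and v :: val
    assume q: "independent q m" "snd v \<le> m"
    have "interp q v = interp q (True, 0) \<longleftrightarrow> v = (True, 0)"
      using interp_inject[OF q, of "(True, 0)"] by (metis snd_conv zero_le)
    then show "interp q v = top \<longleftrightarrow> fst v \<and> snd v = 0"
      by (simp add: interp_def[of q "(True, 0)"] prod_eq_iff)
  qed
  moreover have "weak_SAT TYPE('a) \<in> NP"
    unfolding weak_SAT_def
  proof (rule in_NP[where Q = "\<lambda>y. y \<noteq> bot" and P = "\<lambda>b z. b \<or> \<not> z"])
    fix q :: "nat \<Rightarrow> 'a" and m and v :: val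
    assume q: "independent q m" "snd v \<le> m"
    have "interp q v = interp q (False, 0) \<longleftrightarrow> v = (False, 0)"
      using interp_inject[OF q, of "(False, 0)"] by (metis snd_conv zero_le)
    then show "interp q v \<noteq> bot \<longleftrightarrow> fst v \<or> \<not> snd v = 0"
      by (simp add: interp_def[of q "(False, 0)"] prod_eq_iff)
  qed
  moreover have "polynomial_reducible A (strong_SAT TYPE('a)) \<and>
      polynomial_reducible A (weak_SAT TYPE('a))"
    if "A \<in> NP" for A
    using height_two_if_dimension[OF assms] that by (rule NP_hard)
  ultimately show ?thesis unfolding NP_complete_def by blast
qed

end
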